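(* Let $L_0>2m_0>0$ with $L_0/m_0<4$. Then the MKN black hole with parameters $(L_0,m_0)$ cannot be put into stationary rotation along a deformation family with $L/m$ varying continuously and with $q$ metrically complete at infinity for all $\lambda$. That is, there does not exist a family $(\mathfrak{g}_\lambda)_{\lambda\in I}$, with $I\subset\mathbb{R}$ a non-degenerate interval containing $0$, of (vacuum) periodic stationary and axisymmetric black hole metrics $$\mathfrak{g}_{\lambda} = -V_{\lambda}dt^{2}+2W_{\lambda}d\varphi dt+\eta_{\lambda}d\varphi^{2}+\frac{e^{2\gamma_{\lambda}}}{\eta_{\lambda}}(d\rho^{2}+dz^{2})$$ with periods $L_\lambda$ and horizon length parameters $m_\lambda$, such that $\mathfrak{g}_0$ is the MKN black hole with parameters $(L_0,m_0)$, the function $\lambda\mapsto L_\lambda/m_\lambda$ is continuous, the angular momentum of $\mathfrak{g}_\lambda$ is non-zero for all $\lambda\neq0$, and the 2-metric $q_\lambda=e^{2\gamma_\lambda}(dz^2+d\rho^2)$ is metrically complete at infinity for all $\lambda$.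
   Context: Periodic stationary and axisymmetric black hole with period $L$ and horizon length parameter $m$ (where $L/2>m>0$): a solution of the vacuum Einstein equations ${\rm Ric}(\mathfrak{g})=0$ given in Weyl-Papapetrou coordinates $(t,\varphi,z,\rho)$, $t\in\mathbb{R}$, $\varphi\in\mathbb{R}/2\pi\mathbb{Z}$, $\rho>0$, $z\in\mathbb{R}$, by $$\mathfrak{g} = -V\,dt^{2}+2W\,d\varphi\, dt+\eta\, d\varphi^{2}+\frac{e^{2\gamma}}{\eta}(d\rho^{2}+dz^{2}),$$ where $V,W,\eta,\gamma$ are smooth functions of $(z,\rho)$ that are $L$-periodic in $z$, $\eta>0$, and $V\eta+W^{2}=\rho^{2}$. Because of periodicity, $z$ is regarded as an element of $\mathbb{R}/L\mathbb{Z}$, represented by $-L/2\le z\le L/2$ with endpoints identified. The boundary $\{\rho=0\}$ consists of the horizon $\{-m\le z\le m\}$ (a single horizon, of coordinate length $2m$) and the axis $\{m<|z|\le L/2\}$. The spacetime is required to be regular there: the metric extends smoothly across the axis, which is the fixed point set of the rotational Killing field $\partial_\varphi$ (no conical singularities, "no struts"), and extends smoothly to a non-degenerate Killing horizon with spherical cross-sections corresponding to $\{\rho=0,\ |z|\le m\}$, whose two poles are at $z=\pm m$. In particular $\eta$ has the usual black hole boundary behaviour as $\rho\to0$: with $$\omega_{S}(z,\rho)=\ln\left(\frac{\sqrt{(z-m)^{2}+\rho^{2}}+\sqrt{(z+m)^{2}+\rho^{2}}-2m}{\sqrt{(z-m)^{2}+\rho^{2}}+\sqrt{(z+m)^{2}+\rho^{2}}+2m}\right)$$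 for $|z|\le L/2$, the function $\ln\eta-2\ln\rho+\omega_S$ is bounded near $\rho=0$ and extends continuously to $\{\rho=0\}$; $\rho\,\partial_\rho\ln\eta\to 2$ at points of the axis and $\rho\,\partial_\rho\ln\eta\to0$ at points of the horizon with $|z|<m$. The spatial hypersurfaces $\{t={\rm const}\}$, with spatial metric $\eta\,d\varphi^2+\frac{e^{2\gamma}}{\eta}(d\rho^2+dz^2)$, are always assumed to be metrically complete at infinity. No other assumption is made on the asymptotic behaviour as $\rho\to\infty$, and in a deformation family no continuity in $\lambda$ of $V_\lambda,W_\lambda,\eta_\lambda,\gamma_\lambda$ is required, only that of $L_\lambda/m_\lambda$. Complete at infinity: $q$ (respectively, the spatial metric) is metrically complete at infinity if for $\rho_0>0$ the region $\{\rho\ge\rho_0\}$ with the induced Riemannian distance is a complete metric space (equivalently, every curve along which $\rho\to\infty$ has infinite length). Angular momentum: the Komar angular momentum of the rotational Killing field $\xi=\partial_\varphi$, $J=\frac{1}{16\pi}\int_{\Sigma}\star d\xi^{\flat}$, where $\Sigma$ is the horizon cross-section or, equivalently, any 2-torus $\{t={\rm const},\ \rho={\rm const}\}$ in the quotient by $z\mapsto z+L$ (the overall sign is immaterial here). MKN (Myers/Korotkin-Nicolai, "periodic Schwarzschild") black hole with parameters $(L,m)$, $L/2>m>0$: the static vacuum metric $$\mathfrak{g}_{\rm MKN}=-e^{\omega}dt^{2}+e^{-\omega}\big(e^{2k}(dz^{2}+d\rho^{2})+\rho^{2}d\varphi^{2}\big),$$ quotiented by $z\mapsto z+L$, where, with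 $$\omega_{S}(z,\rho)=\ln\left(\frac{\sqrt{(z-m)^{2}+\rho^{2}}+\sqrt{(z+m)^{2}+\rho^{2}}-2m}{\sqrt{(z-m)^{2}+\rho^{2}}+\sqrt{(z+m)^{2}+\rho^{2}}+2m}\right)$$ for all $z\in\mathbb{R}$, $\rho>0$, $$\omega(z,\rho)=\omega_S(z,\rho)+\sum_{j\in\mathbb{Z}\setminus\{0\}}\Big(\omega_S(z+jL,\rho)+\frac{2m}{|j|L}\Big),$$ and $k$ is the ($L$-periodic) solution of $k_{\rho}=\frac{\rho}{4}(\omega_{\rho}^{2}-\omega_{z}^{2})$, $k_{z}=\frac{\rho}{2}\omega_{z}\omega_{\rho}$ normalized so that $k=0$ on the axis $\{\rho=0,\ m<|z|\le L/2\}$ (no struts). It is a periodic stationary and axisymmetric black hole with period $L$ and horizon length parameter $m$, with $V=e^\omega$, $W=0$, $\eta=\rho^2e^{-\omega}$, $e^{2\gamma}=\rho^{2}e^{2k-2\omega}$, and zero angular momentum. *)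

theory Defs
  imports "HOL-Analysis.Analysis"
begin

section \<open>Smooth functions\<close>

primrec Ck_on :: "nat \<Rightarrow> ('a::euclidean_space \<Rightarrow> real) \<Rightarrow> 'a set \<Rightarrow> bool" where
  "Ck_on 0 f S \<longleftrightarrow> continuous_on S f"
| "Ck_on (Suc k) f S \<longleftrightarrow>
     f differentiable_on S \<and> (\<forall>b\<in>Basis. Ck_on k (\<lambda>x. frechet_derivative f (at x) b) S)"

text \<open>Only used for open sets \<open>S\<close>.\<close>

definition smooth_on :: "('a::euclidean_space \<Rightarrow> real) \<Rightarrow> 'a set \<Rightarrow> bool" where
  "smooth_on f S \<longleftrightarrow> (\<forall>k. Ck_on k f S)"


section \<open>Metrics and curvature in coordinates\<close>

type_synonym metric4 = "real ^ 4 \<Rightarrow> real ^ 4 ^ 4"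

definition pd :: "'n \<Rightarrow> (real ^ 'n \<Rightarrow> real) \<Rightarrow> real ^ 'n::finite \<Rightarrow> real" where
  "pd i f x = frechet_derivative f (at x) (axis i 1)"

definition christoffel :: "metric4 \<Rightarrow> 4 \<Rightarrow> 4 \<Rightarrow> 4 \<Rightarrow> real ^ 4 \<Rightarrow> real" where
  "christoffel g a b c x =
     (\<Sum>d\<in>UNIV. matrix_inv (g x) $ a $ d *
        (pd b (\<lambda>y. g y $ d $ c) x + pd c (\<lambda>y. g y $ d $ b) x - pd d (\<lambda>y. g y $ b $ c) x)) / 2"

definition ricci :: "metric4 \<Rightarrow> 4 \<Rightarrow> 4 \<Rightarrow> real ^ 4 \<Rightarrow> real" where
  "ricci g b c x =
     (\<Sum>a\<in>UNIV. pd a (christoffel g a b c) x - pd c (christoffel g a b a) x) +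
     (\<Sum>a\<in>UNIV. \<Sum>d\<in>UNIV. christoffel g a a d x * christoffel g d b c x
                       - christoffel g a c d x * christoffel g d b a x)"

definition lorentzian :: "real ^ 4 ^ 4 \<Rightarrow> bool" where
  "lorentzian A \<longleftrightarrow> transpose A = A \<and>
     (\<exists>P :: real ^ 4 ^ 4. invertible P \<and>
        transpose P ** A ** P = (\<chi> i j. if i = j then (if i = 1 then -1 else 1) else 0))"


section \<open>The Weyl-Papapetrou form\<close>

text \<open>Coordinates are ordered as \<open>(t, \<phi>, z, \<rho>)\<close>, with indices 1, 2, 3, 4; in the type \<open>4\<close> the
  numeral \<open>4\<close> denotes the same element as \<open>0\<close>, which is distinct from 1, 2, 3.\<close>

definition weyl_domain :: "(real ^ 4) set" where
  "weyl_domain = {x. x $ 4 > 0}"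

definition weyl_metric ::
  "(real \<Rightarrow> real \<Rightarrow> real) \<Rightarrow> (real \<Rightarrow> real \<Rightarrow> real) \<Rightarrow> (real \<Rightarrow> real \<Rightarrow> real) \<Rightarrow> (real \<Rightarrow> real \<Rightarrow> real) \<Rightarrow> metric4"
where
  "weyl_metric V W \<eta> \<gamma> x =
     (let z = x $ 3; \<rho> = x $ 4; f = exp (2 * \<gamma> z \<rho>) / \<eta> z \<rho> in
      vector [vector [- V z \<rho>, W z \<rho>, 0, 0],
              vector [  W z \<rho>, \<eta> z \<rho>, 0, 0],
              vector [      0,     0, f, 0],
              vector [      0,     0, 0, f]])"


section \<open>Regularity at the axis and at the horizon\<close>

text \<open>The metric \<open>g\<close> on the Weyl domain extends smoothly, in the coordinates \<open>\<Psi>\<close>, to a Lorentzian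
  metric \<open>h\<close> near the point \<open>p\<close>: there \<open>g\<close> is the pullback of \<open>h\<close> under \<open>\<Psi>\<close>.\<close>

definition extends_to :: "metric4 \<Rightarrow> (real ^ 4 \<Rightarrow> real ^ 4) \<Rightarrow> real ^ 4 \<Rightarrow> bool" where
  "extends_to g \<Psi> p \<longleftrightarrow>
     (\<exists>U h. open U \<and> p \<in> U \<and>
        (\<forall>i j. smooth_on (\<lambda>y. h y $ i $ j) U) \<and> (\<forall>y\<in>U. lorentzian (h y)) \<and>
        (\<forall>x\<in>weyl_domain. \<Psi> x \<in> U \<longrightarrow>
           (\<forall>u v. u \<bullet> (g x *v v) =
                  frechet_derivative \<Psi> (at x) u \<bullet> (h (\<Psi> x) *v frechet_derivative \<Psi> (at x) v))))"

text \<open>Near the axis: the Cartesian coordinates \<open>(t, \<rho> cos \<phi>, \<rho> sin \<phi>, z)\<close>, with \<open>\<phi>\<close> of period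
  \<open>2 * pi\<close>; smoothness of the extension excludes conical singularities.\<close>

definition axis_chart :: "real ^ 4 \<Rightarrow> real ^ 4" where
  "axis_chart x = vector [x $ 1, x $ 4 * cos (x $ 2), x $ 4 * sin (x $ 2), x $ 3]"

text \<open>Near the horizon: Kruskal-type coordinates adapted to the Killing field
  \<open>\<partial>\<^sub>t + \<Omega> \<partial>\<^sub>\<phi>\<close>, which becomes \<open>\<kappa>\<close> times the boost of the first two coordinates \<open>(T, X)\<close>.
  Thus \<open>{T\<^sup>2 = X\<^sup>2}\<close> is a Killing horizon with surface gravity \<open>\<kappa>\<close>, and \<open>\<rho> = 0\<close> on the slices of
  constant \<open>t\<close> is its cross-section \<open>{T = X = 0}\<close>. Every smooth extension to a horizon with
  \<open>\<kappa> \<noteq> 0\<close> also extends smoothly to this cross-section.\<close>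

definition horizon_chart :: "real \<Rightarrow> real \<Rightarrow> real ^ 4 \<Rightarrow> real ^ 4" where
  "horizon_chart \<Omega> \<kappa> x =
     vector [x $ 4 * sinh (\<kappa> * x $ 1), x $ 4 * cosh (\<kappa> * x $ 1), x $ 2 - \<Omega> * x $ 1, x $ 3]"

text \<open>Near the pole \<open>z = s * m\<close>, where \<open>s\<close> is 1 or -1: with \<open>\<zeta> = s * z - m\<close>, the functions
  \<open>\<mu>, \<nu> \<ge> 0\<close> are defined by \<open>\<zeta> = (\<mu>\<^sup>2 - \<nu>\<^sup>2) / 2\<close> and \<open>\<rho> = \<mu> * \<nu>\<close>, so the axis is \<open>{\<nu> = 0}\<close> and the
  horizon is \<open>{\<mu> = 0}\<close>. The plane of \<open>\<mu>\<close> is treated as in the horizon chart and the plane of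
  \<open>\<nu>\<close> as in the axis chart. The poles close the horizon cross-section up to a sphere.\<close>

definition pole_chart :: "real \<Rightarrow> real \<Rightarrow> real \<Rightarrow> real \<Rightarrow> real ^ 4 \<Rightarrow> real ^ 4" where
  "pole_chart s m \<Omega> \<kappa> x =
     (let \<zeta> = s * x $ 3 - m; R = sqrt (\<zeta>\<^sup>2 + (x $ 4)\<^sup>2);
          \<mu> = sqrt (R + \<zeta>); \<nu> = sqrt (R - \<zeta>); \<phi> = x $ 2 - \<Omega> * x $ 1 in
      vector [\<mu> * sinh (\<kappa> * x $ 1), \<mu> * cosh (\<kappa> * x $ 1), \<nu> * cos \<phi>, \<nu> * sin \<phi>])"

definition regular_axis :: "real \<Rightarrow> real \<Rightarrow> metric4 \<Rightarrow> bool" where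
  "regular_axis L m g \<longleftrightarrow>
     (\<forall>t z. m < \<bar>z\<bar> \<and> \<bar>z\<bar> \<le> L / 2 \<longrightarrow> extends_to g axis_chart (vector [t, 0, 0, z]))"

definition regular_horizon :: "real \<Rightarrow> metric4 \<Rightarrow> bool" where
  "regular_horizon m g \<longleftrightarrow>
     (\<exists>\<Omega> \<kappa>. \<kappa> > 0 \<and>
        (\<forall>\<phi> z. \<bar>z\<bar> < m \<longrightarrow> extends_to g (horizon_chart \<Omega> \<kappa>) (vector [0, 0, \<phi>, z])) \<and>
        (\<forall>s\<in>{1, -1}. extends_to g (pole_chart s m \<Omega> \<kappa>) 0))"

definition omega_S :: "real \<Rightarrow> real \<Rightarrow> real \<Rightarrow> real" where
  "omega_S m z \<rho> =
     (let R = sqrt ((z - m)\<^sup>2 + \<rho>\<^sup>2) + sqrt ((z + m)\<^sup>2 + \<rho>\<^sup>2) in ln ((R - 2 * m) / (R + 2 * m)))"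

text \<open>The behaviour of \<open>\<eta>\<close> at \<open>\<rho> = 0\<close>; it is a consequence of the regularity conditions above.\<close>

definition eta_boundary :: "real \<Rightarrow> real \<Rightarrow> (real \<Rightarrow> real \<Rightarrow> real) \<Rightarrow> bool" where
  "eta_boundary L m \<eta> \<longleftrightarrow>
     (\<exists>F. continuous_on ({- (L / 2)..L / 2} \<times> {0..}) F \<and>
        (\<forall>z \<rho>. \<bar>z\<bar> \<le> L / 2 \<and> \<rho> > 0 \<longrightarrow> F (z, \<rho>) = ln (\<eta> z \<rho>) - 2 * ln \<rho> + omega_S m z \<rho>)) \<and>
     (\<forall>z. m < \<bar>z\<bar> \<and> \<bar>z\<bar> \<le> L / 2 \<longrightarrow>
        ((\<lambda>(z, \<rho>). \<rho> * deriv (\<lambda>r. ln (\<eta> z r)) \<rho>) \<longlongrightarrow> 2) (at (z, 0) within UNIV \<times> {0<..})) \<and>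
     (\<forall>z. \<bar>z\<bar> < m \<longrightarrow>
        ((\<lambda>(z, \<rho>). \<rho> * deriv (\<lambda>r. ln (\<eta> z r)) \<rho>) \<longlongrightarrow> 0) (at (z, 0) within UNIV \<times> {0<..}))"


section \<open>Metric completeness at infinity\<close>

text \<open>\<open>Q x v\<close> is the squared length of the tangent vector \<open>v\<close> at \<open>x\<close>, invariant under a group \<open>G\<close> of
  translations preserving \<open>S\<close>. The distance is that of the quotient of \<open>S\<close> by \<open>G\<close>: a curve in the
  quotient is represented by a lift, which ends at a translate of \<open>b\<close>. The relation
  \<open>has_integral\<close> discards curves of infinite length.\<close>

definition quotient_dist ::
  "('a::real_normed_vector \<Rightarrow> 'a \<Rightarrow> real) \<Rightarrow> 'a set \<Rightarrow> 'a set \<Rightarrow> 'a \<Rightarrow> 'a \<Rightarrow> real" where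
  "quotient_dist Q G S a b =
     (if a \<in> S \<and> b \<in> S then
        Inf {l. \<exists>c. valid_path c \<and> path_image c \<subseteq> S \<and> pathstart c = a \<and> pathfinish c - b \<in> G \<and>
               ((\<lambda>s. sqrt (Q (c s) (vector_derivative c (at s)))) has_integral l) {0..1}}
      else 0)"

text \<open>The carriers below are fundamental domains for the period lattices.\<close>

definition q_complete_at_infinity :: "real \<Rightarrow> (real \<Rightarrow> real \<Rightarrow> real) \<Rightarrow> bool" where
  "q_complete_at_infinity L \<gamma> \<longleftrightarrow>
     (\<forall>\<rho>\<^sub>0>0.
        let M = {- (L / 2)<..L / 2} \<times> {\<rho>\<^sub>0..};
            d = quotient_dist (\<lambda>(z, \<rho>) (dz, d\<rho>). exp (2 * \<gamma> z \<rho>) * (dz\<^sup>2 + d\<rho>\<^sup>2))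
                  (range (\<lambda>n::int. (of_int n * L, 0))) (UNIV \<times> {\<rho>\<^sub>0..})
        in Metric_space M d \<and> Metric_space.mcomplete M d)"

definition spatial_complete_at_infinity ::
  "real \<Rightarrow> (real \<Rightarrow> real \<Rightarrow> real) \<Rightarrow> (real \<Rightarrow> real \<Rightarrow> real) \<Rightarrow> bool" where
  "spatial_complete_at_infinity L \<eta> \<gamma> \<longleftrightarrow>
     (\<forall>\<rho>\<^sub>0>0.
        let M = {- pi<..pi} \<times> {- (L / 2)<..L / 2} \<times> {\<rho>\<^sub>0..};
            d = quotient_dist
                  (\<lambda>(\<phi>, z, \<rho>) (d\<phi>, dz, d\<rho>).
                     \<eta> z \<rho> * d\<phi>\<^sup>2 + exp (2 * \<gamma> z \<rho>) / \<eta> z \<rho> * (d\<rho>\<^sup>2 + dz\<^sup>2))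
                  (range (\<lambda>(k::int, n::int). (of_int k * (2 * pi), of_int n * L, 0)))
                  (UNIV \<times> UNIV \<times> {\<rho>\<^sub>0..})
        in Metric_space M d \<and> Metric_space.mcomplete M d)"


section \<open>Periodic stationary and axisymmetric black holes\<close>

definition periodic_black_hole ::
  "real \<Rightarrow> real \<Rightarrow> (real \<Rightarrow> real \<Rightarrow> real) \<Rightarrow> (real \<Rightarrow> real \<Rightarrow> real) \<Rightarrow>
   (real \<Rightarrow> real \<Rightarrow> real) \<Rightarrow> (real \<Rightarrow> real \<Rightarrow> real) \<Rightarrow> bool" where
  "periodic_black_hole L m V W \<eta> \<gamma> \<longleftrightarrow>
     0 < m \<and> m < L / 2 \<and>
     (\<forall>f\<in>{V, W, \<eta>, \<gamma>}. smooth_on (\<lambda>(z, \<rho>). f z \<rho>) (UNIV \<times> {0<..}) \<and>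
                       (\<forall>z. \<forall>\<rho>>0. f (z + L) \<rho> = f z \<rho>)) \<and>
     (\<forall>z. \<forall>\<rho>>0. \<eta> z \<rho> > 0 \<and> V z \<rho> * \<eta> z \<rho> + (W z \<rho>)\<^sup>2 = \<rho>\<^sup>2) \<and>
     (\<forall>x\<in>weyl_domain. \<forall>b c. ricci (weyl_metric V W \<eta> \<gamma>) b c x = 0) \<and>
     regular_axis L m (weyl_metric V W \<eta> \<gamma>) \<and>
     regular_horizon m (weyl_metric V W \<eta> \<gamma>) \<and>
     eta_boundary L m \<eta> \<and>
     spatial_complete_at_infinity L \<eta> \<gamma>"


section \<open>Komar angular momentum\<close>

text \<open>The exterior derivative of the one-form dual to the Killing field \<open>\<partial>\<^sub>\<phi>\<close> (index 2).\<close>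

definition d_killing :: "metric4 \<Rightarrow> 4 \<Rightarrow> 4 \<Rightarrow> real ^ 4 \<Rightarrow> real" where
  "d_killing g a b x = pd a (\<lambda>y. g y $ b $ 2) x - pd b (\<lambda>y. g y $ a $ 2) x"

definition levi_civita :: "4 \<Rightarrow> 4 \<Rightarrow> 4 \<Rightarrow> 4 \<Rightarrow> real" where
  "levi_civita a b c d = det (vector [axis a 1, axis b 1, axis c 1, axis d 1] :: real ^ 4 ^ 4)"

definition hodge_star ::
  "metric4 \<Rightarrow> (4 \<Rightarrow> 4 \<Rightarrow> real ^ 4 \<Rightarrow> real) \<Rightarrow> 4 \<Rightarrow> 4 \<Rightarrow> real ^ 4 \<Rightarrow> real" where
  "hodge_star g F c d x =
     sqrt \<bar>det (g x)\<bar> / 2 *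
     (\<Sum>a\<in>UNIV. \<Sum>b\<in>UNIV. levi_civita a b c d *
        (\<Sum>p\<in>UNIV. \<Sum>q\<in>UNIV. matrix_inv (g x) $ a $ p * matrix_inv (g x) $ b $ q * F p q x))"

text \<open>The integral of \<open>\<star>d\<xi>\<close> over the torus of constant \<open>t = 0\<close> and \<open>\<rho>\<close>. For a vacuum metric
  \<open>\<star>d\<xi>\<close> is closed, so the value does not depend on \<open>\<rho>\<close>; the angular momentum is defined by the
  torus \<open>\<rho> = 1\<close>.\<close>

definition komar_integral :: "real \<Rightarrow> metric4 \<Rightarrow> real \<Rightarrow> real" where
  "komar_integral L g \<rho> =
     1 / (16 * pi) *
     integral {0..2 * pi} (\<lambda>\<phi>. integral {- (L / 2)..L / 2}
       (\<lambda>z. hodge_star g (d_killing g) 2 3 (vector [0, \<phi>, z, \<rho>])))"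

definition angular_momentum :: "real \<Rightarrow> metric4 \<Rightarrow> real" where
  "angular_momentum L g = komar_integral L g 1"


section \<open>The Myers/Korotkin-Nicolai black holes\<close>

definition omega_MKN :: "real \<Rightarrow> real \<Rightarrow> real \<Rightarrow> real \<Rightarrow> real" where
  "omega_MKN L m z \<rho> =
     omega_S m z \<rho> +
     (\<Sum>\<^sub>\<infinity>j\<in>UNIV - {0::int}. omega_S m (z + of_int j * L) \<rho> + 2 * m / (\<bar>of_int j\<bar> * L))"

definition is_k_MKN :: "real \<Rightarrow> real \<Rightarrow> (real \<Rightarrow> real \<Rightarrow> real) \<Rightarrow> bool" where
  "is_k_MKN L m k \<longleftrightarrow>
     (\<forall>z. \<forall>\<rho>>0.
        let \<omega>\<^sub>z = deriv (\<lambda>y. omega_MKN L m y \<rho>) z; \<omega>\<^sub>\<rho> = deriv (\<lambda>r. omega_MKN L m z r) \<rho> in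
        ((\<lambda>r. k z r) has_real_derivative \<rho> / 4 * (\<omega>\<^sub>\<rho>\<^sup>2 - \<omega>\<^sub>z\<^sup>2)) (at \<rho>) \<and>
        ((\<lambda>y. k y \<rho>) has_real_derivative \<rho> / 2 * \<omega>\<^sub>z * \<omega>\<^sub>\<rho>) (at z) \<and>
        k (z + L) \<rho> = k z \<rho>) \<and>
     (\<forall>z. m < \<bar>z\<bar> \<and> \<bar>z\<bar> \<le> L / 2 \<longrightarrow>
        ((\<lambda>(z, \<rho>). k z \<rho>) \<longlongrightarrow> 0) (at (z, 0) within UNIV \<times> {0<..}))"

definition is_MKN ::
  "real \<Rightarrow> real \<Rightarrow> (real \<Rightarrow> real \<Rightarrow> real) \<Rightarrow> (real \<Rightarrow> real \<Rightarrow> real) \<Rightarrow>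
   (real \<Rightarrow> real \<Rightarrow> real) \<Rightarrow> (real \<Rightarrow> real \<Rightarrow> real) \<Rightarrow> bool" where
  "is_MKN L m V W \<eta> \<gamma> \<longleftrightarrow>
     (\<exists>k. is_k_MKN L m k \<and>
        (\<forall>z. \<forall>\<rho>>0. let \<omega> = omega_MKN L m z \<rho> in
           V z \<rho> = exp \<omega> \<and> W z \<rho> = 0 \<and> \<eta> z \<rho> = \<rho>\<^sup>2 * exp (- \<omega>) \<and>
           exp (2 * \<gamma> z \<rho>) = \<rho>\<^sup>2 * exp (2 * k z \<rho> - 2 * \<omega>)))"

end

theory Submission
  imports Defs
begin

text \<open>By continuity of \<open>L / m\<close>, some member of the family with \<open>\<lambda> \<noteq> 0\<close> has \<open>L < 4 m\<close>, and already this one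
  black hole is contradictory. Put \<open>x = ln \<eta>\<close>, \<open>\<Omega> = W / \<eta>\<close>, \<open>P = \<eta>\<^sup>2 d\<Omega> / \<rho>\<close>, and integrate over a period
  of \<open>z\<close>. The vacuum equations give \<open>div P = 0\<close> and \<open>x\<^sub>z\<^sub>z + x\<^sub>\<rho>\<^sub>\<rho> + x\<^sub>\<rho> / \<rho> = - |P|\<^sup>2 / \<eta>\<^sup>2\<close>, so the mean \<open>X\<close> of
  \<open>x\<close> has \<open>\<rho> X'\<close> nonincreasing; the behaviour of \<open>\<eta>\<close> at \<open>\<rho> = 0\<close> bounds \<open>X\<close> from below by \<open>s ln \<rho> - C\<close> with
  \<open>s < L\<close>, because \<open>L < 4 m\<close>, and therefore \<open>X \<le> L ln \<rho> + C\<close> for \<open>\<rho> \<ge> 1\<close>. The mean \<open>Y\<close> of \<open>\<gamma>\<close> satisfies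
  \<open>2 \<rho> (\<rho> Y')' = - \<integral> \<rho>\<^sup>2 (x\<^sub>z\<^sup>2 + P\<^sub>\<rho>\<^sup>2 / \<eta>\<^sup>2) dz\<close>. The flux \<open>\<integral> P\<^sub>\<rho> dz\<close> is a nonzero constant, the angular
  momentum, so the bound on \<open>X\<close> keeps the right-hand side below a negative constant and \<open>\<rho> Y' \<rightarrow> - \<infinity>\<close>.

  On the other hand \<open>q\<close> has nonnegative curvature, since \<open>\<gamma>\<close> is superharmonic, and completeness then
  implies \<open>exp \<gamma> * 2 (\<rho> - 1) \<ge> R\<close> with a constant \<open>R > 0\<close>, so that \<open>Y \<ge> - L ln \<rho> - C\<close>. Classically this is
  the minimum principle for the sum of \<open>ln dist(p, \<sqdot>)\<close> and the Green's function \<open>b\<close> of a half plane. The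
  distance is replaced here by chains \<open>z\<^sub>0 = p, \<dots>, z\<^sub>n\<close>, for which
  \<open>exp (b z\<^sub>n) * \<Sum>\<^sub>i |z\<^sub>i - z\<^sub>i\<^sub>-\<^sub>1|\<^sup>2 exp (2 \<gamma> z\<^sub>i)\<close> has no interior minimum. If the inequality failed at \<open>p\<close>,
  the minimisers would be chains of bounded length that reach any height, against completeness.\<close>

section \<open>Second variation of chains\<close>

text \<open>The threshold 4 compares two slopes in \<open>ln \<rho>\<close>. Near \<rho> = 0 the
  function \<open>ln \<eta>\<close> behaves like \<open>2 ln \<rho>\<close> on the axis, of
  coordinate length \<open>L - 2 m\<close>, and stays bounded on the horizon, so X has the slope
  \<open>2 (L - 2 m)\<close> there; this is below L exactly if \<open>L < 4 m\<close>. The slope L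
  is what the flux needs: if X is at most \<open>L ln \<rho>\<close>, then \<eta> is at most of
  order \<rho>, the term \<open>\<rho>^2 P_\<rho>^2 / \<eta>^2\<close> does not decay, and
  \<open>(\<rho> Y')'\<close> is below a negative multiple of \<open>1 / \<rho>\<close>, whose
  integral diverges. The factor \<open>2 (\<rho> - 1)\<close> comes from the Green's function
  \<open>b = ln |w - cnj p| - ln |w - p|\<close>. The sum \<open>ln dist + b\<close> tends to
  \<open>\<gamma>(p) + ln (2 Im p)\<close> at p, is at least \<open>ln R\<close> on the real axis,
  where R bounds the length across the strip \<open>1 \<le> \<rho> \<le> 2\<close> from below, and
  is unbounded at infinity by completeness. A distance function is only Lipschitz. The chain
  functional is a function of finitely many points: its minimum over a compact box exists, and
  second variations apply to it directly.\<close>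

definition jet2 :: "(real \<Rightarrow> real) \<Rightarrow> real \<Rightarrow> real \<Rightarrow> bool" where
  "jet2 f u v \<longleftrightarrow> (\<exists>f'. (\<forall>\<^sub>F t in nhds 0. (f has_real_derivative f' t) (at t)) \<and>
     f' 0 = u \<and> (f' has_real_derivative v) (at 0))"

lemma jet2_add:
  assumes "jet2 f u v" "jet2 g p q"
  shows "jet2 (\<lambda>t. f t + g t) (u + p) (v + q)"
proof -
  obtain f' g' where f: "\<forall>\<^sub>F t in nhds 0. (f has_real_derivative f' t) (at t)"
      "f' 0 = u" "(f' has_real_derivative v) (at 0)"
    and g: "\<forall>\<^sub>F t in nhds 0. (g has_real_derivative g' t) (at t)"
      "g' 0 = p" "(g' has_real_derivative q) (at 0)"
    using assms by (auto simp: jet2_def)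
  have "\<forall>\<^sub>F t in nhds 0. ((\<lambda>t. f t + g t) has_real_derivative f' t + g' t) (at t)"
    using f(1) g(1) by eventually_elim (rule DERIV_add)
  then show ?thesis
    unfolding jet2_def using f g by (intro exI[of _ "\<lambda>t. f' t + g' t"]) (auto intro: DERIV_add)
qed

lemma jet2_exp:
  assumes "jet2 f u v"
  shows "jet2 (\<lambda>t. exp (f t)) (exp (f 0) * u) (exp (f 0) * (v + u\<^sup>2))"
proof -
  obtain f' where f: "\<forall>\<^sub>F t in nhds 0. (f has_real_derivative f' t) (at t)"
      "f' 0 = u" "(f' has_real_derivative v) (at 0)"
    using assms by (auto simp: jet2_def)
  have "\<forall>\<^sub>F t in nhds 0. ((\<lambda>t. exp (f t)) has_real_derivative exp (f t) * f' t) (at t)"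
    using f(1) by eventually_elim (auto intro!: derivative_eq_intros)
  moreover have "(f has_real_derivative u) (at 0)"
    using eventually_nhds_x_imp_x[OF f(1)] f(2) by simp
  ultimately show ?thesis
    unfolding jet2_def using f
    by (intro exI[of _ "\<lambda>t. exp (f t) * f' t"])
      (auto intro!: derivative_eq_intros simp: algebra_simps power2_eq_square)
qed

lemma jet2_const: "jet2 (\<lambda>t. c) 0 0"
  unfolding jet2_def by (intro exI[of _ "\<lambda>t. 0"]) auto

lemma jet2_sum:
  "finite A \<Longrightarrow> (\<And>i. i \<in> A \<Longrightarrow> jet2 (f i) (u i) (v i)) \<Longrightarrow>
    jet2 (\<lambda>t. \<Sum>i\<in>A. f i t) (\<Sum>i\<in>A. u i) (\<Sum>i\<in>A. v i)"
  by (induction A rule: finite_induct) (auto intro: jet2_add jet2_const)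

lemma jet2_local_min:
  assumes "jet2 f 0 v" and min: "\<forall>\<^sub>F t in nhds 0. f 0 \<le> f t"
  shows "v \<ge> 0"
proof (rule ccontr)
  assume "\<not> v \<ge> 0"
  then have v: "v < 0" by simp
  obtain f' where f: "\<forall>\<^sub>F t in nhds 0. (f has_real_derivative f' t) (at t)"
      "f' 0 = 0" "(f' has_real_derivative v) (at 0)"
    using assms by (auto simp: jet2_def)
  obtain d where d: "d > 0" "\<And>h. 0 < h \<Longrightarrow> h < d \<Longrightarrow> f' (0 + h) < f' 0"
    using DERIV_neg_dec_right[OF f(3) v] by auto
  obtain e where e: "e > 0" "\<And>t. dist t 0 < e \<Longrightarrow> (f has_real_derivative f' t) (at t) \<and> f 0 \<le> f t"
    using eventually_conj[OF f(1) min] unfolding eventually_nhds_metric by blast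
  define b where "b = min d e / 2"
  have b: "b > 0" "b < d" "b < e" using d e by (auto simp: b_def)
  obtain s where s: "0 < s" "s < b" "f b - f 0 = (b - 0) * f' s"
    using MVT2[of 0 b f f'] b e by (auto simp: dist_real_def)
  have "f' s < 0" using d(2)[of s] s b f(2) by auto
  then have "f b < f 0" using s b by (smt (verit) mult_pos_neg)
  then show False using e(2)[of b] b by (auto simp: dist_real_def)
qed

text \<open>The complex gradient \<open>\<Gamma> = \<partial>\<^sub>x G - i \<partial>\<^sub>y G\<close>; the Laplacian of \<open>G\<close> is then
  \<open>Re (\<Gamma>' 1 + i \<Gamma>' i)\<close>.\<close>

definition cjet :: "(complex \<Rightarrow> real) \<Rightarrow> (complex \<Rightarrow> complex) \<Rightarrow> (complex \<Rightarrow> complex) \<Rightarrow> complex \<Rightarrow> bool"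
  where "cjet G \<Gamma> \<Gamma>' z \<longleftrightarrow>
    (\<forall>\<^sub>F w in nhds z. (G has_derivative (\<lambda>h. Re (\<Gamma> w * h))) (at w)) \<and> (\<Gamma> has_derivative \<Gamma>') (at z)"

lemma cjet_add:
  assumes "cjet F \<Phi> \<Phi>' z" "cjet G \<Gamma> \<Gamma>' z"
  shows "cjet (\<lambda>w. F w + G w) (\<lambda>w. \<Phi> w + \<Gamma> w) (\<lambda>h. \<Phi>' h + \<Gamma>' h) z"
proof -
  have "\<forall>\<^sub>F w in nhds z. ((\<lambda>w. F w + G w) has_derivative (\<lambda>h. Re ((\<Phi> w + \<Gamma> w) * h))) (at w)"
    using assms[unfolded cjet_def, THEN conjunct1]
    by eventually_elim (auto intro!: derivative_eq_intros simp: algebra_simps)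
  then show ?thesis using assms by (auto simp: cjet_def intro: has_derivative_add)
qed

lemma cjet_cmult:
  assumes "cjet G \<Gamma> \<Gamma>' z"
  shows "cjet (\<lambda>w. c * G w) (\<lambda>w. of_real c * \<Gamma> w) (\<lambda>h. of_real c * \<Gamma>' h) z"
proof -
  have "\<forall>\<^sub>F w in nhds z. ((\<lambda>w. c * G w) has_derivative (\<lambda>h. Re ((of_real c * \<Gamma> w) * h))) (at w)"
    using assms[unfolded cjet_def, THEN conjunct1]
    by eventually_elim (auto intro!: derivative_eq_intros simp: algebra_simps)
  then show ?thesis using assms by (auto simp: cjet_def intro!: derivative_eq_intros)
qed

text \<open>\<open>2 / (w - p)\<close> is the derivative of \<open>2 log (w - p)\<close>. The
  differential of the gradient is multiplication by a complex number, which is how harmonicity shows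
  in this encoding: the contributions of 1 and \<i> to the Laplacian cancel.\<close>

lemma cjet_ln:
  assumes "z \<noteq> p"
  shows "cjet (\<lambda>w. ln ((cmod (w - p))\<^sup>2)) (\<lambda>w. 2 / (w - p)) (\<lambda>h. - 2 / (z - p)\<^sup>2 * h) z"
proof -
  have "\<forall>\<^sub>F w in nhds z. w \<noteq> p"
    using assms by (metis t1_space_nhds)
  moreover have "((\<lambda>w. ln ((cmod (w - p))\<^sup>2)) has_derivative (\<lambda>h. Re (2 / (w - p) * h))) (at w)"
    if "w \<noteq> p" for w
  proof -
    have pos: "(Re w - Re p)\<^sup>2 + (Im w - Im p)\<^sup>2 > 0"
      using that by (metis complex_eq_iff diff_eq_diff_eq eq_iff_diff_eq_0 sum_power2_gt_zero_iff)
    have "((\<lambda>w. ln ((Re w - Re p)\<^sup>2 + (Im w - Im p)\<^sup>2)) has_derivative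
      (\<lambda>h. (2 * (Re w - Re p) * Re h + 2 * (Im w - Im p) * Im h) / ((Re w - Re p)\<^sup>2 + (Im w - Im p)\<^sup>2))) (at w)"
      using pos by (auto intro!: derivative_eq_intros simp: field_simps)
    moreover have "(\<lambda>h. (2 * (Re w - Re p) * Re h + 2 * (Im w - Im p) * Im h) / ((Re w - Re p)\<^sup>2 + (Im w - Im p)\<^sup>2))
       = (\<lambda>h. Re (2 / (w - p) * h))"
      by (rule ext) (simp add: Re_divide Im_divide add_divide_distrib diff_divide_distrib algebra_simps)
    ultimately show ?thesis by (simp add: cmod_power2)
  qed
  ultimately have "\<forall>\<^sub>F w in nhds z.
      ((\<lambda>w. ln ((cmod (w - p))\<^sup>2)) has_derivative (\<lambda>h. Re (2 / (w - p) * h))) (at w)"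
    by (auto elim: eventually_mono)
  moreover have "((\<lambda>w. 2 / (w - p)) has_derivative (\<lambda>h. - 2 / (z - p)\<^sup>2 * h)) (at z)"
    using assms by (auto intro!: derivative_eq_intros simp: field_simps power2_eq_square)
  ultimately show ?thesis by (simp add: cjet_def)
qed

lemma cjet_line:
  assumes "cjet G \<Gamma> \<Gamma>' z"
  shows "jet2 (\<lambda>t. G (z + of_real t * a)) (Re (\<Gamma> z * a)) (Re (\<Gamma>' a * a))"
proof -
  have lim: "((\<lambda>t. z + of_real t * a) \<longlongrightarrow> z) (nhds (0::real))"
    by (auto intro!: tendsto_eq_intros filterlim_ident)
  have ev: "\<forall>\<^sub>F t in nhds (0::real). (G has_derivative (\<lambda>h. Re (\<Gamma> (z + of_real t * a) * h))) (at (z + of_real t * a))"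
    using assms filterlim_iff[THEN iffD1, rule_format, OF lim] by (auto simp: cjet_def)
  have "\<forall>\<^sub>F t in nhds (0::real). ((\<lambda>t. G (z + of_real t * a)) has_real_derivative Re (\<Gamma> (z + of_real t * a) * a)) (at t)"
    using ev
  proof eventually_elim
    case (elim t)
    have "((\<lambda>t. z + of_real t * a) has_derivative (\<lambda>h. of_real h * a)) (at t)"
      by (auto intro!: derivative_eq_intros)
    from has_derivative_compose[OF this elim]
    have "((\<lambda>t. G (z + of_real t * a)) has_derivative (\<lambda>h. Re (\<Gamma> (z + of_real t * a) * (of_real h * a)))) (at t)" .
    moreover have "(\<lambda>h. Re (\<Gamma> (z + of_real t * a) * (of_real h * a))) = (*) (Re (\<Gamma> (z + of_real t * a) * a))"
      by (rule ext) (simp add: algebra_simps)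
    ultimately show ?case by (simp only: has_field_derivative_def)
  qed
  moreover have "((\<lambda>t. Re (\<Gamma> (z + of_real t * a) * a)) has_real_derivative Re (\<Gamma>' a * a)) (at 0)"
  proof -
    have "((\<lambda>t. z + of_real t * a) has_derivative (\<lambda>h. of_real h * a)) (at 0)"
      by (auto intro!: derivative_eq_intros)
    moreover have g: "(\<Gamma> has_derivative \<Gamma>') (at z)" using assms by (simp add: cjet_def)
    ultimately have "((\<lambda>t. \<Gamma> (z + of_real t * a)) has_derivative (\<lambda>h. \<Gamma>' (of_real h * a))) (at (0::real))"
      by (intro has_derivative_compose[where g = \<Gamma> and f = "\<lambda>t. z + of_real t * a"]) auto
    then have *: "((\<lambda>t. Re (\<Gamma> (z + of_real t * a) * a)) has_derivative (\<lambda>h. Re (\<Gamma>' (of_real h * a) * a))) (at (0::real))"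
      by (auto intro!: derivative_eq_intros)
    have "\<Gamma>' (of_real h * a) = of_real h * \<Gamma>' a" for h :: real
      using has_derivative_linear[OF g] linear_scale[of \<Gamma>' h a] by (simp add: scaleR_conv_of_real)
    then have "(\<lambda>h. Re (\<Gamma>' (of_real h * a) * a)) = (*) (Re (\<Gamma>' a * a))"
      by (intro ext) (simp add: algebra_simps)
    then show ?thesis using * by (simp only: has_field_derivative_def)
  qed
  ultimately show ?thesis
    unfolding jet2_def by (intro exI[of _ "\<lambda>t. Re (\<Gamma> (z + of_real t * a) * a)"]) auto
qed

text \<open>The Hessian is the quadratic form \<open>Re (\<Gamma>' h * h)\<close>, and
  \<open>a\<close>, \<open>\<i> * a\<close> are orthogonal vectors of length |a|; the sum of the
  form over them is |a|^2 times its trace.\<close>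

lemma laplacian_rotate:
  assumes "linear \<Gamma>'"
  shows "Re (\<Gamma>' a * a) + Re (\<Gamma>' (\<i> * a) * (\<i> * a)) = (cmod a)\<^sup>2 * Re (\<Gamma>' 1 + \<i> * \<Gamma>' \<i>)"
proof -
  have *: "\<Gamma>' w = of_real (Re w) * \<Gamma>' 1 + of_real (Im w) * \<Gamma>' \<i>" for w
  proof -
    have "w = Re w *\<^sub>R 1 + Im w *\<^sub>R \<i>" by (simp add: complex_eq_iff)
    then have "\<Gamma>' w = \<Gamma>' (Re w *\<^sub>R 1 + Im w *\<^sub>R \<i>)" by simp
    also have "\<dots> = Re w *\<^sub>R \<Gamma>' 1 + Im w *\<^sub>R \<Gamma>' \<i>"
      using assms by (simp only: linear_add linear_scale)
    finally show ?thesis by (simp add: scaleR_conv_of_real)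
  qed
  show ?thesis
    unfolding *[of a] *[of "\<i> * a"] cmod_power2
    by (simp add: algebra_simps power2_eq_square)
qed

section \<open>Chain energy and its variations\<close>

text \<open>A discrete energy for the metric \<open>exp G |dz|^2\<close>. The weight is read off at
  the later endpoint of a step, so the logarithm of a summand is
  \<open>ln |z_i - z_(i-1)|^2 + G(z_i)\<close>, the sum of a harmonic function and, in the
  application, a superharmonic one.\<close>

definition chain_energy :: "(complex \<Rightarrow> real) \<Rightarrow> nat \<Rightarrow> (nat \<Rightarrow> complex) \<Rightarrow> real" where
  "chain_energy G n z = (\<Sum>i=1..n. (cmod (z i - z (i - 1)))\<^sup>2 * exp (G (z i)))"

lemma Re_mult_all_zero: "(\<And>c. Re (y * c) = 0) \<Longrightarrow> y = 0"
proof -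
  assume *: "\<And>c. Re (y * c) = 0"
  show "y = 0" using *[of 1] *[of \<i>] by (simp add: complex_eq_iff)
qed

lemma chain_energy_first_variation:
  assumes "\<And>i. i \<in> {1..n} \<Longrightarrow> cjet G \<Gamma> (\<Gamma>' (z i)) (z i)"
    and "cjet \<beta> B B' (z n)"
  shows "((\<lambda>t. chain_energy G n (\<lambda>i. z i + of_real t * a i) * exp (\<beta> (z n + of_real t * a n)))
     has_real_derivative
     exp (\<beta> (z n)) * ((\<Sum>i=1..n. exp (G (z i)) *
        (2 * Re (cnj (z i - z (i - 1)) * (a i - a (i - 1))) + (cmod (z i - z (i - 1)))\<^sup>2 * Re (\<Gamma> (z i) * a i)))
       + chain_energy G n z * Re (B (z n) * a n))) (at 0)"
proof -
  have jd: "((\<lambda>t. F (w + of_real t * c)) has_real_derivative Re (\<Phi> w * c)) (at 0)"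
    if cj: "cjet F \<Phi> \<Phi>' w" for F \<Phi> \<Phi>' w c
  proof -
    obtain f' where f': "\<forall>\<^sub>F t in nhds 0. ((\<lambda>t. F (w + of_real t * c)) has_real_derivative f' t) (at t)"
      "f' 0 = Re (\<Phi> w * c)"
      using cjet_line[OF cj, of c] unfolding jet2_def by blast
    show ?thesis using eventually_nhds_x_imp_x[OF f'(1)] unfolding f'(2) .
  qed
  have sq: "((\<lambda>t. (cmod (z i + of_real t * a i - (z (i-1) + of_real t * a (i-1))))\<^sup>2) has_real_derivative
      2 * Re (cnj (z i - z (i - 1)) * (a i - a (i - 1)))) (at 0)" for i
    unfolding cmod_power2 by (rule derivative_eq_intros refl)+ (simp add: algebra_simps)
  have summand: "((\<lambda>t. (cmod (z i + of_real t * a i - (z (i-1) + of_real t * a (i-1))))\<^sup>2 * exp (G (z i + of_real t * a i)))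
      has_real_derivative exp (G (z i)) *
        (2 * Re (cnj (z i - z (i - 1)) * (a i - a (i - 1))) + (cmod (z i - z (i - 1)))\<^sup>2 * Re (\<Gamma> (z i) * a i))) (at 0)"
    if "i \<in> {1..n}" for i
    by (rule DERIV_cong[OF DERIV_mult[OF sq DERIV_fun_exp[OF jd[OF assms(1)[OF that]]]]])
      (simp add: distrib_left mult_ac del: times_complex.sel)
  have "((\<lambda>t. chain_energy G n (\<lambda>i. z i + of_real t * a i)) has_real_derivative
      (\<Sum>i=1..n. exp (G (z i)) *
        (2 * Re (cnj (z i - z (i - 1)) * (a i - a (i - 1))) + (cmod (z i - z (i - 1)))\<^sup>2 * Re (\<Gamma> (z i) * a i)))) (at 0)"
    unfolding chain_energy_def by (rule DERIV_sum) (rule summand)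
  from DERIV_mult[OF this DERIV_fun_exp[OF jd[OF assms(2)]]] show ?thesis
    by (rule DERIV_cong) (simp add: distrib_left mult_ac)
qed

text \<open>The Euler-Lagrange equation obtained by moving the vertex \<open>z j\<close> alone. It
  occurs in step j, and besides in step j + 1 if j < n, or in the end factor
  \<open>exp \<beta>\<close> if j = n.\<close>

lemma chain_energy_stationary:
  fixes z :: "nat \<Rightarrow> complex"
  assumes G: "\<And>i. i \<in> {1..n} \<Longrightarrow> cjet G \<Gamma> (\<Gamma>' (z i)) (z i)"
    and \<beta>: "cjet \<beta> B B' (z n)"
    and min: "\<And>a. a 0 = 0 \<Longrightarrow> \<forall>\<^sub>F t in nhds (0::real).
      chain_energy G n z * exp (\<beta> (z n)) \<le>
      chain_energy G n (\<lambda>i. z i + of_real t * a i) * exp (\<beta> (z n + of_real t * a n))"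
    and j: "1 \<le> j" "j \<le> n"
  shows "of_real (exp (G (z j))) * (2 * cnj (z j - z (j - 1)) + of_real ((cmod (z j - z (j - 1)))\<^sup>2) * \<Gamma> (z j))
    = (if j < n then 2 * of_real (exp (G (z (Suc j)))) * cnj (z (Suc j) - z j)
       else - of_real (chain_energy G n z) * B (z n))"
proof -
  let ?D = "\<lambda>i. z i - z (i - 1)"
  let ?w = "\<lambda>i. exp (G (z i))"
  define Y where "Y = of_real (?w j) * (2 * cnj (?D j) + of_real ((cmod (?D j))\<^sup>2) * \<Gamma> (z j))
    - (if j < n then 2 * of_real (?w (Suc j)) * cnj (z (Suc j) - z j)
       else - of_real (chain_energy G n z) * B (z n))"
  have "Re (Y * c) = 0" for c
  proof -
    define a where "a = (\<lambda>i::nat. if i = j then c else 0)"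
    have a0: "a 0 = 0" using j by (simp add: a_def)
    have z0: "exp (\<beta> (z n)) * ((\<Sum>i=1..n. ?w i *
        (2 * Re (cnj (?D i) * (a i - a (i - 1))) + (cmod (?D i))\<^sup>2 * Re (\<Gamma> (z i) * a i)))
       + chain_energy G n z * Re (B (z n) * a n)) = 0"
    proof -
      obtain d where d: "d > 0" "\<And>t. \<bar>t\<bar> < d \<Longrightarrow> chain_energy G n z * exp (\<beta> (z n)) \<le>
         chain_energy G n (\<lambda>i. z i + of_real t * a i) * exp (\<beta> (z n + of_real t * a n))"
        using min[of a, OF a0] unfolding eventually_nhds_metric by (auto simp: dist_real_def)
      show ?thesis
        by (rule DERIV_local_min[OF chain_energy_first_variation[of n G \<Gamma> \<Gamma>' z \<beta> B B' a] d(1)])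
          (use G \<beta> d(2) in auto)
    qed
    have s1: "(\<Sum>i=1..n. ?w i * (2 * Re (cnj (?D i) * a i) + (cmod (?D i))\<^sup>2 * Re (\<Gamma> (z i) * a i)))
      = ?w j * (2 * Re (cnj (?D j) * c) + (cmod (?D j))\<^sup>2 * Re (\<Gamma> (z j) * c))"
    proof -
      have "(\<Sum>i=1..n. ?w i * (2 * Re (cnj (?D i) * a i) + (cmod (?D i))\<^sup>2 * Re (\<Gamma> (z i) * a i)))
        = (\<Sum>i=1..n. if i = j then ?w i * (2 * Re (cnj (?D i) * c) + (cmod (?D i))\<^sup>2 * Re (\<Gamma> (z i) * c)) else 0)"
        by (intro sum.cong) (auto simp: a_def)
      then show ?thesis using j by simp
    qed
    have s2: "(\<Sum>i=1..n. ?w i * (2 * Re (cnj (?D i) * a (i - 1))))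
      = (if j < n then ?w (Suc j) * (2 * Re (cnj (z (Suc j) - z j) * c)) else 0)"
    proof -
      have "(\<Sum>i=1..n. ?w i * (2 * Re (cnj (?D i) * a (i - 1))))
        = (\<Sum>i=1..n. if i = Suc j then ?w i * (2 * Re (cnj (?D i) * c)) else 0)"
        using j by (intro sum.cong) (auto simp: a_def)
      then show ?thesis using j by auto
    qed
    have "(\<Sum>i=1..n. ?w i *
        (2 * Re (cnj (?D i) * (a i - a (i - 1))) + (cmod (?D i))\<^sup>2 * Re (\<Gamma> (z i) * a i)))
      = (\<Sum>i=1..n. ?w i * (2 * Re (cnj (?D i) * a i) + (cmod (?D i))\<^sup>2 * Re (\<Gamma> (z i) * a i)))
       - (\<Sum>i=1..n. ?w i * (2 * Re (cnj (?D i) * a (i - 1))))"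
      unfolding sum_subtractf[symmetric] by (intro sum.cong) (auto simp: algebra_simps)
    note f1 = this[unfolded s1 s2]
    have f2: "Re ((of_real v * (2 * cnj U + of_real u * g) - X) * c)
        = v * (2 * Re (cnj U * c) + u * Re (g * c)) - Re (X * c)" for v u U g X
      by (simp add: algebra_simps)
    have f3: "Re ((if j < n then 2 * of_real (?w (Suc j)) * cnj (z (Suc j) - z j)
       else - of_real (chain_energy G n z) * B (z n)) * c)
      = (if j < n then ?w (Suc j) * (2 * Re (cnj (z (Suc j) - z j) * c)) else 0)
        - chain_energy G n z * Re (B (z n) * a n)"
    proof -
      have "Re (2 * of_real v * x * c) = v * (2 * Re (x * c))" "Re (- of_real v * x * c) = - v * Re (x * c)" for v x
        by (simp_all add: algebra_simps)
      then show ?thesis using j by (cases "j < n") (simp_all only: a_def if_True if_False, simp_all)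
    qed
    have "Re (Y * c) = ?w j * (2 * Re (cnj (?D j) * c) + (cmod (?D j))\<^sup>2 * Re (\<Gamma> (z j) * c))
      - ((if j < n then ?w (Suc j) * (2 * Re (cnj (z (Suc j) - z j) * c)) else 0)
        - chain_energy G n z * Re (B (z n) * a n))"
      unfolding Y_def f2 f3 ..
    then have "Re (Y * c) = (\<Sum>i=1..n. ?w i *
        (2 * Re (cnj (?D i) * (a i - a (i - 1))) + (cmod (?D i))\<^sup>2 * Re (\<Gamma> (z i) * a i)))
       + chain_energy G n z * Re (B (z n) * a n)"
      using f1 by linarith
    then show ?thesis using z0 by simp
  qed
  then have "Y = 0" by (rule Re_mult_all_zero)
  then show ?thesis by (simp add: Y_def)
qed

text \<open>The variation field \<open>a\<close> is chosen so that all the summands of the functional have vanishing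
  first variation along both \<open>a\<close> and \<open>\<i> a\<close>; the sum of the two second variations is then a
  positive combination of Laplacians.\<close>

lemma no_interior_minimum:
  fixes z :: "nat \<Rightarrow> complex"
  assumes n: "1 \<le> n"
    and G: "\<And>i. i \<in> {1..n} \<Longrightarrow> cjet G \<Gamma> (\<Gamma>' (z i)) (z i)"
    and lap: "\<And>i. i \<in> {1..n} \<Longrightarrow> Re (\<Gamma>' (z i) 1 + \<i> * \<Gamma>' (z i) \<i>) \<le> 0"
    and \<beta>: "cjet \<beta> B B' (z n)" and B0: "B (z n) \<noteq> 0" and lap\<beta>: "Re (B' 1 + \<i> * B' \<i>) < 0"
    and ne: "z n \<noteq> z 0"
    and min: "\<And>a. a 0 = 0 \<Longrightarrow> \<forall>\<^sub>F t in nhds (0::real).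
      chain_energy G n z * exp (\<beta> (z n)) \<le>
      chain_energy G n (\<lambda>i. z i + of_real t * a i) * exp (\<beta> (z n + of_real t * a n))"
  shows False
proof -
  define D where "D = (\<lambda>i. z i - z (i - 1))"
  define w where "w = (\<lambda>i. exp (G (z i)))"
  define e where "e = (\<lambda>i. (cmod (D i))\<^sup>2 * w i)"
  define S where "S = (\<lambda>i. \<Sum>j=1..i. e j)"
  have wpos: "w i > 0" for i by (simp add: w_def)
  have Sn: "S n = chain_energy G n z"
    by (simp add: S_def e_def D_def w_def chain_energy_def)
  have stat: "of_real (w j) * (2 * cnj (D j) + of_real ((cmod (D j))\<^sup>2) * \<Gamma> (z j))
    = (if j < n then 2 * of_real (w (Suc j)) * cnj (D (Suc j)) else - of_real (S n) * B (z n))"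
    if "1 \<le> j" "j \<le> n" for j
    using chain_energy_stationary[of n G \<Gamma> \<Gamma>' z \<beta> B B' j] G \<beta> min that
    unfolding D_def w_def Sn by simp
  have Spos: "S n > 0"
  proof -
    have "\<exists>i\<in>{1..n}. D i \<noteq> 0"
    proof (rule ccontr)
      assume "\<not> ?thesis"
      then have st: "z i = z (i - 1)" if "1 \<le> i" "i \<le> n" for i using that by (auto simp: D_def)
      have "i \<le> n \<Longrightarrow> z i = z 0" for i
      proof (induction i)
        case (Suc i)
        then show ?case using st[of "Suc i"] by simp
      qed simp
      then have "z n = z 0" by blast
      then show False using ne by simp
    qed
    then obtain i where "i \<in> {1..n}" "D i \<noteq> 0" by blast
    then show ?thesis unfolding S_def
      by (intro sum_pos2[of _ i]) (auto simp: e_def wpos less_imp_le)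
  qed
  \<comment> \<open>Downward induction along the stationarity equations: at n the right-hand side is
    nonzero because \<open>S n > 0\<close> and \<open>B (z n) \<noteq> 0\<close>, and each nonzero
    step forces the preceding one. Thus the logarithms of all summands are smooth near the
    minimiser.\<close>
  have Dn0: "D j \<noteq> 0" if "1 \<le> j" "j \<le> n" for j
    using that(2,1)
  proof (induction rule: inc_induct)
    case base
    show ?case using stat[of n] n B0 Spos by auto
  next
    case (step k)
    show ?case using stat[of k] step wpos[of "Suc k"] by auto
  qed
  have epos: "e j > 0" if "1 \<le> j" "j \<le> n" for j using Dn0[OF that] wpos by (simp add: e_def)
  have cD: "of_real (w j) * cnj (D j) = of_real (e j) / D j" if "1 \<le> j" "j \<le> n" for j
  proof -
    have "of_real ((cmod (D j))\<^sup>2) = D j * cnj (D j)" by (rule complex_norm_square)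
    then show ?thesis using Dn0[OF that] by (simp add: e_def)
  qed
  have stat': "of_real (e j) * (2 / D j + \<Gamma> (z j))
    = (if j < n then 2 * of_real (e (Suc j)) / D (Suc j) else - of_real (S n) * B (z n))"
    if "1 \<le> j" "j \<le> n" for j
  proof -
    have "of_real (e j) * (2 / D j + \<Gamma> (z j)) = 2 * (of_real (w j) * cnj (D j)) + of_real (e j) * \<Gamma> (z j)"
      using cD[OF that] by (simp add: algebra_simps)
    also have "\<dots> = of_real (w j) * (2 * cnj (D j) + of_real ((cmod (D j))\<^sup>2) * \<Gamma> (z j))"
      by (simp add: e_def algebra_simps)
    also have "\<dots> = (if j < n then 2 * (of_real (w (Suc j)) * cnj (D (Suc j))) else - of_real (S n) * B (z n))"
      using stat[OF that] by simp
    finally show ?thesis using cD[of "Suc j"] that by auto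
  qed
  \<comment> \<open>The solution of the equations \<open>zero\<close> with \<open>a 0 = 0\<close>
    and \<open>a n = 1\<close>. Multiplied by \<open>e i\<close> and combined with
    \<open>stat'\<close>, they say that \<open>2 * e (i+1) * a i / D (i+1)\<close> decreases by
    \<open>B * e i\<close> at each index, so it equals \<open>- B * S i\<close>. At i = n the
    stationarity equation makes this consistent with \<open>a n = 1\<close>.\<close>
  define a where "a = (\<lambda>i. if i < n then - B (z n) * of_real (S i) * D (Suc i) / (2 * of_real (e (Suc i))) else 1)"
  have a0: "a 0 = 0" using n by (simp add: a_def S_def)
  have an: "a n = 1" by (simp add: a_def)
  have aP: "of_real (e i) * (2 / D i + \<Gamma> (z i)) * a i = - B (z n) * of_real (S i)" if "1 \<le> i" "i \<le> n" for i
  proof (cases "i < n")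
    case True
    then show ?thesis
      using stat'[OF that] that Dn0[of "Suc i"] epos[of "Suc i"] by (simp add: a_def)
  next
    case False
    then show ?thesis using stat'[OF that] that by (simp add: a_def)
  qed
  have zero: "2 * (a i - a (i - 1)) / D i + \<Gamma> (z i) * a i + B (z n) * a n = 0" if "1 \<le> i" "i \<le> n" for i
  proof -
    have S: "S i = S (i - 1) + e i" using that unfolding S_def by (cases i) auto
    have "of_real (e i) * (2 * a (i - 1) / D i) = - B (z n) * of_real (S (i - 1))"
    proof -
      have "i - 1 < n" "Suc (i - 1) = i" using that by auto
      then show ?thesis using Dn0[OF that] epos[OF that] by (simp add: a_def)
    qed
    then have "of_real (e i) * (2 * (a i - a (i - 1)) / D i + \<Gamma> (z i) * a i) = - B (z n) * of_real (e i)"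
      using aP[OF that] S by (simp add: algebra_simps diff_divide_distrib)
    then have "of_real (e i) * (2 * (a i - a (i - 1)) / D i + \<Gamma> (z i) * a i + B (z n) * a n) = 0"
      by (simp add: an algebra_simps)
    then show ?thesis using epos[OF that] by simp
  qed
  define q where "q = (\<lambda>i c. Re (- 2 / (D i)\<^sup>2 * (c * (a i - a (i - 1))) * (c * (a i - a (i - 1))))
     + Re (\<Gamma>' (z i) (c * a i) * (c * a i)) + Re (B' (c * a n) * (c * a n)))"
  have second: "(\<Sum>i=1..n. e i * exp (\<beta> (z n)) * q i c) \<ge> 0" for c
  proof -
    define b where "b = (\<lambda>i. c * a i)"
    \<comment> \<open>The logarithms of the summands along the variation \<open>c * a\<close>. By
      \<open>zero\<close> their first derivatives vanish, so the second derivative of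
      \<open>exp (Q i)\<close> at 0 is \<open>exp (Q i 0) * q i c\<close>, without a square of the
      first derivative.\<close>
    define Q where "Q = (\<lambda>i (t::real). ln ((cmod (D i + of_real t * (b i - b (i - 1)) - 0))\<^sup>2)
       + G (z i + of_real t * b i) + \<beta> (z n + of_real t * b n))"
    have Q0: "exp (Q i 0) = e i * exp (\<beta> (z n))" if "1 \<le> i" "i \<le> n" for i
      using Dn0[OF that] by (simp add: Q_def e_def w_def exp_add)
    have "jet2 (Q i) 0 (q i c)" if "1 \<le> i" "i \<le> n" for i
    proof -
      have "jet2 (Q i) (Re (2 / (D i - 0) * (b i - b (i - 1))) + Re (\<Gamma> (z i) * b i) + Re (B (z n) * b n))
        (Re (- 2 / (D i - 0)\<^sup>2 * (b i - b (i - 1)) * (b i - b (i - 1)))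
          + Re (\<Gamma>' (z i) (b i) * b i) + Re (B' (b n) * b n))"
        unfolding Q_def
        by (intro jet2_add cjet_line cjet_ln Dn0 G \<beta>) (use that in auto)
      moreover have "Re (2 / (D i - 0) * (b i - b (i - 1))) + Re (\<Gamma> (z i) * b i) + Re (B (z n) * b n)
        = Re (c * (2 * (a i - a (i - 1)) / D i + \<Gamma> (z i) * a i + B (z n) * a n))"
        unfolding b_def plus_complex.simps(1)[symmetric] by (intro arg_cong[of _ _ Re]) (simp add: algebra_simps diff_divide_distrib)
      moreover have "Re (c * (2 * (a i - a (i - 1)) / D i + \<Gamma> (z i) * a i + B (z n) * a n)) = 0"
        unfolding zero[OF that] by simp
      moreover have "b i - b (i - 1) = c * (a i - a (i - 1))" by (simp add: b_def algebra_simps)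
      ultimately show ?thesis by (simp only: q_def b_def diff_0_right)
    qed
    then have "jet2 (\<lambda>t. exp (Q i t)) (exp (Q i 0) * 0) (exp (Q i 0) * (q i c + 0\<^sup>2))" if "i \<in> {1..n}" for i
      using that by (intro jet2_exp) auto
    then have "jet2 (\<lambda>t. \<Sum>i=1..n. exp (Q i t)) (\<Sum>i=1..n. exp (Q i 0) * 0) (\<Sum>i=1..n. exp (Q i 0) * (q i c + 0\<^sup>2))"
      by (intro jet2_sum) auto
    then have J: "jet2 (\<lambda>t. \<Sum>i=1..n. exp (Q i t)) 0 (\<Sum>i=1..n. exp (Q i 0) * q i c)"
      by simp
    have nz: "\<forall>\<^sub>F t in nhds (0::real). \<forall>i\<in>{1..n}. D i + of_real t * (b i - b (i - 1)) \<noteq> 0"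
    proof (intro eventually_ball_finite ballI)
      fix i assume "i \<in> {1..n}"
      then have nzi: "D i \<noteq> 0" using Dn0 by auto
      have lim: "((\<lambda>t. D i + of_real t * (b i - b (i - 1))) \<longlongrightarrow> D i) (nhds (0::real))"
        by (auto intro!: tendsto_eq_intros filterlim_ident)
      show "\<forall>\<^sub>F t in nhds (0::real). D i + of_real t * (b i - b (i - 1)) \<noteq> 0"
        by (rule tendsto_imp_eventually_ne[OF lim nzi])
    qed simp
    have eq: "(\<Sum>i=1..n. exp (Q i t)) = chain_energy G n (\<lambda>i. z i + of_real t * b i) * exp (\<beta> (z n + of_real t * b n))"
      if "\<forall>i\<in>{1..n}. D i + of_real t * (b i - b (i - 1)) \<noteq> 0" for t :: real
      unfolding chain_energy_def sum_distrib_right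
    proof (intro sum.cong refl)
      fix i assume i: "i \<in> {1..n}"
      have "z i + of_real t * b i - (z (i - 1) + of_real t * b (i - 1)) = D i + of_real t * (b i - b (i - 1))"
        by (simp add: D_def algebra_simps)
      then show "exp (Q i t) = (cmod (z i + of_real t * b i - (z (i - 1) + of_real t * b (i - 1))))\<^sup>2 *
         exp (G (z i + of_real t * b i)) * exp (\<beta> (z n + of_real t * b n))"
        using that i by (simp add: Q_def exp_add)
    qed
    have b0: "b 0 = 0" using a0 by (simp add: b_def)
    have "\<forall>\<^sub>F t in nhds 0. (\<Sum>i=1..n. exp (Q i 0)) \<le> (\<Sum>i=1..n. exp (Q i t))"
      using min[of b, OF b0] nz
    proof eventually_elim
      case (elim t)
      have "\<forall>i\<in>{1..n}. D i + of_real 0 * (b i - b (i - 1)) \<noteq> 0" using Dn0 by auto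
      from elim(1) eq[OF elim(2)] eq[OF this] show ?case by (simp only: of_real_0 mult_zero_left add_0_right)
    qed
    from jet2_local_min[OF J this] have "0 \<le> (\<Sum>i=1..n. exp (Q i 0) * q i c)" .
    also have "\<dots> = (\<Sum>i=1..n. e i * exp (\<beta> (z n)) * q i c)"
      by (intro sum.cong refl) (metis Q0 atLeastAtMost_iff)
    finally show ?thesis .
  qed
  have lin: "linear (\<Gamma>' (z i))" if "i \<in> {1..n}" for i
    using G[OF that] has_derivative_linear by (auto simp: cjet_def)
  have linB: "linear B'" using \<beta> has_derivative_linear by (auto simp: cjet_def)
  have add3: "x1 + y1 + z1 + (x2 + y2 + z2) = u + v" if "x1 + x2 = 0" "y1 + y2 = u" "z1 + z2 = v"
    for x1 x2 y1 y2 z1 z2 u v :: real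
    using that by linarith
  have qq: "q i 1 + q i \<i> < 0" if "i \<in> {1..n}" for i
  proof -
    \<comment> \<open>The logarithm of a step is harmonic and drops out. What remains is the
      Laplacian of G with weight \<open>|a i|^2\<close> and that of \<beta> with weight
      \<open>|a n|^2 = 1\<close>; the latter makes the sum strictly negative.\<close>
    have l: "Re (- 2 / (D i)\<^sup>2 * (1 * d) * (1 * d)) + Re (- 2 / (D i)\<^sup>2 * (\<i> * d) * (\<i> * d)) = 0" for d
    proof -
      have "- 2 / (D i)\<^sup>2 * (\<i> * d) * (\<i> * d) = - (- 2 / (D i)\<^sup>2 * (1 * d) * (1 * d))"
        by (simp add: algebra_simps)
      then show ?thesis by (metis add.right_inverse uminus_complex.sel(1))
    qed
    have "q i 1 + q i \<i> = (cmod (a i))\<^sup>2 * Re (\<Gamma>' (z i) 1 + \<i> * \<Gamma>' (z i) \<i>) + (cmod (a n))\<^sup>2 * Re (B' 1 + \<i> * B' \<i>)"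
      unfolding q_def
      by (rule add3, rule l) (use laplacian_rotate[OF lin[OF that]] laplacian_rotate[OF linB] in \<open>simp_all only: mult_1_left\<close>)
    moreover have "(cmod (a i))\<^sup>2 * Re (\<Gamma>' (z i) 1 + \<i> * \<Gamma>' (z i) \<i>) \<le> 0"
      using lap[OF that] by (simp add: mult_nonneg_nonpos)
    ultimately show ?thesis using lap\<beta> an by simp
  qed
  have "(\<Sum>i=1..n. e i * exp (\<beta> (z n)) * (q i 1 + q i \<i>)) < 0"
  proof -
    have "(\<Sum>i=1..n. e i * exp (\<beta> (z n)) * (q i 1 + q i \<i>)) < (\<Sum>i=1..n. 0)"
      using n epos qq by (intro sum_strict_mono) (auto intro!: mult_pos_neg)
    then show ?thesis by simp
  qed
  then show False using second[of 1] second[of \<i>] by (simp add: algebra_simps sum.distrib)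
qed

section \<open>Euclidean distance, length and energy of a chain\<close>

lemma dist_le_sum_steps:
  fixes z :: "nat \<Rightarrow> complex"
  shows "k \<le> i \<Longrightarrow> cmod (z i - z k) \<le> (\<Sum>j=Suc k..i. cmod (z j - z (j - 1)))"
proof (induction i rule: dec_induct)
  case (step i)
  have "cmod (z (Suc i) - z k) \<le> cmod (z (Suc i) - z i) + cmod (z i - z k)"
    using norm_triangle_ineq[of "z (Suc i) - z i" "z i - z k"] by simp
  then show ?case using step by simp
qed simp

lemma chain_length_le_energy:
  "(\<Sum>j=1..n. cmod (z j - z (j - 1)) * exp (G (z j)))\<^sup>2 \<le> real n * chain_energy (\<lambda>w. 2 * G w) n z"
proof -
  have "(\<Sum>j=1..n. cmod (z j - z (j - 1)) * exp (G (z j)))\<^sup>2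
     \<le> (\<Sum>j=1..n. (cmod (z j - z (j - 1)) * exp (G (z j)))\<^sup>2) * card {1..n}"
    by (rule sum_squared_le_sum_of_squares)
  also have "(\<Sum>j=1..n. (cmod (z j - z (j - 1)) * exp (G (z j)))\<^sup>2) = chain_energy (\<lambda>w. 2 * G w) n z"
    unfolding chain_energy_def by (intro sum.cong) (auto simp: power_mult_distrib exp_double)
  finally show ?thesis by (simp add: mult.commute)
qed

text \<open>Take the last vertex k up to i that is at height at least 1. All later steps end in the
  strip below height 1, where the weight is at least R, and together they cover a Euclidean distance
  of at least 1. The step that crosses height 1 is counted too, since weights are taken at the end
  of a step.\<close>

lemma chain_length_descending:
  fixes z :: "nat \<Rightarrow> complex"
  assumes "i \<le> n" and p: "Im (z 0) \<ge> 1" "Im (z i) = 0"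
    and nonneg: "\<And>j. j \<le> n \<Longrightarrow> Im (z j) \<ge> 0"
    and R: "\<And>w. 0 \<le> Im w \<Longrightarrow> Im w \<le> 1 \<Longrightarrow> R \<le> exp (G w)" and "R > 0"
  shows "R \<le> (\<Sum>j=1..n. cmod (z j - z (j - 1)) * exp (G (z j)))"
proof -
  define k where "k = Max {j. j \<le> i \<and> Im (z j) \<ge> 1}"
  have fin: "finite {j. j \<le> i \<and> Im (z j) \<ge> 1}" by simp
  have k: "k \<le> i" "Im (z k) \<ge> 1"
  proof -
    have "k \<in> {j. j \<le> i \<and> Im (z j) \<ge> 1}"
      unfolding k_def by (rule Max_in[OF fin]) (use p in auto)
    then show "k \<le> i" "Im (z k) \<ge> 1" by auto
  qed
  have low: "Im (z j) < 1" if "j \<in> {Suc k..i}" for j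
  proof (rule ccontr)
    assume "\<not> Im (z j) < 1"
    then have "j \<le> k" unfolding k_def using that by (intro Max_ge fin) auto
    then show False using that by auto
  qed
  have "1 \<le> cmod (z i - z k)" using k p abs_Im_le_cmod[of "z i - z k"] by auto
  also have "\<dots> \<le> (\<Sum>j=Suc k..i. cmod (z j - z (j - 1)))" using k by (intro dist_le_sum_steps)
  finally have "R * 1 \<le> R * (\<Sum>j=Suc k..i. cmod (z j - z (j - 1)))"
    using \<open>R > 0\<close> by (intro mult_left_mono) auto
  also have "\<dots> \<le> (\<Sum>j=Suc k..i. cmod (z j - z (j - 1)) * exp (G (z j)))"
    unfolding sum_distrib_left
  proof (rule sum_mono)
    fix j assume j: "j \<in> {Suc k..i}"
    have "R \<le> exp (G (z j))" using low[OF j] nonneg[of j] j \<open>i \<le> n\<close> by (intro R) auto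
    then show "R * cmod (z j - z (j - 1)) \<le> cmod (z j - z (j - 1)) * exp (G (z j))"
      by (simp add: mult.commute[of R] mult_left_mono)
  qed
  also have "\<dots> \<le> (\<Sum>j=1..n. cmod (z j - z (j - 1)) * exp (G (z j)))"
    using \<open>i \<le> n\<close> by (intro sum_mono2) auto
  finally show ?thesis by simp
qed

text \<open>A perturbation of the Green's function of the upper half plane with pole \<open>p\<close>, made strictly
  superharmonic, with a pole of slightly more than the natural strength.\<close>

definition green :: "real \<Rightarrow> complex \<Rightarrow> complex \<Rightarrow> real" where
  "green \<delta> p w = (1 + \<delta>) * (ln ((cmod (w - cnj p))\<^sup>2) + (- 1) * ln ((cmod (w - p))\<^sup>2)) + (- \<delta>) * (Im w)\<^sup>2"

definition green_grad :: "real \<Rightarrow> complex \<Rightarrow> complex \<Rightarrow> complex" where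
  "green_grad \<delta> p w = of_real (1 + \<delta>) * (2 / (w - cnj p) + of_real (- 1) * (2 / (w - p)))
     + of_real (- \<delta>) * (- 2 * \<i> * of_real (Im w))"

definition green_hess :: "real \<Rightarrow> complex \<Rightarrow> complex \<Rightarrow> complex \<Rightarrow> complex" where
  "green_hess \<delta> p w h = of_real (1 + \<delta>) * (- 2 / (w - cnj p)\<^sup>2 * h + of_real (- 1) * (- 2 / (w - p)\<^sup>2 * h))
     + of_real (- \<delta>) * (- 2 * \<i> * of_real (Im h))"

lemma cjet_Im_square: "cjet (\<lambda>w. (Im w)\<^sup>2) (\<lambda>w. - 2 * \<i> * of_real (Im w)) (\<lambda>h. - 2 * \<i> * of_real (Im h)) z"
  unfolding cjet_def by (auto intro!: derivative_eq_intros always_eventually)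

lemma cjet_green:
  assumes "w \<noteq> p" "w \<noteq> cnj p"
  shows "cjet (green \<delta> p) (green_grad \<delta> p) (green_hess \<delta> p w) w"
  unfolding green_def[abs_def] green_grad_def[abs_def] green_hess_def[abs_def]
  by (intro cjet_add cjet_cmult cjet_ln cjet_Im_square assms)

lemma green_laplacian: "Re (green_hess \<delta> p w 1 + \<i> * green_hess \<delta> p w \<i>) = - 2 * \<delta>"
proof -
  have "Re (of_real c * (\<alpha> * 1 + of_real (- 1) * (\<beta> * 1)) + of_real (- \<delta>) * (- 2 * \<i> * of_real (Im 1)) +
    \<i> * (of_real c * (\<alpha> * \<i> + of_real (- 1) * (\<beta> * \<i>)) + of_real (- \<delta>) * (- 2 * \<i> * of_real (Im \<i>)))) = - 2 * \<delta>"
    for c and \<alpha> \<beta> :: complex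
    by (simp add: algebra_simps)
  then show ?thesis unfolding green_hess_def .
qed

text \<open>This supplies the hypothesis \<open>B (z n) \<noteq> 0\<close> of
  \<open>no_interior_minimum\<close>. Up to a nonzero factor the gradient vanishes only if
  \<open>\<delta> * Im w * q = 2 * (1 + \<delta>) * h\<close>. The imaginary part puts w on the
  vertical line through p; the real part then needs \<open>\<delta> * h * N\<close> to exceed
  2.\<close>

lemma green_grad_nonzero:
  assumes "w \<noteq> p" "0 < Im w" "Im w \<le> N" "0 < Im p" "\<delta> > 0" "\<delta> * Im p * N \<le> 2"
  shows "green_grad \<delta> p w \<noteq> 0"
proof
  assume z: "green_grad \<delta> p w = 0"
  define h where "h = Im p"
  define q where "q = (w - cnj p) * (w - p)"
  have wne: "w \<noteq> cnj p" using assms by (metis add.inverse_inverse cnj.sel(2) less_asym neg_0_less_iff_less)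
  then have q0: "q \<noteq> 0" using assms by (simp add: q_def)
  have cp: "cnj p - p = - 2 * \<i> * of_real h" by (simp add: complex_eq_iff h_def)
  have "2 / (w - cnj p) - 2 / (w - p) = 2 * (cnj p - p) / q"
    using wne assms(1) by (simp add: q_def field_simps)
  then have "of_real (1 + \<delta>) * (2 * (cnj p - p) / q) + 2 * \<i> * of_real (\<delta> * Im w) = 0"
    using z unfolding green_grad_def by (simp add: algebra_simps)
  then have "of_real (1 + \<delta>) * (2 * (cnj p - p)) + 2 * \<i> * of_real (\<delta> * Im w) * q = 0"
    using q0 by (simp add: field_simps)
  then have "2 * \<i> * (of_real (\<delta> * Im w) * q) = 2 * \<i> * of_real (2 * (1 + \<delta>) * h)"
    unfolding cp by (simp add: algebra_simps)
  then have eq: "of_real (\<delta> * Im w) * q = of_real (2 * (1 + \<delta>) * h)" by simp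
  have Imq: "Im q = 2 * (Re w - Re p) * Im w" and Req: "Re q = (Re w - Re p)\<^sup>2 - (Im w)\<^sup>2 + h\<^sup>2"
    by (simp_all add: q_def h_def algebra_simps power2_eq_square)
  have "\<delta> * Im w * Im q = 0" and R: "\<delta> * Im w * Re q = 2 * (1 + \<delta>) * h"
    using arg_cong[OF eq, of Im] arg_cong[OF eq, of Re] by simp_all
  then have "Re w = Re p" using Imq assms by simp
  then have "2 * (1 + \<delta>) * h = \<delta> * Im w * (h\<^sup>2 - (Im w)\<^sup>2)" using R Req by simp
  also have "\<dots> \<le> \<delta> * Im w * h\<^sup>2" using assms by (intro mult_left_mono) auto
  also have "\<dots> \<le> \<delta> * N * h\<^sup>2" using assms by (intro mult_right_mono mult_left_mono) auto
  also have "\<dots> = (\<delta> * h * N) * h" by (simp add: power2_eq_square)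
  also have "\<dots> \<le> 2 * h" using assms by (intro mult_right_mono) (auto simp: h_def)
  finally show False using assms by (simp add: h_def)
qed

text \<open>Points of the upper half plane are nearer to p than to its mirror image, so the
  logarithms contribute a nonnegative amount and only the quadratic perturbation can be
  negative.\<close>

lemma green_lower:
  assumes "w \<noteq> p" "0 \<le> Im w" "Im w \<le> N" "0 < Im p" "\<delta> \<ge> 0"
  shows "green \<delta> p w \<ge> - \<delta> * N\<^sup>2"
proof -
  have "(cmod (w - p))\<^sup>2 \<le> (cmod (w - cnj p))\<^sup>2"
    unfolding cmod_power2 using assms by (auto simp: power2_eq_square algebra_simps)
  then have "0 \<le> ln ((cmod (w - cnj p))\<^sup>2) - ln ((cmod (w - p))\<^sup>2)"
    using assms by (subst diff_ge_0_iff_ge, intro ln_mono) auto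
  then have "0 \<le> (1 + \<delta>) * (ln ((cmod (w - cnj p))\<^sup>2) - ln ((cmod (w - p))\<^sup>2))" using assms by simp
  moreover have "\<delta> * (Im w)\<^sup>2 \<le> \<delta> * N\<^sup>2" using assms by (intro mult_left_mono power_mono) auto
  ultimately show ?thesis unfolding green_def by simp
qed

text \<open>This is the purpose of the excess pole strength: with the natural strength the product
  would stay bounded near p, with strength \<open>1 + \<delta>\<close> it grows like
  \<open>exp (\<delta> * T)\<close>. The end of a minimising chain is thereby repelled from
  p.\<close>

lemma green_near_pole:
  assumes "cmod (w - p) = h * exp (- T / 2)" "0 \<le> Im w" "Im w \<le> N" "h = Im p" "0 < h" "\<delta> \<ge> 0"
  shows "(cmod (w - p))\<^sup>2 * exp (green \<delta> p w) \<ge> h\<^sup>2 * exp (\<delta> * T - \<delta> * N\<^sup>2)"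
proof -
  have "h\<^sup>2 \<le> (Im w + h)\<^sup>2" using assms by (intro power_mono) auto
  then have h2: "h\<^sup>2 \<le> (cmod (w - cnj p))\<^sup>2"
    unfolding cmod_power2 using assms by (simp add: add_increasing)
  have "ln ((cmod (w - p))\<^sup>2) = ln (h\<^sup>2) - T"
    using assms by (simp add: power_mult_distrib ln_mult ln_realpow)
  moreover have "ln (h\<^sup>2) \<le> ln ((cmod (w - cnj p))\<^sup>2)" using h2 assms by (intro ln_mono) auto
  ultimately have "T \<le> ln ((cmod (w - cnj p))\<^sup>2) - ln ((cmod (w - p))\<^sup>2)" by linarith
  then have "(1 + \<delta>) * T \<le> (1 + \<delta>) * (ln ((cmod (w - cnj p))\<^sup>2) - ln ((cmod (w - p))\<^sup>2))"
    using assms by (intro mult_left_mono) auto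
  moreover have "\<delta> * (Im w)\<^sup>2 \<le> \<delta> * N\<^sup>2" using assms by (intro mult_left_mono power_mono) auto
  ultimately have "T + (\<delta> * T - \<delta> * N\<^sup>2) \<le> green \<delta> p w" unfolding green_def by (simp add: algebra_simps)
  then have "exp (T + (\<delta> * T - \<delta> * N\<^sup>2)) \<le> exp (green \<delta> p w)" by simp
  then have "(cmod (w - p))\<^sup>2 * exp (T + (\<delta> * T - \<delta> * N\<^sup>2)) \<le> (cmod (w - p))\<^sup>2 * exp (green \<delta> p w)"
    by (intro mult_left_mono) auto
  moreover have "(exp (- T / 2))\<^sup>2 * exp T = 1" by (simp flip: exp_double exp_add)
  then have "(cmod (w - p))\<^sup>2 * exp (T + (\<delta> * T - \<delta> * N\<^sup>2)) = h\<^sup>2 * exp (\<delta> * T - \<delta> * N\<^sup>2)"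
    using assms(1) by (simp add: power_mult_distrib exp_add mult.assoc del: mult_minus_left)
  ultimately show ?thesis by simp
qed

text \<open>The competitor is the straight chain from p to \<open>p + \<epsilon>\<close>. For
  \<delta> = 0 the bound is \<open>\<epsilon>^2 + 4 h^2\<close>, which tends to the square of
  \<open>2 Im p\<close> as \<epsilon> tends to 0.\<close>

lemma green_reference:
  assumes "\<epsilon> > 0" "h = Im p" "\<delta> \<ge> 0"
  shows "\<epsilon>\<^sup>2 * exp (green \<delta> p (p + of_real \<epsilon>)) \<le> (\<epsilon>\<^sup>2 + 4 * h\<^sup>2) * exp (\<delta> * ln ((\<epsilon>\<^sup>2 + 4 * h\<^sup>2) / \<epsilon>\<^sup>2))"
proof -
  have "(cmod (p + of_real \<epsilon> - cnj p))\<^sup>2 = \<epsilon>\<^sup>2 + 4 * h\<^sup>2"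
    unfolding cmod_power2 using assms by (simp add: power2_eq_square)
  moreover have "(cmod (p + of_real \<epsilon> - p))\<^sup>2 = \<epsilon>\<^sup>2" by simp
  moreover have pos: "\<epsilon>\<^sup>2 + 4 * h\<^sup>2 > 0" using assms by (simp add: add_pos_nonneg)
  ultimately have "green \<delta> p (p + of_real \<epsilon>) = (1 + \<delta>) * ln ((\<epsilon>\<^sup>2 + 4 * h\<^sup>2) / \<epsilon>\<^sup>2) - \<delta> * (Im p)\<^sup>2"
    unfolding green_def using assms by (simp add: ln_div)
  also have "\<dots> \<le> ln ((\<epsilon>\<^sup>2 + 4 * h\<^sup>2) / \<epsilon>\<^sup>2) + \<delta> * ln ((\<epsilon>\<^sup>2 + 4 * h\<^sup>2) / \<epsilon>\<^sup>2)"
    using assms by (simp add: algebra_simps)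
  finally have "exp (green \<delta> p (p + of_real \<epsilon>)) \<le> exp (ln ((\<epsilon>\<^sup>2 + 4 * h\<^sup>2) / \<epsilon>\<^sup>2) + \<delta> * ln ((\<epsilon>\<^sup>2 + 4 * h\<^sup>2) / \<epsilon>\<^sup>2))"
    by simp
  also have "\<dots> = ((\<epsilon>\<^sup>2 + 4 * h\<^sup>2) / \<epsilon>\<^sup>2) * exp (\<delta> * ln ((\<epsilon>\<^sup>2 + 4 * h\<^sup>2) / \<epsilon>\<^sup>2))"
    using pos assms by (subst exp_add, subst exp_ln) auto
  finally show ?thesis using assms by (simp add: field_simps)
qed

section \<open>Minimising chains that reach a prescribed height\<close>

text \<open>Here \<open>h0\<close> bounds n times the functional on the reference chain, and
  \<open>R^2 * exp (- \<delta> * N^2)\<close> is the price of touching the real axis. The gap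
  between them comes from \<open>exp (G p) * (2 * Im p) < R\<close>. First \<epsilon> is fixed, so
  that \<open>G\<close> varies little near p and \<open>A\<close> stays below \<open>R^2\<close>;
  only then \<delta>, because the error \<open>exp (\<delta> * \<Lambda>)\<close> has an exponent
  \<open>\<Lambda>\<close> that depends on \<epsilon>.\<close>

lemma escaping_chain_parameters:
  fixes G :: "complex \<Rightarrow> real"
  assumes cont: "isCont G p" and p: "0 < Im p" and R: "0 < R" "exp (G p) * (2 * Im p) < R" and N: "0 < N"
  obtains \<epsilon> \<delta> h0 where "\<epsilon> > 0" "\<delta> > 0" "\<delta> * Im p * N \<le> 2" "h0 < R\<^sup>2 * exp (- \<delta> * N\<^sup>2)" "h0 > 0"
    "\<And>w. cmod (w - p) \<le> \<epsilon> \<Longrightarrow>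
      exp (2 * G w) * (\<epsilon>\<^sup>2 * exp (green \<delta> p (p + of_real \<epsilon>))) \<le> h0"
proof -
  define h where "h = Im p"
  define A where "A = (\<lambda>\<epsilon>. exp (2 * (G p + \<epsilon>)) * (\<epsilon>\<^sup>2 + 4 * h\<^sup>2))"
  have "A 0 < R\<^sup>2"
  proof -
    have "A 0 = (exp (G p) * (2 * h))\<^sup>2" by (simp add: A_def power_mult_distrib exp_double)
    also have "\<dots> < R\<^sup>2" using R p by (intro power_strict_mono) (auto simp: h_def)
    finally show ?thesis .
  qed
  moreover have "(A \<longlongrightarrow> A 0) (at_right 0)" unfolding A_def by (auto intro!: tendsto_eq_intros)
  ultimately have "\<forall>\<^sub>F \<epsilon> in at_right 0. A \<epsilon> < R\<^sup>2" by (rule order_tendstoD(2)[rotated])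
  then obtain \<epsilon>1 where \<epsilon>1: "\<epsilon>1 > 0" "A \<epsilon>1 < R\<^sup>2"
    using eventually_happens'[OF trivial_limit_at_right_real, OF eventually_conj[OF _ eventually_at_right_less[of 0]]]
    by (metis (mono_tags, lifting))
  have "\<forall>\<^sub>F w in nhds p. G w < G p + \<epsilon>1"
    by (rule order_tendstoD(2)[OF cont[unfolded isCont_def, THEN tendsto_at_iff_tendsto_nhds[THEN iffD1]]]) (use \<epsilon>1 in simp)
  then obtain \<epsilon>2 where \<epsilon>2: "\<epsilon>2 > 0" "\<And>w. dist w p < \<epsilon>2 \<Longrightarrow> G w < G p + \<epsilon>1"
    unfolding eventually_nhds_metric by blast
  define \<epsilon> where "\<epsilon> = min \<epsilon>1 (\<epsilon>2 / 2)"
  have \<epsilon>: "0 < \<epsilon>" "\<epsilon> \<le> \<epsilon>1" "\<epsilon> < \<epsilon>2" using \<epsilon>1 \<epsilon>2 by (auto simp: \<epsilon>_def min_def)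
  define \<Lambda> where "\<Lambda> = ln ((\<epsilon>\<^sup>2 + 4 * h\<^sup>2) / \<epsilon>\<^sup>2)"
  have "((\<lambda>\<delta>. A \<epsilon>1 * exp (\<delta> * \<Lambda>) - R\<^sup>2 * exp (- \<delta> * N\<^sup>2)) \<longlongrightarrow> A \<epsilon>1 - R\<^sup>2) (at_right 0)"
    by (auto intro!: tendsto_eq_intros)
  then have "\<forall>\<^sub>F \<delta> in at_right 0. A \<epsilon>1 * exp (\<delta> * \<Lambda>) - R\<^sup>2 * exp (- \<delta> * N\<^sup>2) < 0"
    by (rule order_tendstoD(2)) (use \<epsilon>1 in auto)
  moreover have "\<forall>\<^sub>F \<delta> in at_right 0. \<delta> * h * N < 2"
  proof (rule order_tendstoD(2))
    show "((\<lambda>\<delta>. \<delta> * h * N) \<longlongrightarrow> 0) (at_right 0)" by (auto intro!: tendsto_eq_intros)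
  qed simp
  ultimately have "\<forall>\<^sub>F \<delta> in at_right 0. A \<epsilon>1 * exp (\<delta> * \<Lambda>) - R\<^sup>2 * exp (- \<delta> * N\<^sup>2) < 0 \<and> \<delta> * h * N < 2 \<and> \<delta> > 0"
    by (intro eventually_conj eventually_at_right_less)
  from eventually_happens'[OF trivial_limit_at_right_real this] obtain \<delta> where \<delta>: "\<delta> > 0" "\<delta> * h * N < 2" "A \<epsilon>1 * exp (\<delta> * \<Lambda>) < R\<^sup>2 * exp (- \<delta> * N\<^sup>2)"
    by auto
  have A: "0 < A \<epsilon>1" "exp (2 * (G p + \<epsilon>1)) * (\<epsilon>\<^sup>2 + 4 * h\<^sup>2) \<le> A \<epsilon>1"
    using p \<epsilon> by (auto simp: A_def h_def intro!: mult_left_mono power_mono add_nonneg_pos mult_pos_pos)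
  show ?thesis
  proof (rule that[of \<epsilon> \<delta> "A \<epsilon>1 * exp (\<delta> * \<Lambda>)"])
    show "\<delta> * Im p * N \<le> 2" using \<delta> by (simp add: h_def)
    fix w assume "cmod (w - p) \<le> \<epsilon>"
    then have "G w \<le> G p + \<epsilon>1" using \<epsilon>2(2)[of w] \<epsilon> by (auto simp: dist_norm)
    have g: "\<epsilon>\<^sup>2 * exp (green \<delta> p (p + of_real \<epsilon>)) \<le> (\<epsilon>\<^sup>2 + 4 * h\<^sup>2) * exp (\<delta> * \<Lambda>)"
      unfolding \<Lambda>_def using \<epsilon> \<delta> by (intro green_reference) (auto simp: h_def)
    with \<open>G w \<le> G p + \<epsilon>1\<close> have "exp (2 * G w) * (\<epsilon>\<^sup>2 * exp (green \<delta> p (p + of_real \<epsilon>)))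
       \<le> exp (2 * (G p + \<epsilon>1)) * ((\<epsilon>\<^sup>2 + 4 * h\<^sup>2) * exp (\<delta> * \<Lambda>))"
      using g by (rule_tac mult_mono) auto
    also have "\<dots> \<le> A \<epsilon>1 * exp (\<delta> * \<Lambda>)" using mult_right_mono[OF A(2), of "exp (\<delta> * \<Lambda>)"] by (simp add: mult.assoc)
    finally show "exp (2 * G w) * (\<epsilon>\<^sup>2 * exp (green \<delta> p (p + of_real \<epsilon>))) \<le> A \<epsilon>1 * exp (\<delta> * \<Lambda>)" .
  qed (use \<epsilon> \<delta> A in auto)
qed

text \<open>Tychonoff. Chains are functions on all of \<open>nat\<close>, so the entries after the
  last vertex have to be confined as well.\<close>

lemma compact_chains:
  assumes "\<And>i::nat. compact (K i :: complex set)"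
  shows "compact (PiE UNIV K)"
proof -
  have "compactin (product_topology (\<lambda>i. euclidean) UNIV) (PiE UNIV K)"
    using assms by (simp add: compactin_PiE)
  then show ?thesis unfolding euclidean_product_topology by simp
qed

text \<open>The functional is minimised over n-step chains from p in a box of height N. The
  minimiser cannot touch the real axis or the sides, nor end near p, since each of these costs more
  than the reference chain. By \<open>no_interior_minimum\<close> it must touch height N. Its length
  is at most R whatever N and n are, and a large n makes every single step short.\<close>

lemma escaping_chain:
  fixes G :: "complex \<Rightarrow> real" and n :: nat
  assumes cont: "continuous_on {w. 0 \<le> Im w} G"
    and jet: "\<And>w. 0 < Im w \<Longrightarrow> cjet G \<Gamma> (\<Gamma>' w) w"
    and lap: "\<And>w. 0 < Im w \<Longrightarrow> Re (\<Gamma>' w 1 + \<i> * \<Gamma>' w \<i>) \<le> 0"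
    and lower: "\<And>w. 0 \<le> Im w \<Longrightarrow> Im w \<le> N \<Longrightarrow> c \<le> G w"
    and R: "\<And>w. 0 \<le> Im w \<Longrightarrow> Im w \<le> 1 \<Longrightarrow> R \<le> exp (G w)" and "R > 0"
    and p: "1 \<le> Im p" "Im p < N" "exp (G p) * (2 * Im p) < R"
    and n: "1 \<le> n"
  obtains z :: "nat \<Rightarrow> complex" and k where "z 0 = p" "1 \<le> k" "Im (z k) = N" "\<And>i. i \<le> k \<Longrightarrow> 0 \<le> Im (z i) \<and> Im (z i) \<le> N"
    "(\<Sum>i=1..k. cmod (z i - z (i - 1)) * exp (G (z i))) \<le> R"
    "\<And>i. 1 \<le> i \<Longrightarrow> i \<le> k \<Longrightarrow> sqrt n * (cmod (z i - z (i - 1)) * exp (G (z i))) \<le> R"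
proof -
  have "continuous_on {w. 0 < Im w} G" by (rule continuous_on_subset[OF cont]) auto
  then have "isCont G p"
    using p by (subst continuous_on_interior[of "{w. 0 < Im w}"]) (auto simp: interior_open open_halfspace_Im_gt)
  then obtain \<epsilon> \<delta> h0 where \<epsilon>: "\<epsilon> > 0" and \<delta>: "\<delta> > 0" "\<delta> * Im p * N \<le> 2"
    and h0: "h0 < R\<^sup>2 * exp (- \<delta> * N\<^sup>2)" "h0 > 0"
    and ref: "\<And>w. cmod (w - p) \<le> \<epsilon> \<Longrightarrow> exp (2 * G w) * (\<epsilon>\<^sup>2 * exp (green \<delta> p (p + of_real \<epsilon>))) \<le> h0"
    by (rule escaping_chain_parameters[of p G R N]) (use p \<open>R > 0\<close> in auto)
  define h where "h = Im p"
  have hpos: "h > 0" "N > 0" using p by (auto simp: h_def)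
  \<comment> \<open>T fixes the radius \<open>h * exp (- T / 2)\<close> of a disc around p that is
    removed for the last vertex: ending on its circle costs more than \<open>h0\<close>, and the
    reference chain ends outside.\<close>
  obtain T where T: "exp (2 * c) * (h\<^sup>2 * exp (\<delta> * T - \<delta> * N\<^sup>2)) > h0" "h * exp (- T / 2) \<le> \<epsilon>"
  proof -
    have "filterlim (\<lambda>T. exp (2 * c) * h\<^sup>2 * exp (- \<delta> * N\<^sup>2) * exp (\<delta> * T)) at_top at_top"
      using \<delta> hpos by (intro filterlim_tendsto_pos_mult_at_top[OF tendsto_const]
         filterlim_compose[OF exp_at_top] filterlim_ident) (auto intro!: mult_pos_pos)
    then have "\<forall>\<^sub>F T in at_top. exp (2 * c) * h\<^sup>2 * exp (- \<delta> * N\<^sup>2) * exp (\<delta> * T) > h0"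
      by (rule filterlim_at_top_dense[THEN iffD1, rule_format])
    moreover have "\<forall>\<^sub>F T in at_top. T \<ge> 2 * ln (h / \<epsilon>)" by (rule eventually_ge_at_top)
    ultimately have "\<forall>\<^sub>F T in at_top. exp (2 * c) * h\<^sup>2 * exp (- \<delta> * N\<^sup>2) * exp (\<delta> * T) > h0 \<and> T \<ge> 2 * ln (h / \<epsilon>)"
      by eventually_elim auto
    then obtain T where T: "exp (2 * c) * h\<^sup>2 * exp (- \<delta> * N\<^sup>2) * exp (\<delta> * T) > h0" "T \<ge> 2 * ln (h / \<epsilon>)"
      using eventually_happens'[OF trivial_limit_at_top_linorder] by blast
    have "exp (- T / 2) \<le> exp (- ln (h / \<epsilon>))" using T(2) by simp
    also have "\<dots> = \<epsilon> / h" using hpos \<epsilon> by (simp add: exp_minus)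
    finally have "h * exp (- T / 2) \<le> \<epsilon>" using hpos by (simp add: field_simps)
    moreover have "exp (2 * c) * h\<^sup>2 * exp (- \<delta> * N\<^sup>2) * exp (\<delta> * T) = exp (2 * c) * (h\<^sup>2 * exp (\<delta> * T - \<delta> * N\<^sup>2))"
      by (simp add: exp_diff exp_minus field_simps)
    ultimately show ?thesis using T(1) that by metis
  qed
  define \<epsilon>0 where "\<epsilon>0 = h * exp (- T / 2)"
  have \<epsilon>0: "0 < \<epsilon>0" "\<epsilon>0 \<le> \<epsilon>" using hpos T by (auto simp: \<epsilon>0_def)
  \<comment> \<open>Half the width of the box: a chain that gets as far as the sides costs more than
    \<open>h0\<close>, while the reference chain stays inside.\<close>
  obtain X where X: "X > \<epsilon>" "exp (2 * c) * X\<^sup>2 * exp (- \<delta> * N\<^sup>2) > h0"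
  proof -
    have "filterlim (\<lambda>X::real. (exp (2 * c) * exp (- \<delta> * N\<^sup>2)) * X\<^sup>2) at_top at_top"
      by (intro filterlim_tendsto_pos_mult_at_top[OF tendsto_const] filterlim_pow_at_top filterlim_ident) auto
    then have "\<forall>\<^sub>F X in at_top. exp (2 * c) * exp (- \<delta> * N\<^sup>2) * X\<^sup>2 > h0"
      by (rule filterlim_at_top_dense[THEN iffD1, rule_format])
    then have "\<forall>\<^sub>F X in at_top. exp (2 * c) * exp (- \<delta> * N\<^sup>2) * X\<^sup>2 > h0 \<and> X > \<epsilon>"
      using eventually_gt_at_top[of \<epsilon>] by eventually_elim auto
    then obtain X where "exp (2 * c) * exp (- \<delta> * N\<^sup>2) * X\<^sup>2 > h0 \<and> X > \<epsilon>"
      using eventually_happens'[OF trivial_limit_at_top_linorder] by blast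
    then show ?thesis by (intro that[of X]) (auto simp: mult_ac)
  qed
  define Box where "Box = cbox (Complex (Re p - X) 0) (Complex (Re p + X) N)"
  have Box: "w \<in> Box \<longleftrightarrow> Re p - X \<le> Re w \<and> Re w \<le> Re p + X \<and> 0 \<le> Im w \<and> Im w \<le> N" for w
    by (auto simp: Box_def in_cbox_complex_iff)
  \<comment> \<open>Only the last vertex is kept away from the pole, since \<open>green\<close> is
    evaluated only there. The entries after n are frozen at 0.\<close>
  define K where "K = (\<lambda>i::nat. if i = 0 then {p} else if i < n then Box else if i = n then Box \<inter> {w. \<epsilon>0 \<le> dist p w} else {0})"
  have K0: "K 0 = {p}" and Kn: "K n = Box \<inter> {w. \<epsilon>0 \<le> dist p w}" and Kgt: "\<And>i. i > n \<Longrightarrow> K i = {0}"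
    and Ksub: "\<And>i. i \<le> n \<Longrightarrow> K i \<subseteq> Box"
    using n p X \<epsilon> by (auto simp: K_def Box)
  define f where "f = (\<lambda>z. chain_energy (\<lambda>w. 2 * G w) n z * exp (green \<delta> p (z n)))"
  have "compact (K i)" for i
  proof -
    have "closed {w. \<epsilon>0 \<le> dist p w}" by (intro closed_Collect_le continuous_intros)
    then show ?thesis by (auto simp: K_def Box_def intro!: compact_Int_closed)
  qed
  then have comp: "compact (PiE UNIV K)" by (rule compact_chains)
  define s where "s = (\<lambda>i. real i / n * \<epsilon>)"
  define r where "r = (\<lambda>i. if i \<le> n then p + of_real (s i) else 0)"
  have s: "0 \<le> s i" "s i \<le> \<epsilon>" if "i \<le> n" for i
  proof -
    have "real i / n * \<epsilon> \<le> 1 * \<epsilon>" using that \<epsilon> n by (intro mult_right_mono) auto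
    then show "s i \<le> \<epsilon>" by (simp add: s_def)
    show "0 \<le> s i" unfolding s_def using \<epsilon> by (intro mult_nonneg_nonneg) auto
  qed
  have sn: "s n = \<epsilon>" "s 0 = 0" using n by (simp_all add: s_def)
  have rK: "r \<in> PiE UNIV K"
  proof -
    have "r i \<in> K i" for i
    proof -
      have "r i \<in> Box" if "i \<le> n"
        using that s[OF that] p X \<epsilon> by (auto simp: Box r_def)
      moreover have "r n \<in> {w. \<epsilon>0 \<le> dist p w}" using \<epsilon>0 by (simp add: r_def dist_norm sn)
      moreover have "r 0 = p" by (simp add: r_def sn)
      moreover have "r i = 0" if "\<not> i \<le> n" using that by (simp add: r_def)
      ultimately show ?thesis unfolding K_def by (cases "i = n") auto
    qed
    then show ?thesis by auto
  qed
  have Kd: "z i \<in> K i" if "z \<in> PiE UNIV K" for z i using that by auto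
  have zn: "z n \<noteq> p" if "z \<in> PiE UNIV K" for z
    using Kd[OF that, of n] \<epsilon>0 Kn by auto
  have co: "continuous_on (PiE UNIV K) (\<lambda>z. z i)" for i
    by (rule continuous_on_product_coordinates[THEN continuous_on_subset]) auto
  have contf: "continuous_on (PiE UNIV K) f"
  proof -
    have Gc: "continuous_on (PiE UNIV K) (\<lambda>z. G (z i))" if "i \<in> {1..n}" for i
      by (rule continuous_on_compose2[OF cont co]) (use Ksub[of i] Kd that Box in auto)
    have "cmod (z n - cnj p) \<noteq> 0" if "z \<in> PiE UNIV K" for z
    proof -
      have "Im (z n) \<ge> 0" using Kd[OF that, of n] Ksub[of n] Box by auto
      then show ?thesis using p by (auto simp: complex_eq_iff)
    qed
    then show ?thesis
      unfolding f_def chain_energy_def green_def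
      by (intro continuous_intros co Gc) (use zn in auto)
  qed
  have "PiE UNIV K \<noteq> {}" using rK by (metis empty_iff)
  then obtain z where z: "z \<in> PiE UNIV K" and min: "\<And>y. y \<in> PiE UNIV K \<Longrightarrow> f z \<le> f y"
    using continuous_attains_inf[OF comp _ contf] by metis
  \<comment> \<open>An equally spaced chain of Euclidean length \<epsilon> has n steps of square
    \<open>\<epsilon>^2 / n^2\<close>, hence the factor n on the left.\<close>
  have fr: "n * f r \<le> h0"
  proof -
    have "chain_energy (\<lambda>w. 2 * G w) n r * (\<epsilon> / n * n)\<^sup>2 * exp (green \<delta> p (p + of_real \<epsilon>))
       = (\<Sum>i=1..n. (\<epsilon> / n)\<^sup>2 * (exp (2 * G (r i)) * (\<epsilon>\<^sup>2 * exp (green \<delta> p (p + of_real \<epsilon>)))))"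
      unfolding chain_energy_def sum_distrib_right
    proof (intro sum.cong refl)
      fix i assume i: "i \<in> {1..n}"
      have "r i - r (i - 1) = of_real (\<epsilon> / n)"
      proof -
        have "i - 1 \<le> n" "s i - s (i - 1) = \<epsilon> / n" using i by (auto simp: s_def of_nat_diff field_simps)
        then show ?thesis using i by (simp add: r_def flip: of_real_diff)
      qed
      then have "(cmod (r i - r (i - 1)))\<^sup>2 = (\<epsilon> / n)\<^sup>2" by (simp only: norm_of_real power2_abs)
      then show "(cmod (r i - r (i - 1)))\<^sup>2 * exp (2 * G (r i)) * (\<epsilon> / n * n)\<^sup>2 * exp (green \<delta> p (p + of_real \<epsilon>)) =
         (\<epsilon> / n)\<^sup>2 * (exp (2 * G (r i)) * (\<epsilon>\<^sup>2 * exp (green \<delta> p (p + of_real \<epsilon>))))"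
        using n by simp
    qed
    also have "\<dots> \<le> (\<Sum>i=1..n. (\<epsilon> / n)\<^sup>2 * h0)"
    proof (intro sum_mono mult_left_mono ref)
      fix i assume i: "i \<in> {1..n}"
      then show "cmod (r i - p) \<le> \<epsilon>" using s[of i] by (simp add: r_def)
    qed auto
    also have "\<dots> = h0 * \<epsilon>\<^sup>2 / n" using n by (simp add: power2_eq_square)
    finally have "f r * \<epsilon>\<^sup>2 \<le> h0 * \<epsilon>\<^sup>2 / n" using n by (simp add: f_def r_def sn mult_ac)
    then show ?thesis using n \<epsilon> by (simp add: field_simps)
  qed
  then have fz: "n * f z \<le> h0"
    using min[OF rK] n by (smt (verit) mult_left_mono of_nat_0_le_iff)
  define len where "len = (\<Sum>i=1..n. cmod (z i - z (i - 1)) * exp (G (z i)))"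
  have len0: "len \<ge> 0" unfolding len_def by (intro sum_nonneg) auto
  \<comment> \<open>By Cauchy-Schwarz n times the energy dominates the squared length. Each of the
    barriers \<open>intX\<close>, \<open>intp\<close>, \<open>int0\<close> is a lower bound for this
    product that exceeds \<open>h0\<close>.\<close>
  have le: "len\<^sup>2 * exp (green \<delta> p (z n)) \<le> h0"
  proof -
    have "len\<^sup>2 * exp (green \<delta> p (z n)) \<le> (n * chain_energy (\<lambda>w. 2 * G w) n z) * exp (green \<delta> p (z n))"
      unfolding len_def by (intro mult_right_mono chain_length_le_energy) auto
    then show ?thesis using fz unfolding f_def by (simp only: mult.assoc)
  qed
  have zB: "0 \<le> Im (z i)" "Im (z i) \<le> N" if "i \<le> n" for i
    using Kd[OF z, of i] Ksub[OF that] Box by auto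
  have z0: "z 0 = p" using Kd[OF z, of 0] K0 by simp
  have gl: "exp (green \<delta> p (z n)) \<ge> exp (- \<delta> * N\<^sup>2)"
    using green_lower[of "z n" p N \<delta>] zn[OF z] zB[of n] p \<delta> by simp
  have distlen: "exp c * cmod (z i - p) \<le> len" if "i \<le> n" for i
  proof -
    have "exp c * cmod (z i - p) \<le> exp c * (\<Sum>j=Suc 0..i. cmod (z j - z (j - 1)))"
      using dist_le_sum_steps[of 0 i z] z0 by simp
    also have "\<dots> \<le> exp c * (\<Sum>j=1..n. cmod (z j - z (j - 1)))"
      using that by (intro mult_left_mono sum_mono2) auto
    also have "\<dots> \<le> len" unfolding len_def sum_distrib_left
    proof (rule sum_mono)
      fix i assume "i \<in> {1..n}"
      then have "exp c \<le> exp (G (z i))" using lower[of "z i"] zB[of i] by auto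
      then show "exp c * cmod (z i - z (i - 1)) \<le> cmod (z i - z (i - 1)) * exp (G (z i))"
        by (simp add: mult.commute[of "exp c"] mult_left_mono)
    qed
    finally show ?thesis .
  qed
  have dist2: "exp (2 * c) * (cmod (z i - p))\<^sup>2 \<le> len\<^sup>2" if "i \<le> n" for i
    using power_mono[OF distlen[OF that], of 2] by (simp add: power_mult_distrib exp_double)
  have intX: "\<bar>Re (z i) - Re p\<bar> < X" if "i \<le> n" for i
  proof (rule ccontr)
    assume "\<not> ?thesis"
    then have "X \<le> cmod (z i - p)" using abs_Re_le_cmod[of "z i - p"] by simp
    then have "X\<^sup>2 \<le> (cmod (z i - p))\<^sup>2" using X \<epsilon> by (intro power_mono) auto
    then have "exp (2 * c) * X\<^sup>2 \<le> len\<^sup>2"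
      using dist2[OF that] by (smt (verit) exp_gt_zero mult_left_mono)
    then have "exp (2 * c) * X\<^sup>2 * exp (- \<delta> * N\<^sup>2) \<le> len\<^sup>2 * exp (green \<delta> p (z n))"
      using gl by (intro mult_mono) auto
    then show False using le X by linarith
  qed
  have intp: "\<epsilon>0 < dist p (z n)"
  proof (rule ccontr)
    assume "\<not> ?thesis"
    then have d: "cmod (z n - p) = h * exp (- T / 2)"
      using Kd[OF z, of n] Kn by (auto simp: dist_norm norm_minus_commute \<epsilon>0_def)
    have "h\<^sup>2 * exp (\<delta> * T - \<delta> * N\<^sup>2) \<le> (cmod (z n - p))\<^sup>2 * exp (green \<delta> p (z n))"
      using green_near_pole[OF d, of N \<delta>] zB[of n] hpos \<delta> by (simp add: h_def)
    then have "exp (2 * c) * (h\<^sup>2 * exp (\<delta> * T - \<delta> * N\<^sup>2)) \<le> exp (2 * c) * ((cmod (z n - p))\<^sup>2 * exp (green \<delta> p (z n)))"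
      by (intro mult_left_mono) auto
    also have "\<dots> \<le> len\<^sup>2 * exp (green \<delta> p (z n))"
      unfolding mult.assoc[symmetric] by (intro mult_right_mono dist2) auto
    finally show False using le T by linarith
  qed
  have int0: "0 < Im (z i)" if "i \<le> n" for i
  proof (rule ccontr)
    assume "\<not> ?thesis"
    then have "R \<le> len" unfolding len_def
      using zB[OF that] zB z0 p \<open>R > 0\<close> by (intro chain_length_descending[OF that]) (auto intro!: R)
    then have "R\<^sup>2 \<le> len\<^sup>2" using \<open>R > 0\<close> by (intro power_mono) auto
    then have "R\<^sup>2 * exp (- \<delta> * N\<^sup>2) \<le> len\<^sup>2 * exp (green \<delta> p (z n))"
      using gl by (intro mult_mono) auto
    then show False using le h0 by linarith
  qed
  have "\<exists>i\<in>{1..n}. Im (z i) = N"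
  proof (rule ccontr)
    assume "\<not> ?thesis"
    then have intN: "Im (z i) < N" if "1 \<le> i" "i \<le> n" for i using zB[OF that(2)] that by force
    have wn: "z n \<noteq> cnj p" using int0[of n] p by (auto simp: complex_eq_iff)
    show False
    proof (rule no_interior_minimum[of n "\<lambda>w. 2 * G w" "\<lambda>w. of_real 2 * \<Gamma> w" "\<lambda>w h. of_real 2 * \<Gamma>' w h" z
        "green \<delta> p" "green_grad \<delta> p" "green_hess \<delta> p (z n)"])
      show "cjet (\<lambda>w. 2 * G w) (\<lambda>w. of_real 2 * \<Gamma> w) (\<lambda>h. of_real 2 * \<Gamma>' (z i) h) (z i)" if "i \<in> {1..n}" for i
        using int0[of i] that by (intro cjet_cmult jet) auto
      show "Re (of_real 2 * \<Gamma>' (z i) 1 + \<i> * (of_real 2 * \<Gamma>' (z i) \<i>)) \<le> 0" if "i \<in> {1..n}" for i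
        using lap[of "z i"] int0[of i] that by simp
      show "cjet (green \<delta> p) (green_grad \<delta> p) (green_hess \<delta> p (z n)) (z n)"
        using zn[OF z] wn by (rule cjet_green)
      show "green_grad \<delta> p (z n) \<noteq> 0"
        using zn[OF z] int0[of n] zB[of n] p \<delta> by (intro green_grad_nonzero) auto
      show "Re (green_hess \<delta> p (z n) 1 + \<i> * green_hess \<delta> p (z n) \<i>) < 0"
        unfolding green_laplacian using \<delta> by simp
      show "z n \<noteq> z 0" using zn[OF z] z0 by simp
      fix a :: "nat \<Rightarrow> complex" assume a0: "a 0 = 0"
      \<comment> \<open>The varied chain, cut off after n so that it belongs to the compact family
        \<open>PiE UNIV K\<close>. It does so for small t because all constraints on the moving
        vertices hold strictly at \<open>z\<close>.\<close>
      define y where "y = (\<lambda>t i. if i \<le> n then z i + of_real t * a i else 0)"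
      have lim: "((\<lambda>t. z i + of_real t * a i) \<longlongrightarrow> z i) (nhds (0::real))" for i
        by (auto intro!: tendsto_eq_intros filterlim_ident)
      have ev1: "\<forall>\<^sub>F t in nhds (0::real). z i + of_real t * a i \<in> Box" if "1 \<le> i" "i \<le> n" for i
      proof -
        have "z i \<in> box (Complex (Re p - X) 0) (Complex (Re p + X) N)"
          using intX[of i] int0[of i] intN[of i] that by (auto simp: in_box_complex_iff)
        from topological_tendstoD[OF lim open_box this] show ?thesis
          by (rule eventually_mono) (auto simp: Box_def box_subset_cbox[THEN subsetD])
      qed
      have ev2: "\<forall>\<^sub>F t in nhds (0::real). \<epsilon>0 < dist p (z n + of_real t * a n)"
        by (rule order_tendstoD(1)[OF _ intp]) (intro tendsto_intros lim)
      have "\<forall>\<^sub>F t in nhds (0::real). \<forall>i\<in>{1..n}. z i + of_real t * a i \<in> Box"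
        using ev1 by (intro eventually_ball_finite) auto
      then have "\<forall>\<^sub>F t in nhds (0::real). y t \<in> PiE UNIV K"
        using ev2
      proof eventually_elim
        case (elim t)
        have "y t i \<in> K i" for i
          using elim a0 z0 n unfolding K_def y_def by auto
        then show ?case by auto
      qed
      then show "\<forall>\<^sub>F t in nhds (0::real). chain_energy (\<lambda>w. 2 * G w) n z * exp (green \<delta> p (z n))
        \<le> chain_energy (\<lambda>w. 2 * G w) n (\<lambda>i. z i + of_real t * a i) * exp (green \<delta> p (z n + of_real t * a n))"
      proof eventually_elim
        case (elim t)
        have "chain_energy (\<lambda>w. 2 * G w) n (y t) = chain_energy (\<lambda>w. 2 * G w) n (\<lambda>i. z i + of_real t * a i)"
          unfolding chain_energy_def by (intro sum.cong) (auto simp: y_def)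
        moreover have "y t n = z n + of_real t * a n" by (simp add: y_def)
        ultimately show ?case using min[OF elim] by (simp add: f_def)
      qed
    qed (use n in simp)
  qed
  then obtain k where k: "1 \<le> k" "k \<le> n" "Im (z k) = N" by auto
  have "len\<^sup>2 * exp (- \<delta> * N\<^sup>2) \<le> R\<^sup>2 * exp (- \<delta> * N\<^sup>2)"
    using mult_left_mono[OF gl zero_le_power2[of len]] le h0 by linarith
  then have "len\<^sup>2 \<le> R\<^sup>2" by simp
  then have lenR: "len \<le> R" using \<open>R > 0\<close> by (simp add: abs_le_square_iff[symmetric])
  show ?thesis
  proof (rule that[of z k, OF z0 k(1,3)])
    show "0 \<le> Im (z i) \<and> Im (z i) \<le> N" if "i \<le> k" for i using zB[of i] that k by auto
    have "(\<Sum>i=1..k. cmod (z i - z (i - 1)) * exp (G (z i))) \<le> len"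
      unfolding len_def using k by (intro sum_mono2) auto
    then show "(\<Sum>i=1..k. cmod (z i - z (i - 1)) * exp (G (z i))) \<le> R" using lenR by linarith
    fix i assume i: "1 \<le> i" "i \<le> k"
    \<comment> \<open>One summand of the energy is at most the whole, and n times the energy is
      below \<open>R^2\<close> up to the end factor: a single step has length at most
      \<open>R / sqrt n\<close>.\<close>
    have "(cmod (z i - z (i - 1)) * exp (G (z i)))\<^sup>2 \<le> chain_energy (\<lambda>w. 2 * G w) n z"
      unfolding chain_energy_def using i k
      by (intro order_trans[OF _ member_le_sum[of i]]) (auto simp: power_mult_distrib exp_double)
    then have "n * (cmod (z i - z (i - 1)) * exp (G (z i)))\<^sup>2 \<le> n * chain_energy (\<lambda>w. 2 * G w) n z"
      by (intro mult_left_mono) auto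
    moreover have "n * chain_energy (\<lambda>w. 2 * G w) n z * exp (- \<delta> * N\<^sup>2) \<le> R\<^sup>2 * exp (- \<delta> * N\<^sup>2)"
    proof -
      have "n * chain_energy (\<lambda>w. 2 * G w) n z * exp (- \<delta> * N\<^sup>2) \<le> n * chain_energy (\<lambda>w. 2 * G w) n z * exp (green \<delta> p (z n))"
        using gl by (intro mult_left_mono) (auto simp: chain_energy_def intro!: sum_nonneg mult_nonneg_nonneg)
      then show ?thesis using fz h0 unfolding f_def by (simp only: mult.assoc)
    qed
    ultimately have "(sqrt n * (cmod (z i - z (i - 1)) * exp (G (z i))))\<^sup>2 \<le> R\<^sup>2"
      by (simp add: power_mult_distrib)
    then show "sqrt n * (cmod (z i - z (i - 1)) * exp (G (z i))) \<le> R"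
      using \<open>R > 0\<close> by (simp add: abs_le_square_iff[symmetric])
  qed
qed

section \<open>Escaping chains in complete metric spaces\<close>

text \<open>A total length r suffices to reach every level of f. The steps can be made arbitrarily
  small so that a chain can be cut close to its midpoint.\<close>

definition (in Metric_space) escapes :: "('a \<Rightarrow> real) \<Rightarrow> 'a \<Rightarrow> real \<Rightarrow> bool" where
  "escapes f x r \<longleftrightarrow> (\<forall>K. \<forall>\<sigma>>0. \<exists>(c :: nat \<Rightarrow> 'a) n. c 0 = x \<and> (\<forall>i\<le>n. c i \<in> M) \<and> K \<le> f (c n) \<and>
     (\<Sum>i=1..n. d (c (i - 1)) (c i)) \<le> r \<and> (\<forall>i\<in>{1..n}. d (c (i - 1)) (c i) \<le> \<sigma>))"

lemma (in Metric_space) chain_dist_le: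
  fixes c :: "nat \<Rightarrow> 'a"
  assumes "\<And>i. i \<le> n \<Longrightarrow> c i \<in> M"
  shows "j \<le> n \<Longrightarrow> d (c 0) (c j) \<le> (\<Sum>i=1..j. d (c (i - 1)) (c i))"
proof (induction j)
  case (Suc j)
  have "d (c 0) (c (Suc j)) \<le> d (c 0) (c j) + d (c j) (c (Suc j))"
    using assms Suc.prems by (intro triangle) auto
  then show ?case using Suc by simp
qed (use assms in simp)

text \<open>Cut at the last index whose initial length is at most r / 2; the overshoot is at most
  one step.\<close>

lemma (in Metric_space) chain_midpoint:
  fixes c :: "nat \<Rightarrow> 'a"
  assumes c: "\<And>i. i \<le> n \<Longrightarrow> c i \<in> M" and len: "(\<Sum>i=1..n. d (c (i - 1)) (c i)) \<le> r"
    and step: "\<And>i. i \<in> {1..n} \<Longrightarrow> d (c (i - 1)) (c i) \<le> \<sigma>" and "0 \<le> r" "0 \<le> \<sigma>"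
  obtains j where "j \<le> n" "(\<Sum>i=1..j. d (c (i - 1)) (c i)) \<le> r / 2"
    "(\<Sum>i=Suc j..n. d (c (i - 1)) (c i)) \<le> r / 2 + \<sigma>"
proof -
  define S where "S = (\<lambda>j. \<Sum>i=1..j. d (c (i - 1)) (c i))"
  define A where "A = {j. j \<le> n \<and> S j \<le> r / 2}"
  have A: "finite A" "0 \<in> A" using \<open>0 \<le> r\<close> by (auto simp: A_def S_def)
  define j where "j = Max A"
  have j: "j \<le> n" "S j \<le> r / 2" using Max_in[of A] A(1,2) unfolding j_def[symmetric] by (auto simp: A_def)
  have split: "S n = S j + (\<Sum>i=Suc j..n. d (c (i - 1)) (c i))"
    unfolding S_def using j(1) sum.ub_add_nat[of 1 j "\<lambda>i. d (c (i - 1)) (c i)" "n - j"] by simp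
  have "(\<Sum>i=Suc j..n. d (c (i - 1)) (c i)) \<le> r / 2 + \<sigma>"
  proof (cases "j = n")
    case False
    then have "Suc j \<le> n" using j by auto
    then have "\<not> S (Suc j) \<le> r / 2"
      using Max_ge[OF A(1), of "Suc j"] unfolding j_def[symmetric] by (auto simp: A_def)
    moreover have "S (Suc j) = S j + d (c j) (c (Suc j))" by (simp add: S_def)
    moreover have "d (c j) (c (Suc j)) \<le> \<sigma>" using step[of "Suc j"] \<open>Suc j \<le> n\<close> by simp
    moreover have "S n \<le> r" using len by (simp add: S_def)
    ultimately show ?thesis using split by linarith
  qed (use assms in simp)
  then show ?thesis by (rule that[of j, OF j(1) j(2)[unfolded S_def]])
qed

text \<open>Cut the chains at their midpoints. If f is unbounded along the midpoints, the first
  halves already escape from x. Otherwise the midpoints accumulate at a point l, and the second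
  halves, preceded by a short jump from l, escape from l. The factor 3 / 4 leaves room for the jump
  and the overshoot, at most r / 8 each.\<close>

lemma (in Metric_space) escapes_halving:
  fixes f :: "'a \<Rightarrow> real"
  assumes esc: "escapes f x r" and r: "0 < r" and x: "x \<in> M"
    and compact: "\<And>K s. (\<And>n::nat. s n \<in> M \<and> f (s n) \<le> K) \<Longrightarrow>
      \<exists>y\<in>M. \<exists>q. strict_mono q \<and> (\<lambda>n. d (s (q n)) y) \<longlonglongrightarrow> 0"
  shows "\<exists>y\<in>M. d x y \<le> r \<and> escapes f y (3 / 4 * r)"
proof -
  define \<sigma> where "\<sigma> = (\<lambda>k::nat. min (1 / Suc k) (r / 8))"
  have \<sigma>: "\<sigma> k > 0" "\<sigma> k \<le> r / 8" "\<sigma> k \<le> 1 / Suc k" for k using r by (auto simp: \<sigma>_def)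
  define P where "P = (\<lambda>k (c :: nat \<Rightarrow> 'a) n j. c 0 = x \<and> (\<forall>i\<le>n. c i \<in> M) \<and> real k \<le> f (c n) \<and> (\<forall>i\<in>{1..n}. d (c (i - 1)) (c i) \<le> \<sigma> k) \<and>
     j \<le> n \<and> (\<Sum>i=1..j. d (c (i - 1)) (c i)) \<le> r / 2 \<and> (\<Sum>i=Suc j..n. d (c (i - 1)) (c i)) \<le> r / 2 + \<sigma> k)"
  have "\<exists>(c :: nat \<Rightarrow> 'a) n j. c 0 = x \<and> (\<forall>i\<le>n. c i \<in> M) \<and> real k \<le> f (c n) \<and> (\<forall>i\<in>{1..n}. d (c (i - 1)) (c i) \<le> \<sigma> k) \<and>
     j \<le> n \<and> (\<Sum>i=1..j. d (c (i - 1)) (c i)) \<le> r / 2 \<and> (\<Sum>i=Suc j..n. d (c (i - 1)) (c i)) \<le> r / 2 + \<sigma> k" for k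
  proof -
    obtain c :: "nat \<Rightarrow> 'a" and n where c: "c 0 = x" "\<forall>i\<le>n. c i \<in> M" "real k \<le> f (c n)"
      "(\<Sum>i=1..n. d (c (i - 1)) (c i)) \<le> r" "\<forall>i\<in>{1..n}. d (c (i - 1)) (c i) \<le> \<sigma> k"
      using esc \<sigma>(1)[of k] unfolding escapes_def by meson
    obtain j where "j \<le> n" "(\<Sum>i=1..j. d (c (i - 1)) (c i)) \<le> r / 2" "(\<Sum>i=Suc j..n. d (c (i - 1)) (c i)) \<le> r / 2 + \<sigma> k"
      by (rule chain_midpoint[of n c r "\<sigma> k"]) (use c r \<sigma>(1)[of k] in auto)
    then show ?thesis using c by (intro exI[of _ c] exI[of _ n] exI[of _ j] conjI) assumption+
  qed
  then have "\<forall>k. \<exists>(c :: nat \<Rightarrow> 'a) n j. P k c n j" unfolding P_def by (intro allI)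
  then obtain c where "\<forall>k. \<exists>n j. P k (c k) n j" by (rule choice[THEN exE])
  then obtain n where "\<forall>k. \<exists>j. P k (c k) (n k) j" by (rule choice[THEN exE])
  then obtain j where "\<forall>k. P k (c k) (n k) (j k)" by (rule choice[THEN exE])
  then have c: "\<And>k. c k 0 = x" "\<And>i k. i \<le> n k \<Longrightarrow> c k i \<in> M" "\<And>k. real k \<le> f (c k (n k))"
      "\<And>i k. i \<in> {1..n k} \<Longrightarrow> d (c k (i - 1)) (c k i) \<le> \<sigma> k"
      "\<And>k. j k \<le> n k" "\<And>k. (\<Sum>i=1..j k. d (c k (i - 1)) (c k i)) \<le> r / 2"
      "\<And>k. (\<Sum>i=Suc (j k)..n k. d (c k (i - 1)) (c k i)) \<le> r / 2 + \<sigma> k"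
    unfolding P_def by auto
  define y where "y = (\<lambda>k. c k (j k))"
  have yM: "y k \<in> M" for k using c(2,5) by (simp add: y_def)
  have xy: "d x (y k) \<le> r / 2" for k
    using chain_dist_le[of "n k" "c k" "j k", OF c(2)] c(1)[of k] c(5)[of k] c(6)[of k] unfolding y_def by simp
  show ?thesis
  proof (cases "\<forall>K. \<forall>N. \<exists>k\<ge>N. K \<le> f (y k)")
    case True
    have "escapes f x (3 / 4 * r)"
      unfolding escapes_def
    proof (intro allI impI)
      fix K \<epsilon> :: real assume "0 < \<epsilon>"
      obtain N where N: "1 / Suc N < \<epsilon>" using \<open>0 < \<epsilon>\<close> reals_Archimedean[of \<epsilon>] by (auto simp: inverse_eq_divide)
      obtain k where k: "k \<ge> N" "K \<le> f (y k)" using True by blast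
      have "\<sigma> k \<le> 1 / Suc k" by (rule \<sigma>(3))
      also have "\<dots> \<le> 1 / Suc N" using k by (simp add: frac_le)
      finally have "\<sigma> k \<le> \<epsilon>" using N by linarith
      then have "\<forall>i\<in>{1..j k}. d (c k (i - 1)) (c k i) \<le> \<epsilon>" using c(4)[of _ k] c(5)[of k] by fastforce
      moreover have "(\<Sum>i=1..j k. d (c k (i - 1)) (c k i)) \<le> 3 / 4 * r" using c(6)[of k] r by linarith
      ultimately show "\<exists>(c :: nat \<Rightarrow> 'a) n. c 0 = x \<and> (\<forall>i\<le>n. c i \<in> M) \<and> K \<le> f (c n) \<and>
         (\<Sum>i=1..n. d (c (i - 1)) (c i)) \<le> 3 / 4 * r \<and> (\<forall>i\<in>{1..n}. d (c (i - 1)) (c i) \<le> \<epsilon>)"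
        using c(1)[of k] c(2)[of _ k] c(5)[of k] k unfolding y_def
        by (intro exI[of _ "c k"] exI[of _ "j k"]) (auto dest: order_trans)
    qed
    then show ?thesis using x r by (intro bexI[of _ x]) auto
  next
    case False
    then obtain K0 N0 where "\<And>k. k \<ge> N0 \<Longrightarrow> f (y k) < K0" by (metis not_le)
    then have "y (n + N0) \<in> M \<and> f (y (n + N0)) \<le> K0" for n using yM by (simp add: less_imp_le)
    from compact[of "\<lambda>n. y (n + N0)", OF this] obtain l q where l: "l \<in> M" "strict_mono q"
      "(\<lambda>n. d (y (q n + N0)) l) \<longlonglongrightarrow> 0" by auto
    have close: "\<exists>k\<ge>N. d (y k) l < \<epsilon>" if "0 < \<epsilon>" for N \<epsilon>
    proof -
      have "\<forall>\<^sub>F n in sequentially. d (y (q n + N0)) l < \<epsilon>" using order_tendstoD(2)[OF l(3) that] .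
      then have "\<forall>\<^sub>F n in sequentially. d (y (q n + N0)) l < \<epsilon> \<and> n \<ge> N"
        using eventually_ge_at_top[of N] by eventually_elim auto
      then obtain m where "d (y (q m + N0)) l < \<epsilon>" "m \<ge> N"
        using eventually_happens'[OF sequentially_bot] by blast
      moreover have "q m \<ge> m" using l(2) by (rule seq_suble)
      ultimately show ?thesis by (intro exI[of _ "q m + N0"]) auto
    qed
    have "escapes f l (3 / 4 * r)"
      unfolding escapes_def
    proof (intro allI impI)
      fix K \<epsilon> :: real assume "0 < \<epsilon>"
      obtain N1 where N1: "1 / Suc N1 < \<epsilon>" using \<open>0 < \<epsilon>\<close> reals_Archimedean[of \<epsilon>] by (auto simp: inverse_eq_divide)
      obtain N2 :: nat where N2: "K \<le> real N2" using real_arch_simple by blast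
      obtain k where k: "k \<ge> max N1 N2" "d (y k) l < min \<epsilon> (r / 8)" using close[of "min \<epsilon> (r / 8)" "max N1 N2"] \<open>0 < \<epsilon>\<close> r by auto
      have "\<sigma> k \<le> 1 / Suc k" by (rule \<sigma>(3))
      also have "\<dots> \<le> 1 / Suc N1" using k by (simp add: frac_le)
      finally have \<sigma>k: "\<sigma> k \<le> \<epsilon>" using N1 by linarith
      \<comment> \<open>The second half of the chain with l put in front: index i of
        \<open>b\<close> is index \<open>j k + i - 1\<close> of \<open>c k\<close>, and the first
        step is the jump from l to the midpoint.\<close>
      define b where "b = (\<lambda>i. if i = 0 then l else c k (j k + i - 1))"
      define m where "m = n k - j k + 1"
      have b0: "d (b 0) (b 1) = d (y k) l" by (simp add: b_def y_def commute)
      have bstep: "d (b (i - 1)) (b i) = d (c k (j k + i - 1 - 1)) (c k (j k + i - 1))" if "i \<ge> 2" for i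
        using that by (simp add: b_def)
      have "(\<Sum>i=1..m. d (b (i - 1)) (b i)) = d (b 0) (b 1) + (\<Sum>i=2..m. d (b (i - 1)) (b i))"
        by (subst sum.atLeast_Suc_atMost) (auto simp: m_def numeral_2_eq_2)
      also have "(\<Sum>i=2..m. d (b (i - 1)) (b i)) = (\<Sum>i=Suc (j k)..n k. d (c k (i - 1)) (c k i))"
      proof (rule sum.reindex_bij_witness[of _ "\<lambda>i. i + 1 - j k" "\<lambda>i. j k + i - 1"])
        fix i assume "i \<in> {2..m}"
        then show "d (c k (j k + i - 1 - 1)) (c k (j k + i - 1)) = d (b (i - 1)) (b i)"
          using bstep[of i] by simp
      qed (use c(5)[of k] in \<open>auto simp: m_def\<close>)
      also have "d (b 0) (b 1) + \<dots> \<le> r / 8 + (r / 2 + r / 8)"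
        using k b0 c(7)[of k] \<sigma>(2)[of k] by auto
      finally have "(\<Sum>i=1..m. d (b (i - 1)) (b i)) \<le> 3 / 4 * r" by simp
      moreover have "\<forall>i\<in>{1..m}. d (b (i - 1)) (b i) \<le> \<epsilon>"
      proof
        fix i assume i: "i \<in> {1..m}"
        show "d (b (i - 1)) (b i) \<le> \<epsilon>"
        proof (cases "i = 1")
          case True
          then show ?thesis using b0 k by simp
        next
          case False
          then have "j k + i - 1 \<in> {1..n k}" "i \<ge> 2" using i c(5)[of k] by (auto simp: m_def)
          then show ?thesis using c(4)[of "j k + i - 1" k] bstep[of i] \<sigma>k by linarith
        qed
      qed
      moreover have "b 0 = l" "b m = c k (n k)" using c(5)[of k] by (auto simp: b_def m_def)
      moreover have "\<forall>i\<le>m. b i \<in> M" using l c(2)[of _ k] c(5)[of k] by (auto simp: b_def m_def)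
      moreover have "K \<le> f (c k (n k))" using c(3)[of k] N2 k by linarith
      ultimately show "\<exists>(c :: nat \<Rightarrow> 'a) n. c 0 = l \<and> (\<forall>i\<le>n. c i \<in> M) \<and> K \<le> f (c n) \<and>
         (\<Sum>i=1..n. d (c (i - 1)) (c i)) \<le> 3 / 4 * r \<and> (\<forall>i\<in>{1..n}. d (c (i - 1)) (c i) \<le> \<epsilon>)"
        by (intro exI[of _ b] exI[of _ m]) auto
    qed
    moreover have "d x l \<le> r"
    proof -
      obtain k where "d (y k) l < r / 8" using close[of "r / 8" 0] r by auto
      then show ?thesis using triangle[OF x yM[of k] l(1)] xy[of k] r by linarith
    qed
    ultimately show ?thesis using l by blast
  qed
qed

text \<open>A Hopf-Rinow argument: halving the length of the escaping chains again and again produces a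
  Cauchy sequence without limit.\<close>

lemma (in Metric_space) complete_not_escapes:
  fixes f :: "'a \<Rightarrow> real"
  assumes complete: "mcomplete" and x: "x \<in> M" and r: "0 < r"
    and compact: "\<And>K s. (\<And>n::nat. s n \<in> M \<and> f (s n) \<le> K) \<Longrightarrow>
      \<exists>y\<in>M. \<exists>q. strict_mono q \<and> (\<lambda>n. d (s (q n)) y) \<longlonglongrightarrow> 0"
    and far: "\<And>y. y \<in> M \<Longrightarrow> \<exists>c>0. \<exists>K. \<forall>z\<in>M. K \<le> f z \<longrightarrow> c \<le> d y z"
  shows "\<not> escapes f x r"
proof
  assume esc: "escapes f x r"
  have "\<exists>s. \<forall>k. (s k \<in> M \<and> escapes f (s k) ((3 / 4) ^ k * r)) \<and> d (s k) (s (Suc k)) \<le> (3 / 4) ^ k * r"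
  proof (rule dependent_nat_choice)
    show "\<exists>y. y \<in> M \<and> escapes f y ((3 / 4) ^ 0 * r)" using x esc by auto
    fix y k assume "y \<in> M \<and> escapes f y ((3 / 4) ^ k * r)"
    then show "\<exists>z. (z \<in> M \<and> escapes f z ((3 / 4) ^ Suc k * r)) \<and> d y z \<le> (3 / 4) ^ k * r"
    proof -
      assume y: "y \<in> M \<and> escapes f y ((3 / 4) ^ k * r)"
      have "\<exists>z\<in>M. d y z \<le> (3 / 4) ^ k * r \<and> escapes f z (3 / 4 * ((3 / 4) ^ k * r))"
      proof (rule escapes_halving)
        fix K s assume "\<And>n::nat. s n \<in> M \<and> f (s n) \<le> K"
        then show "\<exists>y\<in>M. \<exists>q. strict_mono q \<and> (\<lambda>n. d (s (q n)) y) \<longlonglongrightarrow> 0" by (rule compact)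
      qed (use y r in auto)
      then show ?thesis by (auto simp: mult.assoc)
    qed
  qed
  then obtain s where s: "\<And>k. s k \<in> M" "\<And>k. escapes f (s k) ((3 / 4) ^ k * r)"
    "\<And>k. d (s k) (s (Suc k)) \<le> (3 / 4) ^ k * r" by blast
  \<comment> \<open>A partial sum of the geometric series with ratio 3 / 4, whose total is
    4.\<close>
  have tail: "d (s k) (s (k + i)) \<le> 4 * r * (3 / 4) ^ k * (1 - (3 / 4) ^ i)" for k i
  proof (induction i)
    case (Suc i)
    have "d (s k) (s (k + Suc i)) \<le> d (s k) (s (k + i)) + d (s (k + i)) (s (Suc (k + i)))"
      using triangle[OF s(1) s(1) s(1)] by simp
    also have "\<dots> \<le> 4 * r * (3 / 4) ^ k * (1 - (3 / 4) ^ i) + (3 / 4) ^ (k + i) * r"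
      by (intro add_mono Suc s(3))
    also have "\<dots> = 4 * r * (3 / 4) ^ k * (1 - (3 / 4) ^ Suc i)" by (simp add: power_add algebra_simps)
    finally show ?case .
  qed (use s in simp)
  have lim: "(\<lambda>k. 4 * r * (3 / 4) ^ k) \<longlonglongrightarrow> 0"
    by (intro tendsto_mult_right_zero LIMSEQ_power_zero) auto
  have tail': "d (s k) (s m) \<le> 4 * r * (3 / 4) ^ k" if "k \<le> m" for k m
  proof -
    have "4 * r * (3 / 4) ^ k * (1 - (3 / 4) ^ (m - k)) \<le> 4 * r * (3 / 4) ^ k * 1"
      using r by (intro mult_left_mono) auto
    then show ?thesis using tail[of k "m - k"] that by simp
  qed
  have "MCauchy s"
    unfolding MCauchy_def
  proof (intro conjI allI impI)
    fix \<epsilon> :: real assume "\<epsilon> > 0"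
    then obtain N where N: "\<And>k. k \<ge> N \<Longrightarrow> 4 * r * (3 / 4) ^ k < \<epsilon>"
      using order_tendstoD(2)[OF lim] by (auto simp: eventually_sequentially)
    show "\<exists>N. \<forall>n n'. N \<le> n \<longrightarrow> N \<le> n' \<longrightarrow> d (s n) (s n') < \<epsilon>"
    proof (intro exI[of _ N] allI impI)
      fix n n' assume "N \<le> n" "N \<le> n'"
      then show "d (s n) (s n') < \<epsilon>"
        using tail'[of n n'] tail'[of n' n] N[of n] N[of n'] commute[of "s n" "s n'"]
        by (cases "n \<le> n'") auto
    qed
  qed (use s in auto)
  then obtain l where "limitin mtopology s l sequentially" using complete by (auto simp: mcomplete_def)
  then have l: "l \<in> M" "\<And>\<epsilon>. \<epsilon> > 0 \<Longrightarrow> \<exists>N. \<forall>n\<ge>N. s n \<in> M \<and> d (s n) l < \<epsilon>"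
    by (auto simp: limit_metric_sequentially)
  \<comment> \<open>The points s k approach l and start chains of vanishing length that climb to
    level K, although by \<open>far\<close> that level is at a positive distance from l.\<close>
  obtain c K where c: "c > 0" "\<forall>z\<in>M. K \<le> f z \<longrightarrow> c \<le> d l z" using far[OF l(1)] by blast
  obtain N where N: "\<And>n. n \<ge> N \<Longrightarrow> d (s n) l < c / 2" using l(2)[of "c / 2"] c by auto
  obtain N' where N': "\<And>k. k \<ge> N' \<Longrightarrow> 4 * r * (3 / 4) ^ k < c / 2"
    using order_tendstoD(2)[OF lim, of "c / 2"] c by (auto simp: eventually_sequentially)
  define k where "k = max N N'"
  obtain b :: "nat \<Rightarrow> 'a" and n where b: "b 0 = s k" "\<forall>i\<le>n. b i \<in> M" "K \<le> f (b n)" "(\<Sum>i=1..n. d (b (i - 1)) (b i)) \<le> (3 / 4) ^ k * r"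
    using s(2)[of k] unfolding escapes_def by (meson zero_less_one)
  have "d (s k) (b n) \<le> (3 / 4) ^ k * r" using chain_dist_le[of n b n] b by fastforce
  moreover have "(3 / 4) ^ k * r \<le> 4 * r * (3 / 4) ^ k" using r by simp
  ultimately have "d (s k) (b n) < c / 2" using N'[of k] unfolding k_def by linarith
  moreover have "d (s k) l < c / 2" using N[of k] by (simp add: k_def)
  moreover have "d l (b n) \<le> d l (s k) + d (s k) (b n)" using l(1) s(1) b(2) by (intro triangle) auto
  moreover have "c \<le> d l (b n)" using c(2) b by auto
  ultimately show False using commute[of l "s k"] by linarith
qed

section \<open>The distance of a periodic conformal metric\<close>

abbreviation conformal :: "(real \<Rightarrow> real \<Rightarrow> real) \<Rightarrow> real \<times> real \<Rightarrow> real \<times> real \<Rightarrow> real" where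
  "conformal \<gamma> \<equiv> \<lambda>(z, \<rho>) (dz, d\<rho>). exp (2 * \<gamma> z \<rho>) * (dz\<^sup>2 + d\<rho>\<^sup>2)"

abbreviation shifts :: "real \<Rightarrow> (real \<times> real) set" where
  "shifts L \<equiv> range (\<lambda>n::int. (of_int n * L, 0))"

definition strip_dist :: "real \<Rightarrow> (real \<Rightarrow> real \<Rightarrow> real) \<Rightarrow> real \<times> real \<Rightarrow> real \<times> real \<Rightarrow> real" where
  "strip_dist L \<gamma> = quotient_dist (conformal \<gamma>) (shifts L) (UNIV \<times> {1..})"

definition strip_lengths :: "real \<Rightarrow> (real \<Rightarrow> real \<Rightarrow> real) \<Rightarrow> real \<times> real \<Rightarrow> real \<times> real \<Rightarrow> real set" where
  "strip_lengths L \<gamma> a b = {l. \<exists>c. valid_path c \<and> path_image c \<subseteq> UNIV \<times> {1..} \<and> pathstart c = a \<and>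
     pathfinish c - b \<in> shifts L \<and>
     ((\<lambda>s. sqrt (conformal \<gamma> (c s) (vector_derivative c (at s)))) has_integral l) {0..1}}"

lemma strip_dist_eq:
  "snd a \<ge> 1 \<Longrightarrow> snd b \<ge> 1 \<Longrightarrow> strip_dist L \<gamma> a b = Inf (strip_lengths L \<gamma> a b)"
  unfolding strip_dist_def quotient_dist_def strip_lengths_def by (simp add: mem_Times_iff)

lemma sqrt_conformal: "sqrt (conformal \<gamma> p v) = exp (\<gamma> (fst p) (snd p)) * norm v"
  by (cases p; cases v) (simp add: real_sqrt_mult exp_double norm_prod_def)

lemma strip_lengths_nonneg:
  assumes "l \<in> strip_lengths L \<gamma> a b"
  shows "0 \<le> l"
proof -
  obtain c where "((\<lambda>s. sqrt (conformal \<gamma> (c s) (vector_derivative c (at s)))) has_integral l) {0..1}"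
    using assms unfolding strip_lengths_def by auto
  then show ?thesis unfolding sqrt_conformal by (rule has_integral_nonneg) auto
qed

lemma segment_length:
  fixes \<gamma> :: "real \<Rightarrow> real \<Rightarrow> real"
  assumes cont: "continuous_on (UNIV \<times> {1..}) (\<lambda>(z, \<rho>). \<gamma> z \<rho>)"
    and ab: "snd a \<ge> 1" "snd b' \<ge> 1" "b' - b \<in> shifts L"
    and B: "\<And>p. p \<in> closed_segment a b' \<Longrightarrow> exp (\<gamma> (fst p) (snd p)) \<le> B"
  shows "\<exists>l\<in>strip_lengths L \<gamma> a b. l \<le> B * norm (b' - a)"
proof -
  let ?S = "UNIV \<times> {1..} :: (real \<times> real) set"
  define c where "c = linepath a b'"
  have sub: "closed_segment a b' \<subseteq> ?S"
    by (rule closed_segment_subset) (use ab in \<open>auto simp: mem_Times_iff intro!: convex_Times\<close>)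
  have vd: "vector_derivative c (at s) = b' - a" for s
    unfolding c_def by (simp add: vector_derivative_at has_vector_derivative_linepath_within)
  have inS: "c s \<in> closed_segment a b'" if "s \<in> {0..1}" for s
    using that unfolding c_def by (metis imageI linepath_image_01)
  have "continuous_on {0..1} (\<lambda>s. \<gamma> (fst (c s)) (snd (c s)))"
  proof -
    have "c ` {0..1} \<subseteq> ?S" using inS sub by blast
    moreover have "continuous_on {0..1} c" unfolding c_def by (rule continuous_on_linepath)
    ultimately show ?thesis using continuous_on_compose2[OF cont] by (simp only: case_prod_unfold)
  qed
  then have "continuous_on {0..1} (\<lambda>s. exp (\<gamma> (fst (c s)) (snd (c s))) * norm (b' - a))"
    by (intro continuous_intros)
  then have "(\<lambda>s. exp (\<gamma> (fst (c s)) (snd (c s))) * norm (b' - a)) integrable_on {0..1}"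
    by (rule integrable_continuous_real)
  then obtain l where l: "((\<lambda>s. exp (\<gamma> (fst (c s)) (snd (c s))) * norm (b' - a)) has_integral l) {0..1}"
    unfolding integrable_on_def by (elim exE)
  have "((\<lambda>s. B * norm (b' - a)) has_integral (B * norm (b' - a))) {0..1::real}"
    using has_integral_const_real[of "B * norm (b' - a)" 0 1] by simp
  from l this have "l \<le> B * norm (b' - a)"
    by (rule has_integral_le) (intro mult_right_mono B inS norm_ge_zero)
  moreover have "l \<in> strip_lengths L \<gamma> a b"
    unfolding strip_lengths_def
  proof (intro CollectI exI[of _ c] conjI)
    show "valid_path c" "pathstart c = a" by (simp_all add: c_def)
    show "path_image c \<subseteq> ?S" using sub by (simp add: c_def)
    show "pathfinish c - b \<in> shifts L" using ab by (simp add: c_def)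
    show "((\<lambda>s. sqrt (conformal \<gamma> (c s) (vector_derivative c (at s)))) has_integral l) {0..1}"
      unfolding sqrt_conformal vd by (rule l)
  qed
  ultimately show ?thesis by blast
qed

lemma strip_dist_le:
  fixes \<gamma> :: "real \<Rightarrow> real \<Rightarrow> real"
  assumes "continuous_on (UNIV \<times> {1..}) (\<lambda>(z, \<rho>). \<gamma> z \<rho>)"
    and "snd a \<ge> 1" "snd b' \<ge> 1" "b' - b \<in> shifts L"
    and "\<And>p. p \<in> closed_segment a b' \<Longrightarrow> exp (\<gamma> (fst p) (snd p)) \<le> B"
  shows "strip_dist L \<gamma> a b \<le> B * norm (b' - a)"
proof -
  obtain l where l: "l \<in> strip_lengths L \<gamma> a b" "l \<le> B * norm (b' - a)"
    using segment_length[OF assms] by blast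
  have "snd b = snd b'" using assms(4) by (auto simp: prod_eq_iff)
  then have "strip_dist L \<gamma> a b = Inf (strip_lengths L \<gamma> a b)" using assms by (intro strip_dist_eq) auto
  also have "\<dots> \<le> l" using l strip_lengths_nonneg by (intro cInf_lower bdd_belowI[of _ 0]) auto
  finally show ?thesis using l by simp
qed

text \<open>Squared positive parts are the building blocks of the continuously differentiable test
  function in \<open>strip_dist_ge\<close>; only the kink at 0 needs a difference quotient.\<close>

lemma DERIV_square_pos_part: "((\<lambda>u. (max 0 u)\<^sup>2) has_real_derivative 2 * max 0 u) (at (u::real))"
proof (cases "u = 0")
  case True
  have "(\<lambda>h::real. ((max 0 (0 + h))\<^sup>2 - (max 0 0)\<^sup>2) / h) \<midarrow>0\<rightarrow> 0"
  proof (rule Lim_null_comparison)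
    show "\<forall>\<^sub>F h in at 0. norm (((max 0 (0 + h))\<^sup>2 - (max 0 0)\<^sup>2) / h) \<le> \<bar>h\<bar>"
      by (intro always_eventually allI) (auto simp: max_def power2_eq_square)
    show "(\<lambda>h::real. \<bar>h\<bar>) \<midarrow>0\<rightarrow> 0" by (auto intro!: tendsto_eq_intros)
  qed
  then show ?thesis using True by (simp add: DERIV_def)
next
  case False
  show ?thesis
  proof (cases "u > 0")
    case True
    have "((\<lambda>u. u\<^sup>2) has_real_derivative 2 * max 0 u) (at u)"
      using True by (auto intro!: derivative_eq_intros)
    then show ?thesis
      by (rule has_field_derivative_transform_within_open[where S = "{0<..}"]) (use True in auto)
  next
    case False
    have "((\<lambda>u. 0) has_real_derivative 2 * max 0 u) (at u)"
      using False by (auto intro!: derivative_eq_intros)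
    then show ?thesis
      by (rule has_field_derivative_transform_within_open[where S = "{..<0}"]) (use False \<open>u \<noteq> 0\<close> in auto)
  qed
qed

text \<open>The path is tested against a function of \<open>\<rho>\<close> with derivative at most \<open>exp \<gamma>\<close>, supported in
  \<open>[t, t + 2]\<close>.\<close>

lemma strip_dist_ge:
  fixes \<gamma> :: "real \<Rightarrow> real \<Rightarrow> real"
  assumes cont: "continuous_on (UNIV \<times> {1..}) (\<lambda>(z, \<rho>). \<gamma> z \<rho>)"
    and a: "1 \<le> snd a" "snd a \<le> t" and b: "t + 2 \<le> snd b"
    and m: "0 < m" "\<And>z \<rho>. t \<le> \<rho> \<Longrightarrow> \<rho> \<le> t + 2 \<Longrightarrow> m \<le> exp (\<gamma> z \<rho>)"
  shows "m \<le> strip_dist L \<gamma> a b"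
proof -
  \<comment> \<open>A lower bound for all lengths passes to the infimum only if some path has a
    length at all; the straight segment does.\<close>
  have ne: "strip_lengths L \<gamma> a b \<noteq> {}"
  proof -
    have sub: "closed_segment a b \<subseteq> UNIV \<times> {1..}"
      by (rule closed_segment_subset) (use a b in \<open>auto simp: mem_Times_iff intro!: convex_Times\<close>)
    have "compact ((\<lambda>p. exp (\<gamma> (fst p) (snd p))) ` closed_segment a b)"
      using continuous_on_subset[OF cont sub]
      by (intro compact_continuous_image continuous_intros) (auto simp: case_prod_unfold)
    then have "bdd_above ((\<lambda>p. exp (\<gamma> (fst p) (snd p))) ` closed_segment a b)"
      by (intro bounded_imp_bdd_above compact_imp_bounded)
    then have B: "exp (\<gamma> (fst p) (snd p)) \<le> (SUP p\<in>closed_segment a b. exp (\<gamma> (fst p) (snd p)))"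
      if "p \<in> closed_segment a b" for p
      using that by (intro cSUP_upper)
    have "b - b \<in> shifts L" by (auto simp: zero_prod_def intro!: image_eqI[of _ _ 0])
    from segment_length[where a = a and b = b and b' = b, OF cont _ _ this B] show ?thesis using a b by force
  qed
  \<comment> \<open>The derivative of \<open>\<Phi>\<close> is the hat function
    \<open>\<phi>\<close> with base \<open>[t, t + 2]\<close>, height m and hence area m, so
    \<open>\<Phi>\<close> rises from 0 to m. The hat is continuous, as the chain rule along the path
    requires \<open>\<Phi>\<close> to be differentiable everywhere.\<close>
  define \<Phi> where "\<Phi> = (\<lambda>r. m / 2 * ((max 0 (r - t))\<^sup>2 - 2 * (max 0 (r - (t + 1)))\<^sup>2 + (max 0 (r - (t + 2)))\<^sup>2))"
  define \<phi> where "\<phi> = (\<lambda>r. m * (max 0 (r - t) - 2 * max 0 (r - (t + 1)) + max 0 (r - (t + 2))))"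
  have sq: "((\<lambda>r. (max 0 (r - u))\<^sup>2) has_real_derivative 2 * max 0 (r - u)) (at r)" for r u :: real
  proof -
    have "((\<lambda>r. r - u) has_real_derivative 1) (at r)" by (auto intro!: derivative_eq_intros)
    from DERIV_chain2[where f = "\<lambda>u. (max 0 u)\<^sup>2", OF DERIV_square_pos_part this] show ?thesis by simp
  qed
  have \<Phi>: "(\<Phi> has_real_derivative \<phi> r) (at r)" for r
    unfolding \<Phi>_def \<phi>_def by (rule derivative_eq_intros sq refl)+ (simp add: algebra_simps)
  have \<phi>: "0 \<le> \<phi> r" "\<phi> r \<le> exp (\<gamma> z r)" for r z
  proof -
    have "0 \<le> \<phi> r \<and> \<phi> r \<le> (if t \<le> r \<and> r \<le> t + 2 then m else 0)"
      unfolding \<phi>_def using m(1) by (auto simp: max_def mult_le_cancel_left zero_le_mult_iff)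
    then show "0 \<le> \<phi> r" "\<phi> r \<le> exp (\<gamma> z r)" using m(2)[of r z] by (auto split: if_splits intro: order_trans)
  qed
  have "m \<le> l" if l: "l \<in> strip_lengths L \<gamma> a b" for l
  proof -
    obtain c where c: "valid_path c" "pathstart c = a" "pathfinish c - b \<in> shifts L"
      "((\<lambda>s. sqrt (conformal \<gamma> (c s) (vector_derivative c (at s)))) has_integral l) {0..1}"
      using l unfolding strip_lengths_def mem_Collect_eq by (elim exE conjE)
    obtain F where F: "continuous_on {0..1} c" "finite F" "c C1_differentiable_on ({0..1} - F)"
      using c(1) unfolding valid_path_def piecewise_C1_differentiable_on_def by auto
    have "((\<lambda>s. \<phi> (snd (c s)) * snd (vector_derivative c (at s))) has_integral
       (\<Phi> (snd (c 1)) - \<Phi> (snd (c 0)))) {0..1}"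
    proof (rule fundamental_theorem_of_calculus_interior_strong[OF F(2)])
      have "isCont \<Phi> r" for r using \<Phi> DERIV_isCont by blast
      then have "continuous_on UNIV \<Phi>" by (simp add: continuous_at_imp_continuous_on)
      then show "continuous_on {0..1} (\<lambda>s. \<Phi> (snd (c s)))"
        by (rule continuous_on_compose2) (auto intro!: continuous_intros F)
      fix s assume s: "s \<in> {0<..<1} - F"
      have "(c has_vector_derivative vector_derivative c (at s)) (at s)"
        using F(3) s unfolding C1_differentiable_on_eq by (auto simp: vector_derivative_works)
      then have "((\<lambda>s. snd (c s)) has_vector_derivative snd (vector_derivative c (at s))) (at s)"
        by (rule bounded_linear.has_vector_derivative[OF bounded_linear_snd])
      then show "((\<lambda>s. \<Phi> (snd (c s))) has_vector_derivative
          \<phi> (snd (c s)) * snd (vector_derivative c (at s))) (at s)"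
        using DERIV_chain2[OF \<Phi>, of "\<lambda>s. snd (c s)" "snd (vector_derivative c (at s))" s UNIV]
        by (simp add: has_real_derivative_iff_has_vector_derivative)
    qed simp
    then have "\<Phi> (snd (c 1)) - \<Phi> (snd (c 0)) \<le> l"
    proof (rule has_integral_le[OF _ c(4)])
      fix s :: real
      let ?v = "vector_derivative c (at s)"
      have "\<phi> (snd (c s)) * snd ?v \<le> \<phi> (snd (c s)) * norm ?v"
        using \<phi>(1) norm_snd_le[of "snd ?v" "fst ?v"] by (intro mult_left_mono) auto
      also have "\<dots> \<le> exp (\<gamma> (fst (c s)) (snd (c s))) * norm ?v"
        using \<phi>(2) by (intro mult_right_mono) auto
      finally show "\<phi> (snd (c s)) * snd ?v \<le> sqrt (conformal \<gamma> (c s) ?v)"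
        unfolding sqrt_conformal .
    qed
    moreover have "snd (c 1) = snd b" "c 0 = a"
      using c by (auto simp: pathfinish_def pathstart_def prod_eq_iff)
    moreover have "\<Phi> (snd a) = 0" using a by (simp add: \<Phi>_def)
    moreover have "\<Phi> (snd b) = m" using b by (simp add: \<Phi>_def max_def power2_eq_square) (simp add: field_simps)
    ultimately show ?thesis by simp
  qed
  then have "m \<le> Inf (strip_lengths L \<gamma> a b)" using ne by (intro cInf_greatest) auto
  then show ?thesis using a b by (subst strip_dist_eq) auto
qed

section \<open>Periodicity and representatives in the carrier\<close>

lemma periodic_int:
  fixes f :: "real \<Rightarrow> 'a"
  assumes "\<And>z. f (z + L) = f z"
  shows "f (z + of_int n * L) = f z"
proof (induction n rule: int_induct[of _ 0])
  case (step1 i)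
  then show ?case using assms[of "z + of_int i * L"] by (simp add: algebra_simps)
next
  case (step2 i)
  then show ?case using assms[of "z + of_int (i - 1) * L"] by (simp add: algebra_simps)
qed simp

lemma periodic_reduce:
  assumes "(L::real) > 0"
  obtains n :: int where "a \<le> z + of_int n * L" "z + of_int n * L < a + L"
proof
  have "of_int \<lfloor>(z - a) / L\<rfloor> * L \<le> z - a" using assms by (simp add: pos_le_divide_eq[symmetric])
  then show "a \<le> z + of_int (- \<lfloor>(z - a) / L\<rfloor>) * L" by (simp add: algebra_simps)
  have "(z - a) / L < of_int \<lfloor>(z - a) / L\<rfloor> + 1" by linarith
  then have "z - a < (of_int \<lfloor>(z - a) / L\<rfloor> + 1) * L" using assms by (simp only: pos_divide_less_eq)
  then show "z + of_int (- \<lfloor>(z - a) / L\<rfloor>) * L < a + L" by (simp add: algebra_simps)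
qed

lemma periodic_strip_bounds:
  fixes f :: "real \<Rightarrow> real \<Rightarrow> real"
  assumes "L > 0" and per: "\<And>z \<rho>. \<rho> \<in> {a..b} \<Longrightarrow> f (z + L) \<rho> = f z \<rho>"
    and cont: "continuous_on (UNIV \<times> {a..b}) (\<lambda>(z, \<rho>). f z \<rho>)"
  obtains c C where "\<And>z \<rho>. \<rho> \<in> {a..b} \<Longrightarrow> c \<le> f z \<rho> \<and> f z \<rho> \<le> C"
proof -
  have "compact ((\<lambda>(z, \<rho>). f z \<rho>) ` ({0..L} \<times> {a..b}))"
    by (intro compact_continuous_image continuous_on_subset[OF cont] compact_Times) auto
  then have "bounded ((\<lambda>(z, \<rho>). f z \<rho>) ` ({0..L} \<times> {a..b}))" by (rule compact_imp_bounded)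
  then obtain B where B: "\<And>z \<rho>. z \<in> {0..L} \<Longrightarrow> \<rho> \<in> {a..b} \<Longrightarrow> \<bar>f z \<rho>\<bar> \<le> B"
    unfolding bounded_iff by fastforce
  show ?thesis
  proof (rule that[of "- B" B])
    fix z \<rho> :: real assume \<rho>: "\<rho> \<in> {a..b}"
    obtain n :: int where n: "0 \<le> z + of_int n * L" "z + of_int n * L < 0 + L"
      by (rule periodic_reduce[OF \<open>L > 0\<close>])
    have "f (z + of_int n * L) \<rho> = f z \<rho>" by (rule periodic_int) (use per \<rho> in auto)
    then show "- B \<le> f z \<rho> \<and> f z \<rho> \<le> B" using B[of "z + of_int n * L" \<rho>] n \<rho> by auto
  qed
qed

text \<open>The ceiling selects the half-open interval from -L/2 to L/2 that contains its right end,
  as the carrier does.\<close>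

definition reduce :: "real \<Rightarrow> complex \<Rightarrow> real \<times> real" where
  "reduce L w = (Re w - L * of_int \<lceil>Re w / L - 1 / 2\<rceil>, Im w + 1)"

lemma snd_reduce [simp]: "snd (reduce L w) = Im w + 1"
  by (simp add: reduce_def)

lemma reduce_in_carrier:
  assumes "L > 0" "0 \<le> Im w"
  shows "reduce L w \<in> {- (L / 2)<..L / 2} \<times> {1..}"
proof -
  define k where "k = \<lceil>Re w / L - 1 / 2\<rceil>"
  have "Re w / L - 1 / 2 \<le> of_int k" "of_int k < Re w / L - 1 / 2 + 1" unfolding k_def by linarith+
  then have "Re w - L / 2 \<le> L * of_int k" "L * of_int k < Re w + L / 2"
    using assms by (auto simp: field_simps)
  then show ?thesis using assms by (auto simp: reduce_def k_def)
qed

lemma reduce_carrier_id: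
  assumes "L > 0" "p \<in> {- (L / 2)<..L / 2} \<times> {1..}"
  shows "reduce L (Complex (fst p) (snd p - 1)) = p"
proof -
  have "\<lceil>fst p / L - 1 / 2\<rceil> = 0"
    using assms by (auto simp: ceiling_eq_iff field_simps mem_Times_iff)
  then show ?thesis by (simp add: reduce_def)
qed

lemma strip_dist_reduce_le:
  assumes L: "L > 0" and cont: "continuous_on (UNIV \<times> {1..}) (\<lambda>(z, \<rho>). \<gamma> z \<rho>)"
    and per: "\<And>z \<rho>. \<rho> > 0 \<Longrightarrow> \<gamma> (z + L) \<rho> = \<gamma> z \<rho>"
    and w: "0 \<le> Im w" "0 \<le> Im w'"
    and B: "\<And>u. u \<in> closed_segment w w' \<Longrightarrow> exp (\<gamma> (Re u) (Im u + 1)) \<le> B"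
  shows "strip_dist L \<gamma> (reduce L w) (reduce L w') \<le> B * cmod (w' - w)"
proof -
  define k where "k = \<lceil>Re w / L - 1 / 2\<rceil>"
  \<comment> \<open>Both endpoints are shifted by the lattice vector that reduces w. The image of w'
    then differs from its own reduction by a period, which the quotient distance allows at the end
    of a path.\<close>
  define T where "T = (\<lambda>u. (Re u - L * of_int k, Im u + 1))"
  have Tw: "T w = reduce L w" by (simp add: T_def reduce_def k_def)
  have seg: "\<exists>u\<in>closed_segment w w'. p = T u" if p: "p \<in> closed_segment (T w) (T w')" for p
  proof -
    obtain s where s: "0 \<le> s" "s \<le> 1" "p = (1 - s) *\<^sub>R T w + s *\<^sub>R T w'"
      using p unfolding in_segment by blast
    then have "p = T ((1 - s) *\<^sub>R w + s *\<^sub>R w')"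
      by (simp add: T_def algebra_simps)
    moreover have "(1 - s) *\<^sub>R w + s *\<^sub>R w' \<in> closed_segment w w'" using s unfolding in_segment by blast
    ultimately show ?thesis by blast
  qed
  have "strip_dist L \<gamma> (T w) (reduce L w') \<le> B * norm (T w' - T w)"
  proof (rule strip_dist_le[OF cont])
    have "T w' - reduce L w' = (of_int (\<lceil>Re w' / L - 1 / 2\<rceil> - k) * L, 0)"
      by (simp add: T_def reduce_def algebra_simps)
    then show "T w' - reduce L w' \<in> range (\<lambda>n::int. (of_int n * L, 0))" by blast
    fix p assume "p \<in> closed_segment (T w) (T w')"
    then obtain u where u: "u \<in> closed_segment w w'" "p = T u" using seg by blast
    have "closed_segment w w' \<subseteq> {u. 0 \<le> Im u}"
      by (rule closed_segment_subset) (use w in \<open>auto simp: convex_halfspace_Im_ge\<close>)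
    then have "Im u + 1 > 0" using u by auto
    then have "\<gamma> (Re u + of_int (- k) * L) (Im u + 1) = \<gamma> (Re u) (Im u + 1)"
      by (intro periodic_int[of "\<lambda>z. \<gamma> z (Im u + 1)"] per)
    then have "\<gamma> (fst p) (snd p) = \<gamma> (Re u) (Im u + 1)" using u by (simp add: T_def algebra_simps)
    then show "exp (\<gamma> (fst p) (snd p)) \<le> B" using B u by simp
  qed (use w in \<open>auto simp: T_def\<close>)
  moreover have "norm (T w' - T w) = cmod (w' - w)"
    by (simp add: T_def norm_prod_def cmod_def)
  ultimately show ?thesis using Tw by simp
qed

text \<open>The carrier starts at \<open>\<rho> = 1\<close>, which is the boundary of the half plane of \<open>w = z + i (\<rho> - 1)\<close>.\<close>

lemma schwarz_pick:
  assumes L: "L > 0" and complete: "q_complete_at_infinity L \<gamma>"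
    and per: "\<And>z \<rho>. \<rho> > 0 \<Longrightarrow> \<gamma> (z + L) \<rho> = \<gamma> z \<rho>"
    and cont: "continuous_on (UNIV \<times> {0<..}) (\<lambda>(z, \<rho>). \<gamma> z \<rho>)"
    and jet: "\<And>w. 0 < Im w \<Longrightarrow> cjet (\<lambda>w. \<gamma> (Re w) (Im w + 1)) \<Gamma> (\<Gamma>' w) w"
    and lap: "\<And>w. 0 < Im w \<Longrightarrow> Re (\<Gamma>' w 1 + \<i> * \<Gamma>' w \<i>) \<le> 0"
    and R: "0 < R" "\<And>z \<rho>. 1 \<le> \<rho> \<Longrightarrow> \<rho> \<le> 2 \<Longrightarrow> R \<le> exp (\<gamma> z \<rho>)"
    and p: "1 \<le> Im p"
  shows "R \<le> exp (\<gamma> (Re p) (Im p + 1)) * (2 * Im p)"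
proof (rule ccontr)
  assume "\<not> ?thesis"
  then have less: "exp (\<gamma> (Re p) (Im p + 1)) * (2 * Im p) < R" by simp
  define G where "G = (\<lambda>w. \<gamma> (Re w) (Im w + 1))"
  define M where "M = {- (L / 2)<..L / 2} \<times> {1::real..}"
  define d where "d = strip_dist L \<gamma>"
  have md: "Metric_space M d \<and> Metric_space.mcomplete M d"
    using complete[unfolded q_complete_at_infinity_def, rule_format, of 1]
    by (simp add: Let_def M_def d_def strip_dist_def)
  interpret Metric_space M d using md by simp
  have mcomp: mcomplete using md by simp
  have cont1: "continuous_on (UNIV \<times> {1..}) (\<lambda>(z, \<rho>). \<gamma> z \<rho>)"
    by (rule continuous_on_subset[OF cont]) auto
  have redM: "reduce L w \<in> M" if "0 \<le> Im w" for w
    unfolding M_def using reduce_in_carrier[OF L that] .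
  have contG: "continuous_on {w. 0 \<le> Im w} G"
    unfolding G_def
    by (rule continuous_on_compose2[OF cont1, of _ "\<lambda>w. (Re w, Im w + 1)", simplified])
      (auto intro!: continuous_intros)
  have Gper: "G (w + of_int n * of_real L) = G w" if "0 \<le> Im w" for w n
    using periodic_int[of "\<lambda>z. \<gamma> z (Im w + 1)" L "Re w" n] per that by (simp add: G_def)
  have bound: "\<exists>c C. \<forall>z. \<forall>\<rho>\<in>{a..b}. c \<le> \<gamma> z \<rho> \<and> \<gamma> z \<rho> \<le> C" if a: "1 \<le> a" for a b
  proof -
    obtain c C where "\<And>z \<rho>. \<rho> \<in> {a..b} \<Longrightarrow> c \<le> \<gamma> z \<rho> \<and> \<gamma> z \<rho> \<le> C"
      by (rule periodic_strip_bounds[OF L, of a b \<gamma>])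
        (use per a in \<open>auto intro: continuous_on_subset[OF cont1]\<close>)
    then show ?thesis by blast
  qed
  \<comment> \<open>The doubled radius pays for comparing the weight along a step with its value at
    the later endpoint.\<close>
  have "\<not> escapes snd (reduce L p) (2 * R)"
  proof (rule complete_not_escapes[OF mcomp])
    show "reduce L p \<in> M" using redM p by simp
    show "0 < 2 * R" using R by simp
    show "\<exists>y\<in>M. \<exists>q. strict_mono q \<and> (\<lambda>n. d (s (q n)) y) \<longlonglongrightarrow> 0"
      if s: "\<And>n::nat. s n \<in> M \<and> snd (s n) \<le> K" for K s
    proof -
      \<comment> \<open>A Euclidean limit may lie on the edge z = -L/2, outside the carrier; its
        reduction lies inside and is at the same quotient distance from the sequence.\<close>
      define S where "S = {- (L / 2)..L / 2} \<times> {1..K}"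
      have "compact S" by (simp add: S_def compact_Times)
      moreover have sS: "s n \<in> S" for n using s[of n] by (auto simp: S_def M_def mem_Times_iff)
      ultimately obtain l q where l: "l \<in> S" "strict_mono q" "(s \<circ> q) \<longlonglongrightarrow> l"
        using seq_compactE[OF compact_imp_seq_compact] by metis
      have "K \<ge> 1" using l by (auto simp: S_def)
      obtain c C where C: "\<forall>z. \<forall>\<rho>\<in>{1..K}. c \<le> \<gamma> z \<rho> \<and> \<gamma> z \<rho> \<le> C" using bound[of 1 K, OF order_refl] by (elim exE)
      define u where "u = (\<lambda>p. Complex (fst p) (snd p - 1))"
      have u: "reduce L (u (s n)) = s n" for n
        unfolding u_def using reduce_carrier_id[OF L, of "s n"] s[of n] by (simp add: M_def)
      have Imu: "0 \<le> Im (u p)" "Im (u p) \<le> K - 1" if "p \<in> S" for p using that by (auto simp: u_def S_def)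
      have "d (s n) (reduce L (u l)) \<le> exp C * norm (l - s n)" for n
      proof -
        have "strip_dist L \<gamma> (reduce L (u (s n))) (reduce L (u l)) \<le> exp C * cmod (u l - u (s n))"
        proof (rule strip_dist_reduce_le[OF L cont1 per])
          show "0 \<le> Im (u (s n))" "0 \<le> Im (u l)" using Imu sS l by auto
          fix w assume w: "w \<in> closed_segment (u (s n)) (u l)"
          have "closed_segment (u (s n)) (u l) \<subseteq> {w. 0 \<le> Im w} \<inter> {w. Im w \<le> K - 1}"
            by (rule closed_segment_subset)
              (use Imu sS l in \<open>auto intro!: convex_Int simp: convex_halfspace_Im_ge convex_halfspace_Im_le\<close>)
          then have "Im w + 1 \<in> {1..K}" using w by auto
          then show "exp (\<gamma> (Re w) (Im w + 1)) \<le> exp C" using C by simp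
        qed
        moreover have "cmod (u l - u (s n)) = norm (l - s n)"
          by (simp add: u_def norm_prod_def cmod_def)
        ultimately show ?thesis by (simp add: u d_def)
      qed
      moreover have "(\<lambda>n. exp C * norm (l - s (q n))) \<longlonglongrightarrow> 0"
      proof -
        have "(\<lambda>n. norm (l - s (q n))) \<longlonglongrightarrow> 0"
          using tendsto_norm[OF tendsto_diff[OF tendsto_const[of l] l(3)]] by (simp add: o_def)
        then show ?thesis by (rule tendsto_mult_right_zero)
      qed
      ultimately have "(\<lambda>n. d (s (q n)) (reduce L (u l))) \<longlonglongrightarrow> 0"
        by (rule_tac Lim_null_comparison[where g = "\<lambda>n. exp C * norm (l - s (q n))"]) simp_all
      moreover have "reduce L (u l) \<in> M" using redM Imu l by auto
      ultimately show ?thesis using l by blast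
    qed
    show "\<exists>c>0. \<exists>K. \<forall>z\<in>M. K \<le> snd z \<longrightarrow> c \<le> d y z" if y: "y \<in> M" for y
    proof -
      have y1: "1 \<le> snd y" using y by (auto simp: M_def)
      obtain c C where c: "\<forall>z. \<forall>\<rho>\<in>{snd y..snd y + 2}. c \<le> \<gamma> z \<rho> \<and> \<gamma> z \<rho> \<le> C"
        using bound[OF y1, of "snd y + 2"] by (elim exE)
      have "exp c \<le> d y z" if "snd y + 2 \<le> snd z" for z
        unfolding d_def
      proof (rule strip_dist_ge[OF cont1 y1 order_refl that])
        fix x r assume "snd y \<le> r" "r \<le> snd y + 2"
        then show "exp c \<le> exp (\<gamma> x r)" using c by auto
      qed simp
      then show ?thesis by (intro exI[of _ "exp c"] conjI exI[of _ "snd y + 2"]) auto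
    qed
  qed
  moreover have "escapes snd (reduce L p) (2 * R)"
    unfolding escapes_def
  proof (intro allI impI)
    fix K \<sigma> :: real assume \<sigma>: "\<sigma> > 0"
    define N where "N = max K (Im p) + 1"
    have N: "Im p < N" "K \<le> N + 1" by (auto simp: N_def)
    obtain c C where c: "\<forall>z. \<forall>\<rho>\<in>{1..N + 1}. c \<le> \<gamma> z \<rho> \<and> \<gamma> z \<rho> \<le> C" using bound[of 1 "N + 1", OF order_refl] by (elim exE)
    have Gc: "c \<le> G w" if "0 \<le> Im w" "Im w \<le> N" for w using c that by (auto simp: G_def)
    \<comment> \<open>One period with a further period on each side: two points closer than L can be
      shifted together into this compact set, so uniform continuity on it serves the whole
      strip.\<close>
    define Q where "Q = cbox (Complex (- L) 0) (Complex (2 * L) N)"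
    have Q: "w \<in> Q \<longleftrightarrow> - L \<le> Re w \<and> Re w \<le> 2 * L \<and> 0 \<le> Im w \<and> Im w \<le> N" for w
      by (auto simp: Q_def in_cbox_complex_iff)
    have uc: "uniformly_continuous_on Q G"
      by (rule compact_uniformly_continuous[OF continuous_on_subset[OF contG]]) (auto simp: Q Q_def[symmetric] intro: compact_cbox[of "Complex (- L) 0" "Complex (2 * L) N", folded Q_def])
    have "ln 2 > (0::real)" by simp
    from uc[unfolded uniformly_continuous_on_def, rule_format, OF this]
    obtain \<delta> where \<delta>: "\<delta> > 0" "\<And>w w'. w \<in> Q \<Longrightarrow> w' \<in> Q \<Longrightarrow> dist w' w < \<delta> \<Longrightarrow> dist (G w') (G w) < ln 2"
      by blast
    define \<eta> where "\<eta> = min \<delta> L"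
    have \<eta>: "0 < \<eta>" using \<delta> L by (simp add: \<eta>_def)
    have osc: "exp (G w) \<le> 2 * exp (G w')" if "cmod (w - w') < \<eta>" "0 \<le> Im w" "Im w \<le> N" "0 \<le> Im w'" "Im w' \<le> N" for w w'
    proof -
      obtain n :: int where n: "0 \<le> Re w' + of_int n * L" "Re w' + of_int n * L < 0 + L"
        by (rule periodic_reduce[OF L])
      define v where "v = of_int n * complex_of_real L"
      have v: "Re v = of_int n * L" "Im v = 0" by (simp_all add: v_def)
      have "\<bar>Re w - Re w'\<bar> < L" using abs_Re_le_cmod[of "w - w'"] that by (simp add: \<eta>_def)
      then have "w + v \<in> Q" "w' + v \<in> Q" using n that by (auto simp: Q v)
      then have "dist (G (w + v)) (G (w' + v)) < ln 2"
        using that by (intro \<delta>(2)) (auto simp: dist_norm \<eta>_def)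
      then have "G w < G w' + ln 2"
        using Gper[of w n] Gper[of w' n] that by (simp add: v_def dist_real_def)
      then have "exp (G w) \<le> exp (G w' + ln 2)" by simp
      then show ?thesis by (simp add: exp_add)
    qed
    \<comment> \<open>A step of weighted length at most \<open>\<tau>\<close> is shorter than
      \<open>\<eta>\<close> in the Euclidean sense, because the weight is at least
      \<open>exp c\<close>, and after doubling it still has length at most
      \<open>\<sigma>\<close>.\<close>
    define \<tau> where "\<tau> = min (\<eta> * exp c / 2) (\<sigma> / 2)"
    have \<tau>: "\<tau> > 0" using \<eta> \<sigma> by (simp add: \<tau>_def)
    obtain n :: nat where n: "(R / \<tau>)\<^sup>2 < real n" using reals_Archimedean2 by blast
    have n1: "1 \<le> n" using n by (cases n) auto
    have sqn: "R / \<tau> \<le> sqrt n" using n by (intro real_le_rsqrt) simp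
    have jetG: "cjet G \<Gamma> (\<Gamma>' w) w" if "0 < Im w" for w unfolding G_def by (rule jet[OF that])
    have RG: "R \<le> exp (G w)" if "0 \<le> Im w" "Im w \<le> 1" for w using R that by (simp add: G_def)
    have pG: "exp (G p) * (2 * Im p) < R" using less by (simp add: G_def)
    have "\<exists>(z :: nat \<Rightarrow> complex) k. z 0 = p \<and> 1 \<le> k \<and> Im (z k) = N \<and> (\<forall>i\<le>k. 0 \<le> Im (z i) \<and> Im (z i) \<le> N) \<and>
      (\<Sum>i=1..k. cmod (z i - z (i - 1)) * exp (G (z i))) \<le> R \<and>
      (\<forall>i. 1 \<le> i \<and> i \<le> k \<longrightarrow> sqrt n * (cmod (z i - z (i - 1)) * exp (G (z i))) \<le> R)" (is ?E)
    proof (rule escaping_chain[of G \<Gamma> \<Gamma>' N c R p n])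
      fix z :: "nat \<Rightarrow> complex" and k
      assume "z 0 = p" "1 \<le> k" "Im (z k) = N" "\<And>i. i \<le> k \<Longrightarrow> 0 \<le> Im (z i) \<and> Im (z i) \<le> N"
        "(\<Sum>i=1..k. cmod (z i - z (i - 1)) * exp (G (z i))) \<le> R"
        "\<And>i. 1 \<le> i \<Longrightarrow> i \<le> k \<Longrightarrow> sqrt n * (cmod (z i - z (i - 1)) * exp (G (z i))) \<le> R"
      then show ?E by (intro exI[of _ z] exI[of _ k] conjI) simp_all
    qed (fact contG jetG lap Gc RG R(1) p N(1) pG n1)+
    then obtain z :: "nat \<Rightarrow> complex" and k where z: "z 0 = p" "1 \<le> k" "Im (z k) = N"
      "\<And>i. i \<le> k \<Longrightarrow> 0 \<le> Im (z i) \<and> Im (z i) \<le> N"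
      "(\<Sum>i=1..k. cmod (z i - z (i - 1)) * exp (G (z i))) \<le> R"
      "\<And>i. 1 \<le> i \<Longrightarrow> i \<le> k \<Longrightarrow> sqrt n * (cmod (z i - z (i - 1)) * exp (G (z i))) \<le> R"
      by (elim exE conjE) simp
    have small: "cmod (z i - z (i - 1)) * exp (G (z i)) \<le> \<tau>" if "1 \<le> i" "i \<le> k" for i
    proof -
      let ?s = "cmod (z i - z (i - 1)) * exp (G (z i))"
      have "R / \<tau> * ?s \<le> sqrt n * ?s" using sqn by (intro mult_right_mono) auto
      then have "R / \<tau> * ?s \<le> R" using z(6)[OF that] by linarith
      then show ?thesis using \<tau> R by (simp add: field_simps)
    qed
    \<comment> \<open>Along so short a segment \<open>exp G\<close> is at most twice its value at
      the end.\<close>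
    have step: "d (reduce L (z (i - 1))) (reduce L (z i)) \<le> 2 * (cmod (z i - z (i - 1)) * exp (G (z i)))"
      if i: "1 \<le> i" "i \<le> k" for i
    proof -
      have zi: "0 \<le> Im (z i)" "Im (z i) \<le> N" "0 \<le> Im (z (i - 1))" "Im (z (i - 1)) \<le> N"
        using z(4)[of i] z(4)[of "i - 1"] i by auto
      have "cmod (z i - z (i - 1)) * exp c \<le> cmod (z i - z (i - 1)) * exp (G (z i))"
        using Gc zi by (intro mult_left_mono) auto
      also have "\<dots> \<le> \<tau>" by (rule small[OF i])
      also have "\<dots> \<le> \<eta> * exp c / 2" by (simp add: \<tau>_def)
      finally have "cmod (z i - z (i - 1)) \<le> \<eta> / 2" by simp
      then have cl: "cmod (z i - z (i - 1)) < \<eta>" using \<eta> by linarith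
      have "strip_dist L \<gamma> (reduce L (z (i - 1))) (reduce L (z i)) \<le> (2 * exp (G (z i))) * cmod (z i - z (i - 1))"
      proof (rule strip_dist_reduce_le[OF L cont1 per])
        fix w assume w: "w \<in> closed_segment (z (i - 1)) (z i)"
        have "closed_segment (z (i - 1)) (z i) \<subseteq> {w. 0 \<le> Im w} \<inter> {w. Im w \<le> N}"
          by (rule closed_segment_subset)
            (use zi in \<open>auto intro!: convex_Int simp: convex_halfspace_Im_ge convex_halfspace_Im_le\<close>)
        then have "0 \<le> Im w" "Im w \<le> N" using w by auto
        moreover have "cmod (w - z i) < \<eta>"
          using segment_bound(2)[OF w] cl by (simp add: norm_minus_commute)
        ultimately show "exp (\<gamma> (Re w) (Im w + 1)) \<le> 2 * exp (G (z i))"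
          using osc[of w "z i"] zi by (simp add: G_def)
      qed (use zi in auto)
      then show ?thesis by (simp add: d_def mult_ac)
    qed
    show "\<exists>(c :: nat \<Rightarrow> real \<times> real) n. c 0 = reduce L p \<and> (\<forall>i\<le>n. c i \<in> M) \<and> K \<le> snd (c n) \<and>
       (\<Sum>i=1..n. d (c (i - 1)) (c i)) \<le> 2 * R \<and> (\<forall>i\<in>{1..n}. d (c (i - 1)) (c i) \<le> \<sigma>)"
    proof (intro exI[of _ "\<lambda>i. reduce L (z i)"] exI[of _ k] conjI allI impI ballI)
      show "reduce L (z 0) = reduce L p" by (simp add: z)
      show "reduce L (z i) \<in> M" if "i \<le> k" for i using redM z(4)[OF that] by simp
      show "K \<le> snd (reduce L (z k))" using N z by simp
      have "(\<Sum>i=1..k. d (reduce L (z (i - 1))) (reduce L (z i)))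
        \<le> (\<Sum>i=1..k. 2 * (cmod (z i - z (i - 1)) * exp (G (z i))))"
        by (intro sum_mono step) auto
      also have "\<dots> \<le> 2 * R" using z(5) by (simp flip: sum_distrib_left)
      finally show "(\<Sum>i=1..k. d (reduce L (z (i - 1))) (reduce L (z i))) \<le> 2 * R" .
      fix i assume "i \<in> {1..k}"
      then show "d (reduce L (z (i - 1))) (reduce L (z i)) \<le> \<sigma>"
        using step[of i] small[of i] by (auto simp: \<tau>_def)
    qed
  qed
  ultimately show False by contradiction
qed

section \<open>Gradients on the half plane\<close>

definition dz :: "(real \<times> real \<Rightarrow> real) \<Rightarrow> real \<times> real \<Rightarrow> real" where
  "dz F p = frechet_derivative F (at p) (1, 0)"

definition dr :: "(real \<times> real \<Rightarrow> real) \<Rightarrow> real \<times> real \<Rightarrow> real" where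
  "dr F p = frechet_derivative F (at p) (0, 1)"

definition grad_at :: "(real \<times> real \<Rightarrow> real) \<Rightarrow> real \<Rightarrow> real \<Rightarrow> real \<times> real \<Rightarrow> bool" where
  "grad_at F a b p \<longleftrightarrow> (F has_derivative (\<lambda>h. fst h * a + snd h * b)) (at p)"

abbreviation half_plane :: "(real \<times> real) set" where
  "half_plane \<equiv> UNIV \<times> {0<..}"

lemma open_half_plane: "open half_plane"
  by (simp add: open_Times)

lemma grad_at_dz_dr: "grad_at F a b p \<Longrightarrow> dz F p = a \<and> dr F p = b"
  unfolding grad_at_def dz_def dr_def by (drule frechet_derivative_at, drule sym) simp

lemma grad_at_differentiable:
  "grad_at F a b p \<Longrightarrow> F differentiable at p"
  unfolding grad_at_def differentiable_def by blast

lemma differentiable_grad_at: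
  assumes "F differentiable at p"
  shows "grad_at F (dz F p) (dr F p) p"
proof -
  let ?D = "frechet_derivative F (at p)"
  have d: "(F has_derivative ?D) (at p)" using assms frechet_derivative_works by blast
  have "?D h = fst h * dz F p + snd h * dr F p" for h
  proof -
    have "?D h = ?D (fst h *\<^sub>R (1, 0) + snd h *\<^sub>R (0, 1))" by (simp add: prod_eq_iff)
    also have "\<dots> = fst h *\<^sub>R ?D (1, 0) + snd h *\<^sub>R ?D (0, 1)"
      using has_derivative_linear[OF d] by (simp only: linear_add linear_scale)
    finally show ?thesis by (simp add: dz_def dr_def)
  qed
  then have "?D = (\<lambda>h. fst h * dz F p + snd h * dr F p)" by (rule ext)
  then show ?thesis using d unfolding grad_at_def by simp
qed

lemma grad_at_cong:
  assumes "grad_at F a b p" "open S" "p \<in> S" "\<And>q. q \<in> S \<Longrightarrow> F q = G q"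
  shows "grad_at G a b p"
  using assms unfolding grad_at_def by (blast intro: has_derivative_transform_within_open)

lemma grad_at_const: "grad_at (\<lambda>q. c) 0 0 p"
  unfolding grad_at_def by simp

lemma grad_at_snd: "grad_at snd 0 1 p"
  unfolding grad_at_def by (auto intro!: derivative_eq_intros)

lemma grad_at_add: "grad_at F a b p \<Longrightarrow> grad_at G c d p \<Longrightarrow> grad_at (\<lambda>q. F q + G q) (a + c) (b + d) p"
  unfolding grad_at_def by (auto intro!: derivative_eq_intros simp: fun_eq_iff algebra_simps)

lemma grad_at_diff: "grad_at F a b p \<Longrightarrow> grad_at G c d p \<Longrightarrow> grad_at (\<lambda>q. F q - G q) (a - c) (b - d) p"
  unfolding grad_at_def by (auto intro!: derivative_eq_intros simp: fun_eq_iff algebra_simps)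

lemma grad_at_minus: "grad_at F a b p \<Longrightarrow> grad_at (\<lambda>q. - F q) (- a) (- b) p"
  unfolding grad_at_def by (auto intro!: derivative_eq_intros simp: fun_eq_iff algebra_simps)

lemma grad_at_mult:
  "grad_at F a b p \<Longrightarrow> grad_at G c d p \<Longrightarrow>
    grad_at (\<lambda>q. F q * G q) (a * G p + F p * c) (b * G p + F p * d) p"
  unfolding grad_at_def by (auto intro!: derivative_eq_intros simp: fun_eq_iff algebra_simps)

lemma grad_at_compose:
  assumes "grad_at F a b p" "(f has_real_derivative D) (at (F p))"
  shows "grad_at (\<lambda>q. f (F q)) (D * a) (D * b) p"
proof -
  have "(f has_derivative (*) D) (at (F p))" using assms by (simp add: has_field_derivative_def)
  from has_derivative_compose[OF assms(1)[unfolded grad_at_def] this] show ?thesis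
    unfolding grad_at_def by (simp add: algebra_simps)
qed

lemma grad_at_divide:
  assumes "grad_at F a b p" "grad_at G c d p" "G p \<noteq> 0"
  shows "grad_at (\<lambda>q. F q / G q) ((a * G p - F p * c) / (G p)\<^sup>2) ((b * G p - F p * d) / (G p)\<^sup>2) p"
proof -
  have "grad_at (\<lambda>q. F q * inverse (G q)) (a * inverse (G p) + F p * (- (inverse (G p))\<^sup>2 * c))
     (b * inverse (G p) + F p * (- (inverse (G p))\<^sup>2 * d)) p"
  proof (rule grad_at_mult[OF assms(1)], rule grad_at_compose[OF assms(2)])
    show "(inverse has_real_derivative - (inverse (G p))\<^sup>2) (at (G p))"
      using DERIV_inverse[OF assms(3)] by (simp add: numeral_2_eq_2)
  qed
  moreover have "a * inverse (G p) + F p * (- (inverse (G p))\<^sup>2 * c) = (a * G p - F p * c) / (G p)\<^sup>2" for a c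
    using assms(3) by (simp add: field_simps power2_eq_square)
  ultimately show ?thesis by (simp only: divide_inverse)
qed

lemma grad_at_continuous: "grad_at F a b p \<Longrightarrow> isCont F p"
  unfolding grad_at_def by (rule has_derivative_continuous)

definition C2 :: "(real \<times> real \<Rightarrow> real) \<Rightarrow> bool" where
  "C2 F \<longleftrightarrow> (\<forall>p\<in>half_plane. grad_at F (dz F p) (dr F p) p \<and>
      grad_at (dz F) (dz (dz F) p) (dr (dz F) p) p \<and> grad_at (dr F) (dz (dr F) p) (dr (dr F) p) p) \<and>
    continuous_on half_plane (dz (dz F)) \<and> continuous_on half_plane (dr (dz F)) \<and>
    continuous_on half_plane (dz (dr F)) \<and> continuous_on half_plane (dr (dr F))"

lemma C2_grad:
  assumes "C2 F" "p \<in> half_plane"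
  shows "grad_at F (dz F p) (dr F p) p" "grad_at (dz F) (dz (dz F) p) (dr (dz F) p) p"
    "grad_at (dr F) (dz (dr F) p) (dr (dr F) p) p"
  using assms by (auto simp: C2_def)

lemma C2I:
  assumes 1: "\<And>p. p \<in> half_plane \<Longrightarrow> grad_at F (Fz p) (Fr p) p"
    and 2: "\<And>p. p \<in> half_plane \<Longrightarrow> grad_at Fz (A p) (B p) p"
    and 3: "\<And>p. p \<in> half_plane \<Longrightarrow> grad_at Fr (C p) (D p) p"
    and cont: "continuous_on half_plane A" "continuous_on half_plane B"
      "continuous_on half_plane C" "continuous_on half_plane D"
  shows "C2 F" "\<And>p. p \<in> half_plane \<Longrightarrow> dz F p = Fz p \<and> dr F p = Fr p \<and> dz (dz F) p = A p \<and>
     dr (dz F) p = B p \<and> dz (dr F) p = C p \<and> dr (dr F) p = D p"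
proof -
  have e1: "dz F p = Fz p" "dr F p = Fr p" if "p \<in> half_plane" for p
    using grad_at_dz_dr[OF 1[OF that]] by auto
  have g2: "grad_at (dz F) (A p) (B p) p" if "p \<in> half_plane" for p
    by (rule grad_at_cong[OF 2[OF that] open_half_plane that]) (simp add: e1)
  have g3: "grad_at (dr F) (C p) (D p) p" if "p \<in> half_plane" for p
    by (rule grad_at_cong[OF 3[OF that] open_half_plane that]) (simp add: e1)
  show e: "dz F p = Fz p \<and> dr F p = Fr p \<and> dz (dz F) p = A p \<and>
     dr (dz F) p = B p \<and> dz (dr F) p = C p \<and> dr (dr F) p = D p" if "p \<in> half_plane" for p
    using e1[OF that] grad_at_dz_dr[OF g2[OF that]] grad_at_dz_dr[OF g3[OF that]] by auto
  have c: "continuous_on half_plane (dz (dz F)) \<and> continuous_on half_plane (dr (dz F)) \<and>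
    continuous_on half_plane (dz (dr F)) \<and> continuous_on half_plane (dr (dr F))"
    using cont e by (auto cong: continuous_on_cong)
  show "C2 F"
    unfolding C2_def
  proof (intro conjI ballI)
    fix p assume p: "p \<in> half_plane"
    show "grad_at F (dz F p) (dr F p) p" using 1[OF p] e[OF p] by simp
    show "grad_at (dz F) (dz (dz F) p) (dr (dz F) p) p" using g2[OF p] e[OF p] by simp
    show "grad_at (dr F) (dz (dr F) p) (dr (dr F) p) p" using g3[OF p] e[OF p] by simp
  qed (use c in auto)
qed

lemma C2_continuous:
  assumes "C2 F"
  shows "continuous_on half_plane F" "continuous_on half_plane (dz F)" "continuous_on half_plane (dr F)"
    "continuous_on half_plane (dz (dz F))" "continuous_on half_plane (dr (dz F))"
    "continuous_on half_plane (dz (dr F))" "continuous_on half_plane (dr (dr F))"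
proof -
  note c = C2_grad[OF assms, THEN grad_at_continuous]
  show "continuous_on half_plane F" "continuous_on half_plane (dz F)" "continuous_on half_plane (dr F)"
    by (rule continuous_at_imp_continuous_on, rule ballI, erule c)+
  show "continuous_on half_plane (dz (dz F))" "continuous_on half_plane (dr (dz F))"
    "continuous_on half_plane (dz (dr F))" "continuous_on half_plane (dr (dr F))"
    using assms by (simp_all add: C2_def)
qed

lemma smooth_on_grad:
  assumes "smooth_on F half_plane"
  shows "\<And>p. p \<in> half_plane \<Longrightarrow> grad_at F (dz F p) (dr F p) p"
    "smooth_on (dz F) half_plane" "smooth_on (dr F) half_plane" "continuous_on half_plane F"
proof -
  have S: "Ck_on k F half_plane" for k using assms by (simp add: smooth_on_def)
  have "F differentiable_on half_plane" using S[of "Suc 0"] by simp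
  then show "grad_at F (dz F p) (dr F p) p" if "p \<in> half_plane" for p
  proof -
    have "F differentiable (at p within half_plane)"
      using \<open>F differentiable_on half_plane\<close> that unfolding differentiable_on_def by blast
    then show ?thesis using at_within_open[OF that open_half_plane] by (simp only: differentiable_grad_at)
  qed
  have B: "(1, 0) \<in> (Basis :: (real \<times> real) set)" "(0, 1) \<in> (Basis :: (real \<times> real) set)"
    by (auto simp: Basis_prod_def)
  show "smooth_on (dz F) half_plane" "smooth_on (dr F) half_plane"
    unfolding smooth_on_def dz_def[abs_def] dr_def[abs_def] using S[of "Suc _"] B by auto
  show "continuous_on half_plane F" using S[of 0] by simp
qed

lemma smooth_on_C2:
  assumes "smooth_on F half_plane"
  shows "C2 F"
proof -
  note z = smooth_on_grad[OF smooth_on_grad(2)[OF assms]] and r = smooth_on_grad[OF smooth_on_grad(3)[OF assms]]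
  show ?thesis
    unfolding C2_def
  proof (intro conjI ballI)
    fix p assume p: "p \<in> half_plane"
    show "grad_at F (dz F p) (dr F p) p" by (rule smooth_on_grad(1)[OF assms p])
    show "grad_at (dz F) (dz (dz F) p) (dr (dz F) p) p" by (rule z(1)[OF p])
    show "grad_at (dr F) (dz (dr F) p) (dr (dr F) p) p" by (rule r(1)[OF p])
  qed (rule smooth_on_grad(4)[OF z(2)] smooth_on_grad(4)[OF z(3)] smooth_on_grad(4)[OF r(2)] smooth_on_grad(4)[OF r(3)])+
qed

section \<open>Partial derivatives of functions of z and \<rho> on four-space\<close>

lemma four_ne: "(1::4) \<noteq> 2" "(1::4) \<noteq> 3" "(1::4) \<noteq> 4" "(2::4) \<noteq> 3" "(2::4) \<noteq> 4" "(3::4) \<noteq> 4"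
  by simp_all

lemma vector_4 [simp]:
  "(vector [a, b, c, d] :: 'a::zero ^ 4) $ 1 = a" "(vector [a, b, c, d] :: 'a::zero ^ 4) $ 2 = b"
  "(vector [a, b, c, d] :: 'a::zero ^ 4) $ 3 = c" "(vector [a, b, c, d] :: 'a::zero ^ 4) $ 4 = d"
  unfolding vector_def by simp_all

lemma pd_weyl:
  fixes x :: "real ^ 4"
  assumes "grad_at F a b (x $ 3, x $ 4)"
  shows "pd i (\<lambda>y. F (y $ 3, y $ 4)) x = (vector [0, 0, a, b] :: real ^ 4) $ i"
proof -
  have "((\<lambda>y::real ^ 4. (y $ 3, y $ 4)) has_derivative (\<lambda>h. (h $ 3, h $ 4))) (at x)"
    by (intro has_derivative_Pair bounded_linear.has_derivative[OF bounded_linear_vec_nth] has_derivative_ident)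
  from has_derivative_compose[OF this assms[unfolded grad_at_def]]
  have "((\<lambda>y::real ^ 4. F (y $ 3, y $ 4)) has_derivative (\<lambda>h. h $ 3 * a + h $ 4 * b)) (at x)" by simp
  then have "frechet_derivative (\<lambda>y::real ^ 4. F (y $ 3, y $ 4)) (at x) = (\<lambda>h. h $ 3 * a + h $ 4 * b)"
    by (rule frechet_derivative_at[symmetric])
  then have *: "pd i (\<lambda>y. F (y $ 3, y $ 4)) x = axis i 1 $ 3 * a + axis i 1 $ 4 * b" for i
    by (simp add: pd_def)
  have "\<forall>i. pd i (\<lambda>y. F (y $ 3, y $ 4)) x = (vector [0, 0, a, b] :: real ^ 4) $ i"
    unfolding * forall_4 vector_4 by (simp add: axis_def four_ne four_ne[symmetric])
  then show ?thesis by blast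
qed

text \<open>The closed form of the Christoffel symbols holds only on the Weyl domain; since that is
  open, it may be differentiated.\<close>

lemma pd_cong:
  assumes "open S" "x \<in> S" "\<And>y. y \<in> S \<Longrightarrow> F y = G y"
  shows "pd i F x = pd i G x"
proof -
  have "(F has_derivative D) (at x) \<longleftrightarrow> (G has_derivative D) (at x)" for D
    using assms(3) by (auto intro: has_derivative_transform_within_open[OF _ assms(1,2)] has_derivative_transform_within_open[OF _ assms(1,2) assms(3)[symmetric]])
  then show ?thesis unfolding pd_def frechet_derivative_def by simp
qed

lemma open_weyl_domain: "open weyl_domain"
  unfolding weyl_domain_def by (intro open_Collect_less continuous_intros)

section \<open>The vacuum equations\<close>

text \<open>\<open>E\<close> and \<open>g\<close> stand for \<eta> and \<gamma>; all four functions
  take the pair (z, \<rho>).\<close>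

locale weyl_vacuum =
  fixes V W E g :: "real \<times> real \<Rightarrow> real"
  assumes C2V: "C2 V" and C2W: "C2 W" and C2E: "C2 E" and C2g: "C2 g"
    and pos: "p \<in> half_plane \<Longrightarrow> E p > 0"
    and det: "p \<in> half_plane \<Longrightarrow> V p * E p + (W p)\<^sup>2 = (snd p)\<^sup>2"
    and vacuum: "x \<in> weyl_domain \<Longrightarrow>
      ricci (weyl_metric (curry V) (curry W) (curry E) (curry g)) b c x = 0"
begin

abbreviation "weyl_g \<equiv> weyl_metric (curry V) (curry W) (curry E) (curry g)"

text \<open>\<open>nz\<close> and \<open>nr\<close> are half the logarithmic derivatives of the conformal factor \<open>1 / (2 h)\<close>.\<close>

definition "h p = E p * exp (- (2 * g p)) / 2"
definition "nz p = dz g p - dz E p / (2 * E p)"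
definition "nr p = dr g p - dr E p / (2 * E p)"
text \<open>A, B and C are the Christoffel symbols \<open>\<Gamma>^1_1i\<close>,
  \<open>\<Gamma>^1_2i\<close> and \<open>\<Gamma>^2_1i\<close>, with i = z or \<rho>.\<close>

definition "Az p = (E p * dz V p + W p * dz W p) / (2 * (snd p)\<^sup>2)"
definition "Ar p = (E p * dr V p + W p * dr W p) / (2 * (snd p)\<^sup>2)"
definition "Bz p = (W p * dz E p - E p * dz W p) / (2 * (snd p)\<^sup>2)"
definition "Br p = (W p * dr E p - E p * dr W p) / (2 * (snd p)\<^sup>2)"
definition "Cz p = (V p * dz W p - W p * dz V p) / (2 * (snd p)\<^sup>2)"
definition "Cr p = (V p * dr W p - W p * dr V p) / (2 * (snd p)\<^sup>2)"

definition "metric_entries p = (vector [vector [- V p, W p, 0, 0], vector [W p, E p, 0, 0],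
   vector [0, 0, 1 / (2 * h p), 0], vector [0, 0, 0, 1 / (2 * h p)]] :: real ^ 4 ^ 4)"

definition "metric_entries_z p = (vector [vector [- dz V p, dz W p, 0, 0], vector [dz W p, dz E p, 0, 0],
   vector [0, 0, nz p / h p, 0], vector [0, 0, 0, nz p / h p]] :: real ^ 4 ^ 4)"

definition "metric_entries_r p = (vector [vector [- dr V p, dr W p, 0, 0], vector [dr W p, dr E p, 0, 0],
   vector [0, 0, nr p / h p, 0], vector [0, 0, 0, nr p / h p]] :: real ^ 4 ^ 4)"

definition "inverse_entries p =
  (vector [vector [- E p / (snd p)\<^sup>2, W p / (snd p)\<^sup>2, 0, 0], vector [W p / (snd p)\<^sup>2, V p / (snd p)\<^sup>2, 0, 0],
   vector [0, 0, 2 * h p, 0], vector [0, 0, 0, 2 * h p]] :: real ^ 4 ^ 4)"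

text \<open>\<open>\<Gamma>\<^sup>2\<^sub>2\<^sub>i\<close> is expressed by \<open>\<Gamma>\<^sup>1\<^sub>1\<^sub>i\<close>, since their sum is the derivative of \<open>ln \<rho>\<close>.\<close>

definition "christoffel_table p = (vector
  [vector [vector [0, 0, Az p, Ar p], vector [0, 0, Bz p, Br p], vector [Az p, Bz p, 0, 0], vector [Ar p, Br p, 0, 0]],
   vector [vector [0, 0, Cz p, Cr p], vector [0, 0, - Az p, 1 / snd p - Ar p],
     vector [Cz p, - Az p, 0, 0], vector [Cr p, 1 / snd p - Ar p, 0, 0]],
   vector [vector [dz V p * h p, - (dz W p * h p), 0, 0], vector [- (dz W p * h p), - (dz E p * h p), 0, 0],
     vector [0, 0, nz p, nr p], vector [0, 0, nr p, - nz p]],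
   vector [vector [dr V p * h p, - (dr W p * h p), 0, 0], vector [- (dr W p * h p), - (dr E p * h p), 0, 0],
     vector [0, 0, - nr p, nz p], vector [0, 0, nz p, nr p]]] :: real ^ 4 ^ 4 ^ 4)"

lemma h_pos: "p \<in> half_plane \<Longrightarrow> h p > 0"
  using pos by (simp add: h_def)

lemma metric_components: "weyl_g x = metric_entries (x $ 3, x $ 4)"
  unfolding weyl_metric_def metric_entries_def Let_def curry_def h_def
  by (simp add: exp_minus inverse_eq_divide)

lemma in_half_plane: "x \<in> weyl_domain \<Longrightarrow> (x $ 3, x $ 4) \<in> half_plane"
  by (simp add: weyl_domain_def)

lemma grad_h:
  assumes "p \<in> half_plane"
  shows "grad_at h (- (2 * nz p * h p)) (- (2 * nr p * h p)) p"
proof -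
  have "grad_at (\<lambda>q. E q * exp (- (2 * g q)) * (1 / 2))
    ((dz E p * exp (- (2 * g p)) + E p * (exp (- (2 * g p)) * - (0 * g p + 2 * dz g p))) * (1 / 2) + E p * exp (- (2 * g p)) * 0)
    ((dr E p * exp (- (2 * g p)) + E p * (exp (- (2 * g p)) * - (0 * g p + 2 * dr g p))) * (1 / 2) + E p * exp (- (2 * g p)) * 0) p"
    by (rule grad_at_mult[OF grad_at_mult[OF C2_grad(1)[OF C2E assms] grad_at_compose[OF
       grad_at_minus[OF grad_at_mult[OF grad_at_const C2_grad(1)[OF C2g assms]]] DERIV_exp]] grad_at_const])
  moreover have "(dE * exp (- (2 * g p)) + E p * (exp (- (2 * g p)) * - (0 * g p + 2 * dg))) * (1 / 2) + E p * exp (- (2 * g p)) * 0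
     = - (2 * (dg - dE / (2 * E p)) * h p)" for dE dg
    using pos[OF assms] by (simp add: h_def field_simps)
  ultimately have "grad_at (\<lambda>q. E q * exp (- (2 * g q)) * (1 / 2)) (- (2 * nz p * h p)) (- (2 * nr p * h p)) p"
    unfolding nz_def nr_def by simp
  then show ?thesis unfolding h_def[abs_def] by simp
qed

lemma det_derivative:
  assumes "p \<in> half_plane"
  shows "E p * dz V p + V p * dz E p + 2 * W p * dz W p = 0"
    "E p * dr V p + V p * dr E p + 2 * W p * dr W p = 2 * snd p"
proof -
  have "grad_at (\<lambda>q. V q * E q + W q * W q) (dz V p * E p + V p * dz E p + (dz W p * W p + W p * dz W p))
    (dr V p * E p + V p * dr E p + (dr W p * W p + W p * dr W p)) p"
    by (intro grad_at_add grad_at_mult C2_grad(1)[OF _ assms] C2V C2W C2E)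
  moreover have "grad_at (\<lambda>q. V q * E q + W q * W q) (0 * snd p + snd p * 0) (1 * snd p + snd p * 1) p"
    by (rule grad_at_cong[OF grad_at_mult[OF grad_at_snd grad_at_snd] open_half_plane assms])
      (use det in \<open>simp add: power2_eq_square\<close>)
  ultimately show "E p * dz V p + V p * dz E p + 2 * W p * dz W p = 0"
    "E p * dr V p + V p * dr E p + 2 * W p * dr W p = 2 * snd p"
    by (auto dest!: grad_at_dz_dr simp: algebra_simps)
qed

lemma grad_components:
  assumes "p \<in> half_plane"
  shows "grad_at (\<lambda>q. metric_entries q $ i $ j) (metric_entries_z p $ i $ j) (metric_entries_r p $ i $ j) p"
proof -
  have f: "grad_at (\<lambda>q. 1 / (2 * h q)) (nz p / h p) (nr p / h p) p"
  proof -
    have "grad_at (\<lambda>q. 1 / (2 * h q)) ((0 * (2 * h p) - 1 * (0 * h p + 2 * - (2 * nz p * h p))) / (2 * h p)\<^sup>2)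
       ((0 * (2 * h p) - 1 * (0 * h p + 2 * - (2 * nr p * h p))) / (2 * h p)\<^sup>2) p"
      by (rule grad_at_divide[OF grad_at_const grad_at_mult[OF grad_at_const grad_h[OF assms]]])
        (use h_pos[OF assms] in simp)
    then show ?thesis using h_pos[OF assms] by (simp add: power2_eq_square)
  qed
  have "\<forall>i j. grad_at (\<lambda>q. metric_entries q $ i $ j) (metric_entries_z p $ i $ j) (metric_entries_r p $ i $ j) p"
    unfolding forall_4 metric_entries_def metric_entries_z_def metric_entries_r_def vector_4
    by (intro conjI grad_at_const grad_at_minus f C2_grad(1)[OF _ assms] C2V C2W C2E)
  then show ?thesis by blast
qed

lemma pd_metric:
  assumes "x \<in> weyl_domain" "p = (x $ 3, x $ 4)"
  shows "pd k (\<lambda>y. weyl_g y $ i $ j) x = (vector [0, 0, metric_entries_z p, metric_entries_r p] :: real ^ 4 ^ 4 ^ 4) $ k $ i $ j"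
proof -
  have "pd k (\<lambda>y. weyl_g y $ i $ j) x = (vector [0, 0, metric_entries_z p $ i $ j, metric_entries_r p $ i $ j] :: real ^ 4) $ k" for k
    unfolding metric_components assms(2)
    by (rule pd_weyl[where F = "\<lambda>q. metric_entries q $ i $ j"]) (rule grad_components[OF in_half_plane[OF assms(1)]])
  then have "\<forall>k. pd k (\<lambda>y. weyl_g y $ i $ j) x = (vector [0, 0, metric_entries_z p, metric_entries_r p] :: real ^ 4 ^ 4 ^ 4) $ k $ i $ j"
    unfolding forall_4 by simp
  then show ?thesis by blast
qed

lemma metric_inverse:
  assumes "x \<in> weyl_domain" "p = (x $ 3, x $ 4)"
  shows "matrix_inv (weyl_g x) = inverse_entries p"
proof -
  have p: "p \<in> half_plane" using in_half_plane[OF assms(1)] assms(2) by simp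
  have r: "snd p \<noteq> 0" using p by auto
  have d: "V p * E p = (snd p)\<^sup>2 - (W p)\<^sup>2" using det[OF p] by simp
  have h: "h p \<noteq> 0" using h_pos[OF p] by simp
  have 1: "weyl_g x ** inverse_entries p = mat 1" "inverse_entries p ** weyl_g x = mat 1"
    unfolding metric_components assms(2)[symmetric] vec_eq_iff forall_4 matrix_matrix_mult_def
      metric_entries_def inverse_entries_def
    using r h d by (simp_all add: sum_4 mat_def four_ne four_ne[symmetric] field_simps power2_eq_square)
  \<comment> \<open>\<open>matrix_inv\<close> is a choice operator, so its defining property is
    extracted first and then cancelled against the explicit inverse.\<close>
  then have "invertible (weyl_g x)" unfolding invertible_def by blast
  then have 2: "matrix_inv (weyl_g x) ** weyl_g x = mat 1"
    unfolding invertible_def matrix_inv_def by (rule someI2_ex) blast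
  have "matrix_inv (weyl_g x) = matrix_inv (weyl_g x) ** (weyl_g x ** inverse_entries p)" using 1 by simp
  also have "\<dots> = inverse_entries p" unfolding matrix_mul_assoc 2 by simp
  finally show ?thesis .
qed

lemma christoffel_weyl:
  assumes "x \<in> weyl_domain" "p = (x $ 3, x $ 4)"
  shows "christoffel weyl_g a b c x = christoffel_table p $ a $ b $ c"
proof -
  have p: "p \<in> half_plane" using in_half_plane[OF assms(1)] assms(2) by simp
  have r: "snd p \<noteq> 0" using p by auto
  have h: "h p \<noteq> 0" using h_pos[OF p] by simp
  have t: "- Az p = (V p * dz E p + W p * dz W p) / (2 * (snd p)\<^sup>2)"
    "1 / snd p - Ar p = (V p * dr E p + W p * dr W p) / (2 * (snd p)\<^sup>2)"
  proof -
    have "V p * dz E p + W p * dz W p = - (E p * dz V p + W p * dz W p)"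
      "V p * dr E p + W p * dr W p = 2 * snd p - (E p * dr V p + W p * dr W p)"
      using det_derivative[OF p] by linarith+
    then show "- Az p = (V p * dz E p + W p * dz W p) / (2 * (snd p)\<^sup>2)"
      "1 / snd p - Ar p = (V p * dr E p + W p * dr W p) / (2 * (snd p)\<^sup>2)"
      using r by (simp_all only: Az_def Ar_def minus_divide_left diff_divide_distrib) (simp add: power2_eq_square)
  qed
  have "\<forall>a b c. christoffel weyl_g a b c x = christoffel_table p $ a $ b $ c"
    unfolding christoffel_def pd_metric[OF assms] metric_inverse[OF assms] forall_4 sum_4
      metric_entries_z_def metric_entries_r_def inverse_entries_def christoffel_table_def vector_4 zero_index t
    using r h by (simp add: Az_def Ar_def Bz_def Br_def Cz_def Cr_def) (simp add: field_simps)
  then show ?thesis by blast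
qed

text \<open>The derivatives of A, B, C stay unevaluated: they cancel in the Ricci components below,
  so their existence is enough.\<close>

lemma grad_frame_quotient:
  assumes p: "p \<in> half_plane"
    and "grad_at F1 a1 b1 p" "grad_at F2 a2 b2 p" "grad_at F3 a3 b3 p" "grad_at F4 a4 b4 p"
    and "\<And>q. F q = (F1 q * F2 q + F3 q * F4 q) / (2 * (snd q)\<^sup>2)"
  shows "grad_at F (dz F p) (dr F p) p"
proof -
  have "snd p \<noteq> 0" using p by auto
  then have "2 * (snd p * snd p) \<noteq> 0" by simp
  from grad_at_divide[OF grad_at_add[OF grad_at_mult[OF assms(2,3)] grad_at_mult[OF assms(4,5)]]
      grad_at_mult[OF grad_at_const[of 2] grad_at_mult[OF grad_at_snd grad_at_snd]] this]
  have "F differentiable at p" unfolding power2_eq_square assms(6)[abs_def] by (rule grad_at_differentiable)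
  then show ?thesis by (rule differentiable_grad_at)
qed

lemma grad_frame:
  assumes p: "p \<in> half_plane"
  shows "grad_at Az (dz Az p) (dr Az p) p" "grad_at Ar (dz Ar p) (dr Ar p) p"
    "grad_at Bz (dz Bz p) (dr Bz p) p" "grad_at Br (dz Br p) (dr Br p) p"
    "grad_at Cz (dz Cz p) (dr Cz p) p" "grad_at Cr (dz Cr p) (dr Cr p) p"
proof -
  note V = C2_grad[OF C2V p] and W = C2_grad[OF C2W p] and E = C2_grad[OF C2E p]
  show "grad_at Az (dz Az p) (dr Az p) p"
    by (rule grad_frame_quotient[OF p E(1) V(2) W(1) W(2)]) (simp add: Az_def)
  show "grad_at Ar (dz Ar p) (dr Ar p) p"
    by (rule grad_frame_quotient[OF p E(1) V(3) W(1) W(3)]) (simp add: Ar_def)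
  show "grad_at Bz (dz Bz p) (dr Bz p) p"
    by (rule grad_frame_quotient[OF p W(1) E(2) grad_at_minus[OF E(1)] W(2)]) (simp add: Bz_def)
  show "grad_at Br (dz Br p) (dr Br p) p"
    by (rule grad_frame_quotient[OF p W(1) E(3) grad_at_minus[OF E(1)] W(3)]) (simp add: Br_def)
  show "grad_at Cz (dz Cz p) (dr Cz p) p"
    by (rule grad_frame_quotient[OF p V(1) W(2) grad_at_minus[OF W(1)] V(2)]) (simp add: Cz_def)
  show "grad_at Cr (dz Cr p) (dr Cr p) p"
    by (rule grad_frame_quotient[OF p V(1) W(3) grad_at_minus[OF W(1)] V(3)]) (simp add: Cr_def)
qed

definition "nzz p = dz (dz g) p - (dz (dz E) p * (2 * E p) - dz E p * (2 * dz E p)) / (2 * E p)\<^sup>2"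
definition "nrr p = dr (dr g) p - (dr (dr E) p * (2 * E p) - dr E p * (2 * dr E p)) / (2 * E p)\<^sup>2"
definition "nzr p = dr (dz g) p - (dr (dz E) p * (2 * E p) - dz E p * (2 * dr E p)) / (2 * E p)\<^sup>2"
definition "nrz p = dz (dr g) p - (dz (dr E) p * (2 * E p) - dr E p * (2 * dz E p)) / (2 * E p)\<^sup>2"

lemma grad_conformal:
  assumes p: "p \<in> half_plane"
  shows "grad_at nz (nzz p) (nzr p) p" "grad_at nr (nrz p) (nrr p) p"
proof -
  have E0: "2 * E p \<noteq> 0" using pos[OF p] by simp
  note g = C2_grad[OF C2g p] and E = C2_grad[OF C2E p]
  note E2 = grad_at_mult[OF grad_at_const[of 2] E(1)]
  show "grad_at nz (nzz p) (nzr p) p"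
    using grad_at_diff[OF g(2) grad_at_divide[OF E(2) E2 E0]]
    unfolding nz_def[abs_def] nzz_def nzr_def by simp
  show "grad_at nr (nrz p) (nrr p) p"
    using grad_at_diff[OF g(3) grad_at_divide[OF E(3) E2 E0]]
    unfolding nr_def[abs_def] nrz_def nrr_def by simp
qed

definition "table_z p = (vector
  [vector [vector [0, 0, dz Az p, dz Ar p], vector [0, 0, dz Bz p, dz Br p],
     vector [dz Az p, dz Bz p, 0, 0], vector [dz Ar p, dz Br p, 0, 0]],
   vector [vector [0, 0, dz Cz p, dz Cr p], vector [0, 0, - dz Az p, 0 - dz Ar p],
     vector [dz Cz p, - dz Az p, 0, 0], vector [dz Cr p, 0 - dz Ar p, 0, 0]],
   vector [vector [dz (dz V) p * h p + dz V p * - (2 * nz p * h p), - (dz (dz W) p * h p + dz W p * - (2 * nz p * h p)), 0, 0],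
     vector [- (dz (dz W) p * h p + dz W p * - (2 * nz p * h p)), - (dz (dz E) p * h p + dz E p * - (2 * nz p * h p)), 0, 0],
     vector [0, 0, nzz p, nrz p], vector [0, 0, nrz p, - nzz p]],
   vector [vector [dz (dr V) p * h p + dr V p * - (2 * nz p * h p), - (dz (dr W) p * h p + dr W p * - (2 * nz p * h p)), 0, 0],
     vector [- (dz (dr W) p * h p + dr W p * - (2 * nz p * h p)), - (dz (dr E) p * h p + dr E p * - (2 * nz p * h p)), 0, 0],
     vector [0, 0, - nrz p, nzz p], vector [0, 0, nzz p, nrz p]]] :: real ^ 4 ^ 4 ^ 4)"

definition "table_r p = (vector
  [vector [vector [0, 0, dr Az p, dr Ar p], vector [0, 0, dr Bz p, dr Br p],
     vector [dr Az p, dr Bz p, 0, 0], vector [dr Ar p, dr Br p, 0, 0]],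
   vector [vector [0, 0, dr Cz p, dr Cr p], vector [0, 0, - dr Az p, - (1 / (snd p)\<^sup>2) - dr Ar p],
     vector [dr Cz p, - dr Az p, 0, 0], vector [dr Cr p, - (1 / (snd p)\<^sup>2) - dr Ar p, 0, 0]],
   vector [vector [dr (dz V) p * h p + dz V p * - (2 * nr p * h p), - (dr (dz W) p * h p + dz W p * - (2 * nr p * h p)), 0, 0],
     vector [- (dr (dz W) p * h p + dz W p * - (2 * nr p * h p)), - (dr (dz E) p * h p + dz E p * - (2 * nr p * h p)), 0, 0],
     vector [0, 0, nzr p, nrr p], vector [0, 0, nrr p, - nzr p]],
   vector [vector [dr (dr V) p * h p + dr V p * - (2 * nr p * h p), - (dr (dr W) p * h p + dr W p * - (2 * nr p * h p)), 0, 0],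
     vector [- (dr (dr W) p * h p + dr W p * - (2 * nr p * h p)), - (dr (dr E) p * h p + dr E p * - (2 * nr p * h p)), 0, 0],
     vector [0, 0, - nrr p, nzr p], vector [0, 0, nzr p, nrr p]]] :: real ^ 4 ^ 4 ^ 4)"

lemma grad_christoffel_table:
  assumes p: "p \<in> half_plane"
  shows "grad_at (\<lambda>q. christoffel_table q $ a $ b $ c) (table_z p $ a $ b $ c) (table_r p $ a $ b $ c) p"
proof -
  have r0: "snd p \<noteq> 0" using p by auto
  have inv: "grad_at (\<lambda>q. 1 / snd q) 0 (- (1 / (snd p)\<^sup>2)) p"
    using grad_at_divide[OF grad_at_const[of 1] grad_at_snd r0] by simp
  have "\<forall>a b c. grad_at (\<lambda>q. christoffel_table q $ a $ b $ c) (table_z p $ a $ b $ c) (table_r p $ a $ b $ c) p"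
    unfolding forall_4 christoffel_table_def table_z_def table_r_def vector_4
    by (intro conjI; (rule grad_at_const | rule grad_frame[OF p] | rule grad_conformal[OF p]
        | rule grad_at_minus[OF grad_frame(1)[OF p]] | rule grad_at_diff[OF inv grad_frame(2)[OF p]]
        | rule grad_at_minus[OF grad_conformal(1)[OF p]] | rule grad_at_minus[OF grad_conformal(2)[OF p]]
        | rule grad_at_mult[OF C2_grad(2)[OF C2V p] grad_h[OF p]]
        | rule grad_at_mult[OF C2_grad(3)[OF C2V p] grad_h[OF p]]
        | rule grad_at_minus[OF grad_at_mult[OF C2_grad(2)[OF C2W p] grad_h[OF p]]]
        | rule grad_at_minus[OF grad_at_mult[OF C2_grad(3)[OF C2W p] grad_h[OF p]]]
        | rule grad_at_minus[OF grad_at_mult[OF C2_grad(2)[OF C2E p] grad_h[OF p]]]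
        | rule grad_at_minus[OF grad_at_mult[OF C2_grad(3)[OF C2E p] grad_h[OF p]]]))
  then show ?thesis by blast
qed

lemma pd_christoffel:
  assumes "x \<in> weyl_domain" "p = (x $ 3, x $ 4)"
  shows "pd k (christoffel weyl_g a b c) x =
    (vector [0, 0, table_z p, table_r p] :: real ^ 4 ^ 4 ^ 4 ^ 4) $ k $ a $ b $ c"
proof -
  have "pd k (christoffel weyl_g a b c) x = pd k (\<lambda>y. christoffel_table (y $ 3, y $ 4) $ a $ b $ c) x" for k
    by (rule pd_cong[OF open_weyl_domain assms(1)]) (rule christoffel_weyl, simp_all)
  also have "pd k (\<lambda>y. christoffel_table (y $ 3, y $ 4) $ a $ b $ c) x
    = (vector [0, 0, table_z p $ a $ b $ c, table_r p $ a $ b $ c] :: real ^ 4) $ k" for k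
    unfolding assms(2)
    by (rule pd_weyl[where F = "\<lambda>q. christoffel_table q $ a $ b $ c"])
      (rule grad_christoffel_table[OF in_half_plane[OF assms(1)]])
  finally have "\<forall>k. pd k (christoffel weyl_g a b c) x =
    (vector [0, 0, table_z p, table_r p] :: real ^ 4 ^ 4 ^ 4 ^ 4) $ k $ a $ b $ c"
    unfolding forall_4 by simp
  then show ?thesis by blast
qed

lemma ricci_expand:
  assumes p: "p \<in> half_plane"
  shows "(\<Sum>a\<in>UNIV. (vector [0, 0, table_z p, table_r p] :: real ^ 4 ^ 4 ^ 4 ^ 4) $ a $ a $ b $ c
        - (vector [0, 0, table_z p, table_r p] :: real ^ 4 ^ 4 ^ 4 ^ 4) $ c $ a $ b $ a) +
     (\<Sum>a\<in>UNIV. \<Sum>d\<in>UNIV. christoffel_table p $ a $ a $ d * christoffel_table p $ d $ b $ c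
        - christoffel_table p $ a $ c $ d * christoffel_table p $ d $ b $ a) = 0"
proof -
  define x :: "real ^ 4" where "x = vector [0, 0, fst p, snd p]"
  have x: "x \<in> weyl_domain" "p = (x $ 3, x $ 4)"
    using p by (auto simp: x_def weyl_domain_def)
  show ?thesis
    using vacuum[OF x(1), of b c] unfolding ricci_def pd_christoffel[OF x] christoffel_weyl[OF x] .
qed

lemma ricci_22:
  assumes p: "p \<in> half_plane"
  shows "dz (dz E) p + dr (dr E) p + dr E p / snd p =
    2 * (- (dz E p * Az p) + dr E p * (1 / snd p - Ar p) + dz W p * Bz p + dr W p * Br p)"
proof -
  have h: "h p \<noteq> 0" using h_pos[OF p] by simp
  have "h p * (dz (dz E) p + dr (dr E) p + dr E p / snd p -
    2 * (- (dz E p * Az p) + dr E p * (1 / snd p - Ar p) + dz W p * Bz p + dr W p * Br p)) = 0"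
    using ricci_expand[OF p, of 2 2] unfolding sum_4 vector_4 christoffel_table_def table_z_def table_r_def zero_index
    by (simp add: algebra_simps)
  then show ?thesis using h by simp
qed

lemma ricci_12:
  assumes p: "p \<in> half_plane"
  shows "dz (dz W) p + dr (dr W) p = dz E p * Cz p + dr E p * Cr p - dz V p * Bz p - dr V p * Br p"
proof -
  have h: "h p \<noteq> 0" using h_pos[OF p] by simp
  have "h p * (dz (dz W) p + dr (dr W) p - (dz E p * Cz p + dr E p * Cr p - dz V p * Bz p - dr V p * Br p)) = 0"
    using ricci_expand[OF p, of 1 2] unfolding sum_4 vector_4 christoffel_table_def table_z_def table_r_def zero_index
    by (simp add: algebra_simps)
  then show ?thesis using h by simp
qed

lemma ricci_33:
  assumes p: "p \<in> half_plane"
  shows "nzz p + nrr p + nr p / snd p + 2 * (Az p)\<^sup>2 + 2 * Bz p * Cz p = 0"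
  using ricci_expand[OF p, of 3 3] unfolding sum_4 vector_4 christoffel_table_def table_z_def table_r_def zero_index
  by (simp add: algebra_simps power2_eq_square)

text \<open>The (t, \<phi>) block of the symbols with lower index \<rho> has trace 1 / \<rho>; its
  derivative is the source of the isolated term \<open>1 / (snd p)^2\<close>.\<close>

lemma ricci_44:
  assumes p: "p \<in> half_plane"
  shows "nzz p + nrr p - 1 / (snd p)\<^sup>2 - nr p / snd p + (Ar p)\<^sup>2 + (1 / snd p - Ar p)\<^sup>2 + 2 * Br p * Cr p = 0"
  using ricci_expand[OF p, of 4 4] unfolding sum_4 vector_4 christoffel_table_def table_z_def table_r_def zero_index
  by (simp add: algebra_simps power2_eq_square)

text \<open>The components of \<open>\<eta>\<^sup>2 d\<Omega> / \<rho>\<close>, where \<open>\<Omega> = W / \<eta>\<close>.\<close>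

definition "Pz p = (E p * dz W p - W p * dz E p) / snd p"
definition "Pr p = (E p * dr W p - W p * dr E p) / snd p"

definition "x p = ln (E p)"

lemma C2_x:
  shows "C2 x"
    and "p \<in> half_plane \<Longrightarrow> dz x p = dz E p / E p"
    and "p \<in> half_plane \<Longrightarrow> dr x p = dr E p / E p"
    and "p \<in> half_plane \<Longrightarrow> dz (dz x) p = (dz (dz E) p * E p - (dz E p)\<^sup>2) / (E p)\<^sup>2"
    and "p \<in> half_plane \<Longrightarrow> dr (dr x) p = (dr (dr E) p * E p - (dr E p)\<^sup>2) / (E p)\<^sup>2"
proof -
  have 1: "grad_at x (dz E p / E p) (dr E p / E p) p" if p: "p \<in> half_plane" for p
    using grad_at_compose[OF C2_grad(1)[OF C2E p] DERIV_ln_divide[OF pos[OF p]]]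
    by (simp add: x_def[abs_def])
  have 2: "grad_at (\<lambda>q. dz E q / E q) ((dz (dz E) p * E p - dz E p * dz E p) / (E p)\<^sup>2)
      ((dr (dz E) p * E p - dz E p * dr E p) / (E p)\<^sup>2) p"
    "grad_at (\<lambda>q. dr E q / E q) ((dz (dr E) p * E p - dr E p * dz E p) / (E p)\<^sup>2)
      ((dr (dr E) p * E p - dr E p * dr E p) / (E p)\<^sup>2) p" if p: "p \<in> half_plane" for p
    by (rule grad_at_divide[OF C2_grad(2)[OF C2E p] C2_grad(1)[OF C2E p]]
        grad_at_divide[OF C2_grad(3)[OF C2E p] C2_grad(1)[OF C2E p]], use pos[OF p] in simp)+
  note c = C2_continuous[OF C2E]
  have cont: "continuous_on half_plane (\<lambda>p. (F p * E p - G p * H p) / (E p)\<^sup>2)"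
    if "continuous_on half_plane F" "continuous_on half_plane G" "continuous_on half_plane H" for F G H
    by (intro continuous_intros that c) (use pos in \<open>fastforce\<close>)
  note X = C2I[OF 1 2, OF _ _ _ cont[OF c(4,2,2)] cont[OF c(5,2,3)] cont[OF c(6,3,2)] cont[OF c(7,3,3)]]
  show "C2 x" by (rule X(1))
  assume p: "p \<in> half_plane"
  show "dz x p = dz E p / E p" "dr x p = dr E p / E p"
    "dz (dz x) p = (dz (dz E) p * E p - (dz E p)\<^sup>2) / (E p)\<^sup>2"
    "dr (dr x) p = (dr (dr E) p * E p - (dr E p)\<^sup>2) / (E p)\<^sup>2"
    using X(2)[OF _ _ _ p] by (simp_all add: power2_eq_square)
qed

section \<open>The field equations in terms of x, P and \<gamma>\<close>

context
  fixes p assumes p: "p \<in> half_plane"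
begin

lemma r_pos: "0 < snd p"
  using p by auto

text \<open>The determinant condition and its derivative eliminate V. Denominators are multiplied up
  so that only polynomial identities remain.\<close>

lemma frame_z:
  "2 * (snd p)\<^sup>2 * E p * Az p = W p * (W p * dz E p - E p * dz W p) - (snd p)\<^sup>2 * dz E p"
  "2 * (snd p)\<^sup>2 * Bz p = W p * dz E p - E p * dz W p"
  "2 * (snd p)\<^sup>2 * (E p)\<^sup>2 * Cz p = (snd p)\<^sup>2 * (E p * dz W p + W p * dz E p) - (W p)\<^sup>2 * (W p * dz E p - E p * dz W p)"
proof -
  have r: "snd p \<noteq> 0" using r_pos by simp
  have s: "2 * (snd p)\<^sup>2 * Az p = E p * dz V p + W p * dz W p" "2 * (snd p)\<^sup>2 * Cz p = V p * dz W p - W p * dz V p"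
    "2 * (snd p)\<^sup>2 * Bz p = W p * dz E p - E p * dz W p"
    using r by (simp_all add: Az_def Bz_def Cz_def)
  show "2 * (snd p)\<^sup>2 * Bz p = W p * dz E p - E p * dz W p" by (rule s)
  have "2 * (snd p)\<^sup>2 * E p * Az p = E p * (2 * (snd p)\<^sup>2 * Az p)"
    "2 * (snd p)\<^sup>2 * (E p)\<^sup>2 * Cz p = (E p)\<^sup>2 * (2 * (snd p)\<^sup>2 * Cz p)" by simp_all
  then show "2 * (snd p)\<^sup>2 * E p * Az p = W p * (W p * dz E p - E p * dz W p) - (snd p)\<^sup>2 * dz E p"
    "2 * (snd p)\<^sup>2 * (E p)\<^sup>2 * Cz p = (snd p)\<^sup>2 * (E p * dz W p + W p * dz E p) - (W p)\<^sup>2 * (W p * dz E p - E p * dz W p)"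
    using det[OF p] det_derivative(1)[OF p] unfolding s by algebra+
qed

lemma frame_r:
  "2 * (snd p)\<^sup>2 * E p * (1 / snd p - Ar p) = (snd p)\<^sup>2 * dr E p - W p * (W p * dr E p - E p * dr W p)"
  "2 * (snd p)\<^sup>2 * Br p = W p * dr E p - E p * dr W p"
  "2 * (snd p)\<^sup>2 * (E p)\<^sup>2 * Cr p = (snd p)\<^sup>2 * (E p * dr W p + W p * dr E p)
     - (W p)\<^sup>2 * (W p * dr E p - E p * dr W p) - 2 * snd p * W p * E p"
proof -
  have r: "snd p \<noteq> 0" using r_pos by simp
  have s: "2 * (snd p)\<^sup>2 * (1 / snd p - Ar p) = 2 * snd p - (E p * dr V p + W p * dr W p)"
    "2 * (snd p)\<^sup>2 * Cr p = V p * dr W p - W p * dr V p" "2 * (snd p)\<^sup>2 * Br p = W p * dr E p - E p * dr W p"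
    subgoal using r by (simp add: Ar_def right_diff_distrib power2_eq_square)
    using r by (simp_all add: Br_def Cr_def)
  show "2 * (snd p)\<^sup>2 * Br p = W p * dr E p - E p * dr W p" by (rule s)
  have "2 * (snd p)\<^sup>2 * E p * (1 / snd p - Ar p) = E p * (2 * (snd p)\<^sup>2 * (1 / snd p - Ar p))"
    "2 * (snd p)\<^sup>2 * (E p)\<^sup>2 * Cr p = (E p)\<^sup>2 * (2 * (snd p)\<^sup>2 * Cr p)" by simp_all
  then show "2 * (snd p)\<^sup>2 * E p * (1 / snd p - Ar p) = (snd p)\<^sup>2 * dr E p - W p * (W p * dr E p - E p * dr W p)"
    "2 * (snd p)\<^sup>2 * (E p)\<^sup>2 * Cr p = (snd p)\<^sup>2 * (E p * dr W p + W p * dr E p)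
     - (W p)\<^sup>2 * (W p * dr E p - E p * dr W p) - 2 * snd p * W p * E p"
    using det[OF p] det_derivative(2)[OF p] unfolding s by algebra+
qed

text \<open>The equations R_12 = 0 and R_22 = 0, combined with the weights E and -W. The result is
  \<open>div P = 0\<close> multiplied by \<rho>.\<close>

lemma div_free: "E p * (dz (dz W) p + dr (dr W) p) - W p * (dz (dz E) p + dr (dr E) p)
    = (E p * dr W p - W p * dr E p) / snd p"
proof -
  have r: "snd p \<noteq> 0" using r_pos by simp
  let ?k = "2 * (snd p)\<^sup>2"
  define D where "D = 1 / snd p - Ar p"
  have cancel: "a = b / c" if "2 * c\<^sup>2 * a = 2 * c * b" "c \<noteq> 0" for a b c :: real
    using that by (simp add: power2_eq_square field_simps)
  have e: "dz (dz E) p + dr (dr E) p = 2 * (- (dz E p * Az p) + dr E p * D + dz W p * Bz p + dr W p * Br p) - dr E p / snd p"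
    using ricci_22[OF p] by (simp add: D_def)
  have sz: "?k * Az p = E p * dz V p + W p * dz W p" "?k * Cz p = V p * dz W p - W p * dz V p"
    "?k * Bz p = W p * dz E p - E p * dz W p"
    using r by (simp_all add: Az_def Bz_def Cz_def)
  have sr: "?k * D = 2 * snd p - (E p * dr V p + W p * dr W p)"
    "?k * Cr p = V p * dr W p - W p * dr V p" "?k * Br p = W p * dr E p - E p * dr W p"
    subgoal using r by (simp add: D_def Ar_def right_diff_distrib power2_eq_square)
    using r by (simp_all add: Br_def Cr_def)
  have "?k * (E p * (dz E p * Cz p + dr E p * Cr p - dz V p * Bz p - dr V p * Br p)
     - W p * (2 * (- (dz E p * Az p) + dr E p * D + dz W p * Bz p + dr W p * Br p)))
    = E p * (dz E p * (?k * Cz p) + dr E p * (?k * Cr p) - dz V p * (?k * Bz p) - dr V p * (?k * Br p))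
     - W p * (2 * (- (dz E p * (?k * Az p)) + dr E p * (?k * D) + dz W p * (?k * Bz p) + dr W p * (?k * Br p)))"
    by (simp add: algebra_simps)
  also have "\<dots> = 2 * snd p * (E p * dr W p - 2 * W p * dr E p)"
    unfolding sz sr using det_derivative[OF p] by algebra
  finally have "E p * (dz E p * Cz p + dr E p * Cr p - dz V p * Bz p - dr V p * Br p)
     - W p * (2 * (- (dz E p * Az p) + dr E p * D + dz W p * Bz p + dr W p * Br p))
    = (E p * dr W p - 2 * W p * dr E p) / snd p"
    by (rule cancel[OF _ r])
  then show ?thesis unfolding ricci_12[OF p] e by (simp add: right_diff_distrib diff_divide_distrib)
qed

lemma laplacian_x:
  "dz (dz x) p + dr (dr x) p + dr x p / snd p = - ((Pz p)\<^sup>2 + (Pr p)\<^sup>2) / (E p)\<^sup>2"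
proof -
  have r: "snd p \<noteq> 0" using r_pos by simp
  have E0: "E p \<noteq> 0" using pos[OF p] by simp
  define D where "D = 1 / snd p - Ar p"
  have P: "snd p * Pz p = E p * dz W p - W p * dz E p" "snd p * Pr p = E p * dr W p - W p * dr E p"
    using r by (simp_all add: Pz_def Pr_def)
  have "(snd p)\<^sup>2 * (2 * E p * (- (dz E p * Az p) + dr E p * D + dz W p * Bz p + dr W p * Br p))
    = - dz E p * (2 * (snd p)\<^sup>2 * E p * Az p) + dr E p * (2 * (snd p)\<^sup>2 * E p * D)
      + E p * (dz W p * (2 * (snd p)\<^sup>2 * Bz p) + dr W p * (2 * (snd p)\<^sup>2 * Br p))"
    by (simp add: algebra_simps)
  also have "\<dots> = (snd p)\<^sup>2 * ((dz E p)\<^sup>2 + (dr E p)\<^sup>2) - ((snd p * Pz p)\<^sup>2 + (snd p * Pr p)\<^sup>2)"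
    unfolding frame_z frame_r[folded D_def] P by (simp add: algebra_simps power2_eq_square)
  also have "\<dots> = (snd p)\<^sup>2 * ((dz E p)\<^sup>2 + (dr E p)\<^sup>2 - ((Pz p)\<^sup>2 + (Pr p)\<^sup>2))"
    by (simp add: algebra_simps power_mult_distrib)
  finally have "2 * E p * (- (dz E p * Az p) + dr E p * D + dz W p * Bz p + dr W p * Br p)
     = (dz E p)\<^sup>2 + (dr E p)\<^sup>2 - ((Pz p)\<^sup>2 + (Pr p)\<^sup>2)" using r by simp
  then have "E p * (2 * (- (dz E p * Az p) + dr E p * D + dz W p * Bz p + dr W p * Br p))
     = (dz E p)\<^sup>2 + (dr E p)\<^sup>2 - ((Pz p)\<^sup>2 + (Pr p)\<^sup>2)"
    by (simp only: mult.assoc mult.left_commute)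
  then have e: "E p * (dz (dz E) p + dr (dr E) p + dr E p / snd p) = (dz E p)\<^sup>2 + (dr E p)\<^sup>2 - ((Pz p)\<^sup>2 + (Pr p)\<^sup>2)"
    unfolding ricci_22[OF p] D_def .
  have "dz (dz x) p + dr (dr x) p + dr x p / snd p
    = (E p * (dz (dz E) p + dr (dr E) p + dr E p / snd p) - (dz E p)\<^sup>2 - (dr E p)\<^sup>2) / (E p)\<^sup>2"
    unfolding C2_x(3,4,5)[OF p] using E0 r by (simp add: field_simps power2_eq_square)
  then show ?thesis unfolding e by simp
qed

text \<open>The left-hand side is the trace of the square of the matrix \<open>\<Gamma>^A_Bz\<close>
  with A, B in {t, \<phi>}, that is, the quadratic part of R_33.\<close>

lemma trace_z: "2 * (Az p)\<^sup>2 + 2 * Bz p * Cz p = ((dz x p)\<^sup>2 - (Pz p)\<^sup>2 / (E p)\<^sup>2) / 2"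
proof -
  have r: "snd p \<noteq> 0" using r_pos by simp
  have E0: "E p \<noteq> 0" using pos[OF p] by simp
  have P: "snd p * Pz p = E p * dz W p - W p * dz E p" using r by (simp add: Pz_def)
  have X: "E p * dz x p = dz E p" using E0 by (simp add: C2_x(2)[OF p])
  have "4 * (snd p)^4 * (E p)\<^sup>2 * (2 * (Az p)\<^sup>2 + 2 * Bz p * Cz p)
    = 2 * (2 * (snd p)\<^sup>2 * E p * Az p)\<^sup>2 + 2 * (2 * (snd p)\<^sup>2 * Bz p) * (2 * (snd p)\<^sup>2 * (E p)\<^sup>2 * Cz p)"
    by algebra
  also have "\<dots> = 2 * (snd p)^4 * (dz E p)\<^sup>2 - 2 * (snd p)\<^sup>2 * (E p * dz W p - W p * dz E p)\<^sup>2"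
    unfolding frame_z by algebra
  also have "\<dots> = 4 * (snd p)^4 * (((E p * dz x p)\<^sup>2 - (Pz p)\<^sup>2) / 2)"
    unfolding X P[symmetric] by (simp add: power_mult_distrib algebra_simps power4_eq_xxxx power2_eq_square)
  finally have "(E p)\<^sup>2 * (2 * (Az p)\<^sup>2 + 2 * Bz p * Cz p) = ((E p * dz x p)\<^sup>2 - (Pz p)\<^sup>2) / 2"
    using r by simp
  then have "2 * (Az p)\<^sup>2 + 2 * Bz p * Cz p = ((E p * dz x p)\<^sup>2 - (Pz p)\<^sup>2) / 2 / (E p)\<^sup>2"
    using E0 by (simp add: nonzero_eq_divide_eq mult.commute)
  then show ?thesis using E0 by (simp add: power_mult_distrib diff_divide_distrib)
qed

text \<open>As for \<open>trace_z\<close>, but the matrix has trace 1 / \<rho> instead of 0, which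
  produces the first two terms on the right.\<close>

lemma trace_r: "(Ar p)\<^sup>2 + (1 / snd p - Ar p)\<^sup>2 + 2 * Br p * Cr p
  = 1 / (snd p)\<^sup>2 - dr x p / snd p + ((dr x p)\<^sup>2 - (Pr p)\<^sup>2 / (E p)\<^sup>2) / 2"
proof -
  have r: "snd p \<noteq> 0" using r_pos by simp
  have E0: "E p \<noteq> 0" using pos[OF p] by simp
  define D where "D = 1 / snd p - Ar p"
  have A: "snd p * Ar p = 1 - snd p * D" using r by (simp add: D_def algebra_simps)
  have P: "snd p * Pr p = E p * dr W p - W p * dr E p" using r by (simp add: Pr_def)
  have X: "E p * dr x p = dr E p" using E0 by (simp add: C2_x(3)[OF p])
  have "4 * (snd p)^4 * (E p)\<^sup>2 * ((Ar p)\<^sup>2 + D\<^sup>2 + 2 * Br p * Cr p)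
    = (2 * snd p * E p * (snd p * Ar p))\<^sup>2 + (2 * (snd p)\<^sup>2 * E p * D)\<^sup>2 + 2 * (2 * (snd p)\<^sup>2 * Br p) * (2 * (snd p)\<^sup>2 * (E p)\<^sup>2 * Cr p)"
    by algebra
  also have "\<dots> = (2 * snd p * E p - 2 * (snd p)\<^sup>2 * E p * D)\<^sup>2 + (2 * (snd p)\<^sup>2 * E p * D)\<^sup>2 + 2 * (2 * (snd p)\<^sup>2 * Br p) * (2 * (snd p)\<^sup>2 * (E p)\<^sup>2 * Cr p)"
    unfolding A by algebra
  also have "\<dots> = 4 * (snd p)\<^sup>2 * (E p)\<^sup>2 - 4 * (snd p)^3 * E p * dr E p + 2 * (snd p)^4 * (dr E p)\<^sup>2
      - 2 * (snd p)\<^sup>2 * (E p * dr W p - W p * dr E p)\<^sup>2"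
    unfolding frame_r[folded D_def] by algebra
  also have "\<dots> = 4 * (snd p)\<^sup>2 * (E p)\<^sup>2 - 4 * (snd p)^3 * E p * (E p * dr x p) + 2 * (snd p)^4 * (E p * dr x p)\<^sup>2
      - 2 * (snd p)\<^sup>2 * (snd p * Pr p)\<^sup>2"
    unfolding X P ..
  also have "\<dots> = 4 * (snd p)^4 * (E p)\<^sup>2 * (1 / (snd p)\<^sup>2 - dr x p / snd p + ((dr x p)\<^sup>2 - (Pr p)\<^sup>2 / (E p)\<^sup>2) / 2)"
    using r E0 by (simp add: field_simps power2_eq_square power3_eq_cube power4_eq_xxxx)
  finally show ?thesis using r E0 by (simp add: D_def)
qed

text \<open>In the difference of R_33 and R_44 the second derivatives cancel, leaving a first-order
  equation for \<gamma>.\<close>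

lemma gamma_r: "dr g p = snd p / 4 * ((dr x p)\<^sup>2 - (dz x p)\<^sup>2 + ((Pz p)\<^sup>2 - (Pr p)\<^sup>2) / (E p)\<^sup>2)"
proof -
  have r: "snd p \<noteq> 0" using r_pos by simp
  have n: "nr p = dr g p - dr x p / 2" by (simp add: nr_def C2_x(3)[OF p])
  have "2 * (nr p / snd p) = - (1 / (snd p)\<^sup>2) + ((Ar p)\<^sup>2 + (1 / snd p - Ar p)\<^sup>2 + 2 * Br p * Cr p)
      - (2 * (Az p)\<^sup>2 + 2 * Bz p * Cz p)"
    using ricci_33[OF p] ricci_44[OF p] by linarith
  then have "2 * (dr g p / snd p) = ((dr x p)\<^sup>2 - (Pr p)\<^sup>2 / (E p)\<^sup>2) / 2 - ((dz x p)\<^sup>2 - (Pz p)\<^sup>2 / (E p)\<^sup>2) / 2"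
    unfolding trace_z trace_r n by (simp add: diff_divide_distrib)
  moreover have "((Pz p)\<^sup>2 - (Pr p)\<^sup>2) / (E p)\<^sup>2 = (Pz p)\<^sup>2 / (E p)\<^sup>2 - (Pr p)\<^sup>2 / (E p)\<^sup>2"
    by (rule diff_divide_distrib)
  moreover have "u = (a - c + e) / 4" if "2 * u = (a - b) / 2 - (c - d) / 2" "e = d - b" for a b c d e u :: real
    using that by (simp add: field_simps)
  ultimately have "dr g p / snd p = ((dr x p)\<^sup>2 - (dz x p)\<^sup>2 + ((Pz p)\<^sup>2 - (Pr p)\<^sup>2) / (E p)\<^sup>2) / 4"
    by blast
  then show ?thesis using r by (simp add: field_simps)
qed

text \<open>R_33 = 0 with the first-order terms replaced by \<open>gamma_r\<close> and the Laplacian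
  of x by \<open>laplacian_x\<close>. The sign makes \<gamma> superharmonic, as the minimum
  principle for chains requires.\<close>

lemma laplacian_gamma: "dz (dz g) p + dr (dr g) p
   = - ((dz x p)\<^sup>2 + (dr x p)\<^sup>2 + ((Pz p)\<^sup>2 + (Pr p)\<^sup>2) / (E p)\<^sup>2) / 4"
proof -
  have r: "snd p \<noteq> 0" using r_pos by simp
  have E0: "E p \<noteq> 0" using pos[OF p] by simp
  have n: "nr p = dr g p - dr x p / 2" by (simp add: nr_def C2_x(3)[OF p])
  have nn: "nzz p = dz (dz g) p - dz (dz x) p / 2" "nrr p = dr (dr g) p - dr (dr x) p / 2"
    unfolding nzz_def nrr_def C2_x(4,5)[OF p] using E0 by (simp_all add: field_simps power2_eq_square)
  have g: "dr g p / snd p = ((dr x p)\<^sup>2 - (dz x p)\<^sup>2 + ((Pz p)\<^sup>2 - (Pr p)\<^sup>2) / (E p)\<^sup>2) / 4"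
    unfolding gamma_r using r by simp
  have "nzz p + nrr p = - (nr p / snd p) - ((dz x p)\<^sup>2 - (Pz p)\<^sup>2 / (E p)\<^sup>2) / 2"
    using ricci_33[OF p] trace_z by linarith
  moreover have "nr p / snd p = dr g p / snd p - dr x p / snd p / 2" unfolding n by (simp add: diff_divide_distrib)
  moreover have "((Pz p)\<^sup>2 - (Pr p)\<^sup>2) / (E p)\<^sup>2 = (Pz p)\<^sup>2 / (E p)\<^sup>2 - (Pr p)\<^sup>2 / (E p)\<^sup>2"
    "((Pz p)\<^sup>2 + (Pr p)\<^sup>2) / (E p)\<^sup>2 = (Pz p)\<^sup>2 / (E p)\<^sup>2 + (Pr p)\<^sup>2 / (E p)\<^sup>2"
    "- ((Pz p)\<^sup>2 + (Pr p)\<^sup>2) / (E p)\<^sup>2 = - ((Pz p)\<^sup>2 / (E p)\<^sup>2) - (Pr p)\<^sup>2 / (E p)\<^sup>2"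
    by (simp_all add: diff_divide_distrib add_divide_distrib)
  ultimately show ?thesis using g laplacian_x nn by argo
qed

end

section \<open>The conserved flux and the angular momentum\<close>

definition "Pzz p = (E p * dz (dz W) p - W p * dz (dz E) p) / snd p"
definition "Prr p = (E p * dr (dr W) p - W p * dr (dr E) p) / snd p - Pr p / snd p"

text \<open>Of each component only the derivative in its own direction enters the divergence; the
  other one is left existential.\<close>

lemma flux:
  assumes p: "p \<in> half_plane"
  shows "\<exists>b. grad_at Pz (Pzz p) b p" "\<exists>a. grad_at Pr a (Prr p) p" "Pzz p + Prr p = 0"
proof -
  have r: "snd p \<noteq> 0" using p by auto
  note W = C2_grad[OF C2W p] and E = C2_grad[OF C2E p]
  have "grad_at Pz (((dz E p * dz W p + E p * dz (dz W) p - (dz W p * dz E p + W p * dz (dz E) p)) * snd p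
      - (E p * dz W p - W p * dz E p) * 0) / (snd p)\<^sup>2)
    (((dr E p * dz W p + E p * dr (dz W) p - (dr W p * dz E p + W p * dr (dz E) p)) * snd p
      - (E p * dz W p - W p * dz E p) * 1) / (snd p)\<^sup>2) p"
    unfolding Pz_def[abs_def]
    by (rule grad_at_divide[OF grad_at_diff[OF grad_at_mult[OF E(1) W(2)] grad_at_mult[OF W(1) E(2)]] grad_at_snd r])
  moreover have "((dz E p * dz W p + E p * dz (dz W) p - (dz W p * dz E p + W p * dz (dz E) p)) * snd p
      - (E p * dz W p - W p * dz E p) * 0) / (snd p)\<^sup>2 = Pzz p"
    using r by (simp add: Pzz_def field_simps power2_eq_square)
  ultimately show "\<exists>b. grad_at Pz (Pzz p) b p" by auto
  have "grad_at Pr (((dz E p * dr W p + E p * dz (dr W) p - (dz W p * dr E p + W p * dz (dr E) p)) * snd p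
      - (E p * dr W p - W p * dr E p) * 0) / (snd p)\<^sup>2)
    (((dr E p * dr W p + E p * dr (dr W) p - (dr W p * dr E p + W p * dr (dr E) p)) * snd p
      - (E p * dr W p - W p * dr E p) * 1) / (snd p)\<^sup>2) p"
    unfolding Pr_def[abs_def]
    by (rule grad_at_divide[OF grad_at_diff[OF grad_at_mult[OF E(1) W(3)] grad_at_mult[OF W(1) E(3)]] grad_at_snd r])
  moreover have "((dr E p * dr W p + E p * dr (dr W) p - (dr W p * dr E p + W p * dr (dr E) p)) * snd p
      - (E p * dr W p - W p * dr E p) * 1) / (snd p)\<^sup>2 = Prr p"
    using r by (simp add: Prr_def Pr_def field_simps power2_eq_square)
  ultimately show "\<exists>a. grad_at Pr a (Prr p) p" by auto
  show "Pzz p + Prr p = 0"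
  proof -
    have "Pzz p + Prr p = (E p * (dz (dz W) p + dr (dr W) p) - W p * (dz (dz E) p + dr (dr E) p)) / snd p - Pr p / snd p"
      by (simp add: Pzz_def Prr_def algebra_simps flip: add_divide_distrib)
    then show ?thesis unfolding div_free[OF p] by (simp add: Pr_def)
  qed
qed

lemma det_metric:
  assumes "y \<in> weyl_domain" "p = (y $ 3, y $ 4)"
  shows "Determinants.det (weyl_g y) = - ((snd p)\<^sup>2) / (2 * h p)\<^sup>2"
proof -
  have p: "p \<in> half_plane" using in_half_plane[OF assms(1)] assms(2) by simp
  have r: "snd p \<noteq> 0" using p by auto
  have h: "h p \<noteq> 0" using h_pos[OF p] by simp
  have E0: "E p \<noteq> 0" using pos[OF p] by simp
  have V: "- V p - W p * W p / E p = - (snd p * snd p) / E p"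
  proof -
    have "V p = (snd p * snd p - W p * W p) / E p"
      using det[OF p] E0 by (simp add: nonzero_eq_divide_eq power2_eq_square)
    then show ?thesis by (simp add: diff_divide_distrib)
  qed
  define A where "A = weyl_g y"
  \<comment> \<open>Two row operations make the matrix diagonal: row 2 clears the entry (1, 2), then
    the new row 1 clears (2, 1). The determinant condition gives the new entry (1, 1).\<close>
  define B where "B = (\<chi> k. if k = 1 then row 1 A + (- W p / E p) *s row 2 A else row k A)"
  define C where "C = (\<chi> k. if k = 2 then row 2 B + (W p * E p / (snd p)\<^sup>2) *s row 1 B else row k B)"
  have dB: "Determinants.det B = Determinants.det A" unfolding B_def by (rule det_row_operation) (simp add: four_ne)
  have dC: "Determinants.det C = Determinants.det B" unfolding C_def by (rule det_row_operation) (simp add: four_ne)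
  have B: "B = vector [vector [- (snd p)\<^sup>2 / E p, 0, 0, 0], vector [W p, E p, 0, 0],
      vector [0, 0, 1 / (2 * h p), 0], vector [0, 0, 0, 1 / (2 * h p)]]"
    unfolding vec_eq_iff forall_4 B_def A_def metric_components assms(2)[symmetric] metric_entries_def row_def
    using E0 V by (simp add: four_ne four_ne[symmetric] power2_eq_square)
  have C: "C = vector [vector [- (snd p)\<^sup>2 / E p, 0, 0, 0], vector [0, E p, 0, 0],
      vector [0, 0, 1 / (2 * h p), 0], vector [0, 0, 0, 1 / (2 * h p)]]"
    unfolding vec_eq_iff forall_4 C_def B row_def
    using E0 r by (simp add: four_ne four_ne[symmetric])
  have "\<forall>i j. i \<noteq> j \<longrightarrow> C $ i $ j = 0" unfolding forall_4 C by (simp add: four_ne)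
  then have "Determinants.det C = prod (\<lambda>i. C $ i $ i) UNIV" by (intro det_diagonal) auto
  also have "\<dots> = C $ 1 $ 1 * C $ 2 $ 2 * C $ 3 $ 3 * C $ 4 $ 4"
    unfolding UNIV_4 by (simp add: four_ne mult.assoc)
  also have "\<dots> = - ((snd p)\<^sup>2) / (2 * h p)\<^sup>2" unfolding C using E0 by (simp add: power2_eq_square)
  finally show ?thesis unfolding dC dB A_def .
qed

lemma levi_civita_repeated:
  "i \<in> {2, 3} \<Longrightarrow> levi_civita i j 2 3 = 0" "j \<in> {2, 3} \<Longrightarrow> levi_civita i j 2 3 = 0" "levi_civita i i 2 3 = 0"
proof -
  have rep: "levi_civita a b c d = 0" if "a = c \<or> a = d \<or> b = c \<or> b = d \<or> a = b" for a b c d :: 4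
  proof -
    let ?A = "vector [axis a 1, axis b 1, axis c 1, axis d 1] :: real ^ 4 ^ 4"
    have "\<exists>k l. k \<noteq> l \<and> row k ?A = row l ?A"
      using that four_ne unfolding row_def vec_lambda_eta by (metis vector_4)
    then show ?thesis unfolding levi_civita_def by (metis det_identical_rows)
  qed
  show "i \<in> {2, 3} \<Longrightarrow> levi_civita i j 2 3 = 0" "j \<in> {2, 3} \<Longrightarrow> levi_civita i j 2 3 = 0" "levi_civita i i 2 3 = 0"
    using rep by auto
qed

text \<open>Only the index pair (1, 4) survives against (2, 3). The permutation signs may stay
  symbolic: the use made of this is that a vanishing flux forces a vanishing angular
  momentum.\<close>

lemma hodge_killing:
  assumes "y \<in> weyl_domain" "p = (y $ 3, y $ 4)"
  shows "hodge_star weyl_g (d_killing weyl_g) 2 3 y = (levi_civita 1 4 2 3 - levi_civita 4 1 2 3) / 2 * Pr p"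
proof -
  have p: "p \<in> half_plane" using in_half_plane[OF assms(1)] assms(2) by simp
  have r: "snd p > 0" using p by auto
  have h: "h p > 0" using h_pos[OF p] .
  have sq: "sqrt \<bar>Determinants.det (weyl_g y)\<bar> = snd p / (2 * h p)"
  proof -
    have "\<bar>Determinants.det (weyl_g y)\<bar> = (snd p / (2 * h p))\<^sup>2"
      unfolding det_metric[OF assms] by (simp add: power_divide)
    then show ?thesis using r h by simp
  qed
  have sm: "(\<Sum>a\<in>UNIV. \<Sum>b\<in>UNIV. levi_civita a b 2 3 *
        (\<Sum>i\<in>UNIV. \<Sum>j\<in>UNIV. matrix_inv (weyl_g y) $ a $ i * matrix_inv (weyl_g y) $ b $ j * d_killing weyl_g i j y))
    = (levi_civita 1 4 2 3 - levi_civita 4 1 2 3) * (2 * h p * (E p * dr W p - W p * dr E p) / (snd p)\<^sup>2)"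
    unfolding d_killing_def pd_metric[OF assms] metric_inverse[OF assms] inverse_entries_def metric_entries_z_def metric_entries_r_def sum_4 vector_4 zero_index
    using r by (simp add: levi_civita_repeated) (simp add: field_simps)
  show ?thesis
    unfolding hodge_star_def sq sm using r h by (simp add: Pr_def field_simps power2_eq_square)
qed

lemma angular_momentum_flux:
  assumes "angular_momentum L weyl_g \<noteq> 0"
  shows "integral {- (L / 2)..L / 2} (\<lambda>z. Pr (z, 1)) \<noteq> 0"
proof
  assume z: "integral {- (L / 2)..L / 2} (\<lambda>z. Pr (z, 1)) = 0"
  have "hodge_star weyl_g (d_killing weyl_g) 2 3 (vector [0, \<phi>, z, 1]) =
     (levi_civita 1 4 2 3 - levi_civita 4 1 2 3) / 2 * Pr (z, 1)" for \<phi> z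
    by (rule hodge_killing) (simp_all add: weyl_domain_def)
  then have "angular_momentum L weyl_g = 0"
    unfolding angular_momentum_def komar_integral_def using z by (simp only: integral_mult_right mult_zero_right integral_0)
  then show False using assms by simp
qed

end

section \<open>Means over a period\<close>

definition periodic :: "real \<Rightarrow> (real \<times> real \<Rightarrow> real) \<Rightarrow> bool" where
  "periodic L F \<longleftrightarrow> (\<forall>z \<rho>. \<rho> > 0 \<longrightarrow> F (z + L, \<rho>) = F (z, \<rho>))"

lemma periodic_grad:
  assumes per: "periodic L F" and F: "\<And>p. p \<in> half_plane \<Longrightarrow> grad_at F (dz F p) (dr F p) p"
  shows "periodic L (dz F)" "periodic L (dr F)"
proof -
  have "dz F (z, \<rho>) = dz F (z + L, \<rho>) \<and> dr F (z, \<rho>) = dr F (z + L, \<rho>)" if "\<rho> > 0" for z \<rho>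
  proof -
    have A: "((\<lambda>q. q + (L, 0)) has_derivative (\<lambda>h. h)) (at (z, \<rho>))" by (auto intro!: derivative_eq_intros)
    have B: "(F has_derivative (\<lambda>h. fst h * dz F (z + L, \<rho>) + snd h * dr F (z + L, \<rho>))) (at ((z, \<rho>) + (L, 0)))"
      using F[of "(z + L, \<rho>)"] that by (simp add: grad_at_def)
    have "grad_at (\<lambda>q. F (q + (L, 0))) (dz F (z + L, \<rho>)) (dr F (z + L, \<rho>)) (z, \<rho>)"
      using has_derivative_compose[OF A B] unfolding grad_at_def .
    then have "grad_at F (dz F (z + L, \<rho>)) (dr F (z + L, \<rho>)) (z, \<rho>)"
      by (rule grad_at_cong[OF _ open_half_plane]) (use per that in \<open>auto simp: periodic_def\<close>)
    then show ?thesis by (rule grad_at_dz_dr)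
  qed
  then show "periodic L (dz F)" "periodic L (dr F)" unfolding periodic_def by metis+
qed

text \<open>The integral is not divided by L, so growth like \<open>s ln \<rho>\<close> at every z
  becomes the slope \<open>L * s\<close>.\<close>

definition mean :: "real \<Rightarrow> (real \<times> real \<Rightarrow> real) \<Rightarrow> real \<Rightarrow> real" where
  "mean L F \<rho> = integral {- (L / 2)..L / 2} (\<lambda>z. F (z, \<rho>))"

lemma continuous_on_slice:
  assumes "continuous_on half_plane F" "\<rho> > 0"
  shows "continuous_on S (\<lambda>z. F (z, \<rho>))"
  by (rule continuous_on_compose2[OF assms(1)]) (use assms(2) in \<open>auto intro!: continuous_intros\<close>)

lemma integrable_slice:
  fixes F :: "real \<times> real \<Rightarrow> real"
  assumes "continuous_on half_plane F" "\<rho> > 0"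
  shows "(\<lambda>z. F (z, \<rho>)) integrable_on {a..b}"
proof -
  have "continuous_on {a..b} (\<lambda>z. F (z, \<rho>))" by (rule continuous_on_slice[OF assms])
  then show ?thesis by (rule integrable_continuous_real)
qed

lemma grad_at_slice_r:
  assumes "grad_at F a b (z, \<rho>)"
  shows "((\<lambda>\<rho>. F (z, \<rho>)) has_real_derivative b) (at \<rho>)"
proof -
  have "((\<lambda>\<rho>. (z, \<rho>)) has_derivative (\<lambda>h. (0, h))) (at \<rho>)" by (auto intro!: derivative_eq_intros)
  from has_derivative_compose[OF this assms[unfolded grad_at_def]] show ?thesis
    unfolding has_field_derivative_def by (simp add: mult_commute_abs)
qed

lemma grad_at_slice_z:
  assumes "grad_at F a b (z, \<rho>)"
  shows "((\<lambda>z. F (z, \<rho>)) has_real_derivative a) (at z)"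
proof -
  have "((\<lambda>z. (z, \<rho>)) has_derivative (\<lambda>h. (h, 0))) (at z)" by (auto intro!: derivative_eq_intros)
  from has_derivative_compose[OF this assms[unfolded grad_at_def]] show ?thesis
    unfolding has_field_derivative_def by (simp add: mult_commute_abs)
qed

lemma mean_derivative:
  assumes grad: "\<And>p. p \<in> half_plane \<Longrightarrow> \<exists>a. grad_at F a (F' p) p"
    and cont: "continuous_on half_plane F'" and r: "r > 0"
  shows "(mean L F has_real_derivative mean L F' r) (at r)"
proof -
  have contF: "continuous_on half_plane F"
  proof (rule continuous_at_imp_continuous_on, rule ballI)
    fix p assume "p \<in> half_plane"
    then obtain a where "grad_at F a (F' p) p" using grad by metis
    then show "isCont F p" by (rule grad_at_continuous)
  qed
  have "((\<lambda>\<rho>. integral (cbox (- (L / 2)) (L / 2)) (\<lambda>z. F (z, \<rho>))) has_field_derivative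
      integral (cbox (- (L / 2)) (L / 2)) (\<lambda>z. F' (z, r))) (at r within {0<..})"
  proof (rule leibniz_rule_field_derivative[where f = "\<lambda>\<rho> z. F (z, \<rho>)" and fx = "\<lambda>\<rho> z. F' (z, \<rho>)"])
    show "((\<lambda>\<rho>. F (z, \<rho>)) has_field_derivative F' (z, \<rho>)) (at \<rho> within {0<..})" if "\<rho> \<in> {0<..}" for \<rho> z
    proof -
      have "(z, \<rho>) \<in> half_plane" using that by simp
      then obtain a where "grad_at F a (F' (z, \<rho>)) (z, \<rho>)" using grad by metis
      then show ?thesis by (rule has_field_derivative_at_within[OF grad_at_slice_r])
    qed
    show "(\<lambda>z. F (z, \<rho>)) integrable_on cbox (- (L / 2)) (L / 2)" if "\<rho> \<in> {0<..}" for \<rho>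
      using integrable_slice[OF contF, of \<rho>] that by simp
    have "continuous_on ({0<..} \<times> cbox (- (L / 2)) (L / 2)) (\<lambda>q. F' (snd q, fst q))"
    proof (rule continuous_on_compose2[OF cont])
      show "continuous_on ({0<..} \<times> cbox (- (L / 2)) (L / 2)) (\<lambda>q. (snd q, fst q))"
        by (intro continuous_intros)
    qed auto
    then show "continuous_on ({0<..} \<times> cbox (- (L / 2)) (L / 2)) (\<lambda>(\<rho>, z). F' (z, \<rho>))"
      by (simp only: case_prod_unfold)
  qed (use r in simp_all)
  moreover have "at r within {0<..} = at r" using r by (intro at_within_open) auto
  ultimately show ?thesis unfolding mean_def[abs_def] by simp
qed

lemma mean_z_derivative:
  assumes grad: "\<And>p. p \<in> half_plane \<Longrightarrow> \<exists>b. grad_at F (F' p) b p"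
    and per: "periodic L F" and L: "L > 0" and r: "r > 0"
  shows "mean L F' r = 0"
proof -
  have "((\<lambda>z. F' (z, r)) has_integral (F (L / 2, r) - F (- (L / 2), r))) {- (L / 2)..L / 2}"
  proof (rule fundamental_theorem_of_calculus)
    fix z
    obtain b where "grad_at F (F' (z, r)) b (z, r)" using grad[of "(z, r)"] r by (auto simp: mem_Times_iff)
    then show "((\<lambda>z. F (z, r)) has_vector_derivative F' (z, r)) (at z within {- (L / 2)..L / 2})"
      unfolding has_real_derivative_iff_has_vector_derivative[symmetric]
      by (rule has_field_derivative_at_within[OF grad_at_slice_z])
  qed (use L in simp)
  moreover have "F (L / 2, r) = F (- (L / 2), r)"
    using per[unfolded periodic_def, rule_format, OF r, of "- (L / 2)"] by simp
  ultimately show ?thesis by (simp add: mean_def integral_unique)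
qed

lemma mean_combination:
  assumes "continuous_on half_plane F" "continuous_on half_plane G" "r > 0"
  shows "mean L (\<lambda>p. a * F p + b * G p) r = a * mean L F r + b * mean L G r"
  unfolding mean_def using integrable_slice[OF assms(1,3)] integrable_slice[OF assms(2,3)]
  by (subst integral_add) (auto intro: integrable_on_mult_right)

lemma mean_mono:
  assumes "continuous_on half_plane F" "continuous_on half_plane G" "r > 0"
    and "\<And>z. z \<in> {- (L / 2)..L / 2} \<Longrightarrow> F (z, r) \<le> G (z, r)"
  shows "mean L F r \<le> mean L G r"
  unfolding mean_def by (intro integral_le integrable_slice assms)

lemma mean_const: "L > 0 \<Longrightarrow> mean L (\<lambda>p. c) r = L * c"
  unfolding mean_def by simp

lemma decreasing_le:
  fixes f :: "real \<Rightarrow> real"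
  assumes "a \<le> b" "\<And>r. a \<le> r \<Longrightarrow> r \<le> b \<Longrightarrow> (f has_real_derivative f' r) (at r)"
    and "\<And>r. a \<le> r \<Longrightarrow> r \<le> b \<Longrightarrow> f' r \<le> 0"
  shows "f b \<le> f a"
  by (rule DERIV_nonpos_imp_nonincreasing[OF assms(1)]) (rule exI, rule conjI, erule (1) assms(2), erule (1) assms(3))

section \<open>The behaviour of \<eta> at the horizon and the axis\<close>

lemma omega_S_nonpos:
  assumes "r > 0" "m > 0"
  shows "omega_S m z r \<le> 0"
proof -
  define R where "R = sqrt ((z - m)\<^sup>2 + r\<^sup>2) + sqrt ((z + m)\<^sup>2 + r\<^sup>2)"
  have "\<bar>z - m\<bar> \<le> sqrt ((z - m)\<^sup>2 + r\<^sup>2)" "\<bar>z + m\<bar> \<le> sqrt ((z + m)\<^sup>2 + r\<^sup>2)"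
    by (rule real_le_rsqrt; simp)+
  then have R: "2 * m \<le> R" unfolding R_def by linarith
  have "(R - 2 * m) / (R + 2 * m) \<le> 1" using R assms by (simp add: divide_le_eq)
  moreover have "0 \<le> (R - 2 * m) / (R + 2 * m)" using R assms by simp
  ultimately have "ln ((R - 2 * m) / (R + 2 * m)) \<le> 0"
    by (cases "(R - 2 * m) / (R + 2 * m) = 0") (auto simp: less_le intro: ln_le_zero_iff[THEN iffD2])
  then show ?thesis unfolding omega_S_def Let_def R_def .
qed

lemma sqrt_sum_le:
  assumes "0 < e" "e \<le> a" "0 < (r::real)"
  shows "sqrt (a\<^sup>2 + r\<^sup>2) \<le> a + r\<^sup>2 / (2 * e)" "a < sqrt (a\<^sup>2 + r\<^sup>2)"
proof -
  have "a\<^sup>2 + r\<^sup>2 \<le> (a + r\<^sup>2 / (2 * e))\<^sup>2"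
  proof -
    have "e * (r\<^sup>2 / e) \<le> a * (r\<^sup>2 / e)" using assms by (intro mult_right_mono) auto
    then have "r\<^sup>2 \<le> 2 * a * (r\<^sup>2 / (2 * e))" using assms by simp
    then show ?thesis unfolding power2_sum using zero_le_power2[of "r\<^sup>2 / (2 * e)"] by linarith
  qed
  moreover have "0 \<le> a + r\<^sup>2 / (2 * e)" using assms by (intro add_nonneg_nonneg) auto
  ultimately show "sqrt (a\<^sup>2 + r\<^sup>2) \<le> a + r\<^sup>2 / (2 * e)" by (rule real_le_lsqrt[rotated])
  have "sqrt (a\<^sup>2) < sqrt (a\<^sup>2 + r\<^sup>2)" using assms by (intro real_sqrt_less_mono) simp
  then show "a < sqrt (a\<^sup>2 + r\<^sup>2)" using assms by simp
qed

text \<open>R is the sum of the distances to the two poles. At distance at least e from both ends of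
  the rod it exceeds 2 m by at most \<open>r^2 / e\<close>, so the logarithm falls off like
  \<open>2 ln r\<close>.\<close>

lemma omega_S_horizon:
  assumes "0 < e" "\<bar>z\<bar> \<le> m - e" "r > 0"
  shows "omega_S m z r \<le> 2 * ln r - ln (4 * m * e)"
proof -
  have m: "m > 0" using assms by linarith
  define R where "R = sqrt ((z - m)\<^sup>2 + r\<^sup>2) + sqrt ((z + m)\<^sup>2 + r\<^sup>2)"
  have "R = sqrt ((m - z)\<^sup>2 + r\<^sup>2) + sqrt ((m + z)\<^sup>2 + r\<^sup>2)"
    unfolding R_def by (simp add: power2_commute add.commute)
  then have R: "2 * m < R" "R \<le> 2 * m + r\<^sup>2 / e"
  proof -
    have "e \<le> m - z" "e \<le> m + z" using assms(2) by linarith+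
    note a = sqrt_sum_le[OF assms(1) this(1) assms(3)] sqrt_sum_le[OF assms(1) this(2) assms(3)]
    have "r\<^sup>2 / e = r\<^sup>2 / (2 * e) + r\<^sup>2 / (2 * e)" by simp
    then show "2 * m < R" "R \<le> 2 * m + r\<^sup>2 / e"
      using a \<open>R = sqrt ((m - z)\<^sup>2 + r\<^sup>2) + sqrt ((m + z)\<^sup>2 + r\<^sup>2)\<close> by linarith+
  qed
  have "(R - 2 * m) / (R + 2 * m) \<le> (r\<^sup>2 / e) / (4 * m)"
    using R m assms by (intro frac_le) auto
  then have "ln ((R - 2 * m) / (R + 2 * m)) \<le> ln ((r\<^sup>2 / e) / (4 * m))"
    using R m by (intro ln_mono) auto
  also have "\<dots> = 2 * ln r - ln (4 * m * e)"
    using m assms by (simp add: ln_div ln_mult ln_realpow)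
  finally show ?thesis unfolding omega_S_def Let_def R_def .
qed

text \<open>As F is bounded near \<rho> = 0, \<open>ln \<eta>\<close> is at least
  \<open>2 ln r\<close> minus a constant everywhere, and bounded below on the horizon shortened by e
  at both ends. Integrating this step function gives the slope
  \<open>2 L - 4 (m - e)\<close>.\<close>

lemma eta_boundary_mean:
  fixes \<eta> :: "real \<Rightarrow> real \<Rightarrow> real"
  assumes bd: "eta_boundary L m \<eta>" and L: "L < 4 * m" "0 < m" "m < L / 2"
    and cont: "continuous_on half_plane (\<lambda>p. ln (\<eta> (fst p) (snd p)))"
  obtains s C where "s < L" "\<And>r. 0 < r \<Longrightarrow> r \<le> 1 \<Longrightarrow> s * ln r - C \<le> mean L (\<lambda>p. ln (\<eta> (fst p) (snd p))) r"
proof -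
  obtain F where F: "continuous_on ({- (L / 2)..L / 2} \<times> {0..}) F"
    and F': "\<forall>z \<rho>. \<bar>z\<bar> \<le> L / 2 \<and> \<rho> > 0 \<longrightarrow> F (z, \<rho>) = ln (\<eta> z \<rho>) - 2 * ln \<rho> + omega_S m z \<rho>"
    using bd[unfolded eta_boundary_def, THEN conjunct1] by blast
  have "bounded (F ` ({- (L / 2)..L / 2} \<times> {0..1}))"
    by (intro compact_imp_bounded compact_continuous_image continuous_on_subset[OF F] compact_Times) auto
  then obtain B where B0: "\<forall>y\<in>F ` ({- (L / 2)..L / 2} \<times> {0..1}). norm y \<le> B"
    unfolding bounded_iff by (elim exE)
  then have B: "- B \<le> F (z, \<rho>)" if "z \<in> {- (L / 2)..L / 2}" "\<rho> \<in> {0..1}" for z \<rho>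
  proof -
    have "norm (F (z, \<rho>)) \<le> B" using bspec[OF B0 imageI[of "(z, \<rho>)"]] that by simp
    then show ?thesis by (simp add: abs_le_iff)
  qed
  \<comment> \<open>Half of the available slack: \<open>4 (m - e) = 2 m + L / 2\<close>, which still
    exceeds L.\<close>
  define e where "e = (m - L / 4) / 2"
  have e: "0 < e" "e < m" "L < 4 * (m - e)" "m - e < L / 2" using L by (simp_all add: e_def field_simps)
  define B' where "B' = B + \<bar>ln (4 * m * e)\<bar>"
  show ?thesis
  proof (rule that[of "2 * L - 4 * (m - e)" "L * B'"])
    show "2 * L - 4 * (m - e) < L" using e by simp
    fix r :: real assume r: "0 < r" "r \<le> 1"
    let ?S = "{- (m - e)..m - e}"
    define u where "u = (\<lambda>z. (2 * ln r - B') + (if z \<in> ?S then - 2 * ln r else 0))"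
    have "((\<lambda>z. - 2 * ln r) has_integral (2 * (m - e)) * (- 2 * ln r)) ?S"
      using has_integral_const_real[of "- 2 * ln r" "- (m - e)" "m - e"] e by simp
    then have "((\<lambda>z. if z \<in> ?S then - 2 * ln r else 0) has_integral (2 * (m - e)) * (- 2 * ln r)) {- (L / 2)..L / 2}"
      by (subst has_integral_restrict) (use e in auto)
    moreover have "((\<lambda>z. 2 * ln r - B') has_integral L * (2 * ln r - B')) {- (L / 2)..L / 2}"
      using has_integral_const_real[of "2 * ln r - B'" "- (L / 2)" "L / 2"] L by simp
    ultimately have u: "(u has_integral (L * (2 * ln r - B') + (2 * (m - e)) * (- 2 * ln r))) {- (L / 2)..L / 2}"
      unfolding u_def by (rule has_integral_add[rotated])
    have ule: "u z \<le> ln (\<eta> z r)" if z: "z \<in> {- (L / 2)..L / 2}" for z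
    proof -
      have "F (z, r) = ln (\<eta> z r) - 2 * ln r + omega_S m z r" using F' z r by auto
      moreover have "- B \<le> F (z, r)" using B z r by auto
      moreover have "omega_S m z r \<le> 0" using r L by (intro omega_S_nonpos)
      moreover have "omega_S m z r \<le> 2 * ln r - ln (4 * m * e)" if "z \<in> ?S"
        using that e r by (intro omega_S_horizon) auto
      ultimately show ?thesis by (auto simp: u_def B'_def abs_if split: if_splits)
    qed
    have "((\<lambda>z. ln (\<eta> z r)) has_integral mean L (\<lambda>p. ln (\<eta> (fst p) (snd p))) r) {- (L / 2)..L / 2}"
      unfolding mean_def using integrable_slice[OF cont r(1)] by (simp add: integrable_integral)
    from has_integral_le[OF u this ule] have "L * (2 * ln r - B') + (2 * (m - e)) * (- 2 * ln r) \<le> mean L (\<lambda>p. ln (\<eta> (fst p) (snd p))) r" .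
    then show "(2 * L - 4 * (m - e)) * ln r - L * B' \<le> mean L (\<lambda>p. ln (\<eta> (fst p) (snd p))) r"
      by (simp add: algebra_simps)
  qed
qed

lemma cjet_half_plane:
  assumes C2: "C2 g" and w: "0 < Im w"
  shows "cjet (\<lambda>w. curry g (Re w) (Im w + 1))
    (\<lambda>w. of_real (dz g (Re w, Im w + 1)) - \<i> * of_real (dr g (Re w, Im w + 1)))
    (\<lambda>h. of_real (Re h * dz (dz g) (Re w, Im w + 1) + Im h * dr (dz g) (Re w, Im w + 1))
       - \<i> * of_real (Re h * dz (dr g) (Re w, Im w + 1) + Im h * dr (dr g) (Re w, Im w + 1))) w"
proof -
  have q: "((\<lambda>w. (Re w, Im w + 1)) has_derivative (\<lambda>h. (Re h, Im h))) (at w)" for w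
    by (auto intro!: derivative_eq_intros)
  have comp: "((\<lambda>w. F (Re w, Im w + 1)) has_derivative (\<lambda>h. Re h * a + Im h * b)) (at w)"
    if "grad_at F a b (Re w, Im w + 1)" for F a b w
    using has_derivative_compose[OF q that[unfolded grad_at_def]] by simp
  have hp: "(Re w, Im w + 1) \<in> half_plane" if "Im w > - 1" for w using that by simp
  have "\<forall>\<^sub>F v in nhds w. v \<in> {v. Im v > - 1}"
    using w by (intro eventually_nhds_in_open) (auto simp: open_halfspace_Im_gt)
  then have "\<forall>\<^sub>F v in nhds w. ((\<lambda>w. curry g (Re w) (Im w + 1)) has_derivative
    (\<lambda>h. Re ((of_real (dz g (Re v, Im v + 1)) - \<i> * of_real (dr g (Re v, Im v + 1))) * h))) (at v)"
  proof eventually_elim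
    case (elim v)
    have "((\<lambda>w. g (Re w, Im w + 1)) has_derivative
      (\<lambda>h. Re h * dz g (Re v, Im v + 1) + Im h * dr g (Re v, Im v + 1))) (at v)"
      by (rule comp[OF C2_grad(1)[OF C2 hp]]) (use elim in simp)
    moreover have "(\<lambda>h. Re h * dz g (Re v, Im v + 1) + Im h * dr g (Re v, Im v + 1))
      = (\<lambda>h. Re ((of_real (dz g (Re v, Im v + 1)) - \<i> * of_real (dr g (Re v, Im v + 1))) * h))"
      by (rule ext) (simp add: algebra_simps)
    ultimately show ?case by (simp only: curry_def)
  qed
  moreover have hpw: "(Re w, Im w + 1) \<in> half_plane" using w by simp
  ultimately show ?thesis
    unfolding cjet_def
    by (intro conjI has_derivative_diff has_derivative_mult_right has_derivative_of_real
        comp[OF C2_grad(2)[OF C2 hpw]] comp[OF C2_grad(3)[OF C2 hpw]])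
qed

section \<open>One rotating black hole with L < 4 m is contradictory\<close>

context weyl_vacuum
begin

text \<open>The left-hand side is the \<rho>-derivative of \<open>\<rho> g_\<rho>\<close>. Between
  \<open>gamma_r\<close> and \<open>laplacian_gamma\<close> the terms in \<open>x_\<rho>\<close> and
  \<open>P_z\<close> cancel, and those left have one sign.\<close>

lemma Q_identity:
  assumes "p \<in> half_plane"
  shows "dr g p + snd p * dr (dr g) p =
    - snd p * dz (dz g) p - snd p / 2 * ((dz x p)\<^sup>2 + (Pr p)\<^sup>2 / (E p)\<^sup>2)"
proof -
  define a b where "a = (Pz p)\<^sup>2 / (E p)\<^sup>2" and "b = (Pr p)\<^sup>2 / (E p)\<^sup>2"
  have g: "dr g p = snd p / 4 * ((dr x p)\<^sup>2 - (dz x p)\<^sup>2 + (a - b))"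
    using gamma_r[OF assms] by (simp add: a_def b_def diff_divide_distrib)
  have l: "dr (dr g) p = - dz (dz g) p - ((dz x p)\<^sup>2 + (dr x p)\<^sup>2 + (a + b)) / 4"
  proof -
    have "((Pz p)\<^sup>2 + (Pr p)\<^sup>2) / (E p)\<^sup>2 = a + b" by (simp add: a_def b_def add_divide_distrib)
    then show ?thesis using laplacian_gamma[OF assms] by (simp add: field_simps)
  qed
  show ?thesis unfolding g l b_def[symmetric] by (simp add: field_simps)
qed

lemma continuous_flux:
  "continuous_on half_plane Pr" "continuous_on half_plane Prr"
proof -
  note e = C2_continuous[OF C2E] and w = C2_continuous[OF C2W]
  have r: "p \<in> half_plane \<Longrightarrow> snd p \<noteq> 0" for p :: "real \<times> real" by auto
  show P: "continuous_on half_plane Pr"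
    unfolding Pr_def[abs_def] by (intro continuous_intros e w) (use r in auto)
  show "continuous_on half_plane Prr"
    unfolding Prr_def[abs_def] by (intro continuous_intros e w P) (use r in auto)
qed

text \<open>Integrate \<open>|t| \<le> (1 + t^2) / 2\<close> with t = \<open>x_z\<close>. This turns
  the bound on the mean of x into a pointwise bound on \<eta>.\<close>

lemma x_oscillation:
  assumes L: "L > 0" and r: "r > 0" and small: "mean L (\<lambda>p. (dz x p)\<^sup>2) r \<le> 1"
    and z: "z \<in> {- (L / 2)..L / 2}" and w: "w \<in> {- (L / 2)..L / 2}"
  shows "x (z, r) \<le> x (w, r) + (L + 1) / 2"
proof -
  note c = C2_continuous[OF C2_x(1)]
  define h where "h = (\<lambda>z. (1 + (dz x (z, r))\<^sup>2) / 2)"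
  have conth: "continuous_on S h" for S
    unfolding h_def by (intro continuous_intros continuous_on_slice[OF c(2) r]) simp
  have inth: "h integrable_on {a..b}" for a b by (rule integrable_continuous_real[OF conth])
  have "integral {- (L / 2)..L / 2} h = mean L (\<lambda>p. (1 / 2) * 1 + (1 / 2) * (dz x p)\<^sup>2) r"
    unfolding mean_def h_def by (simp add: add_divide_distrib)
  also have "\<dots> = (1 / 2) * (L * 1) + (1 / 2) * mean L (\<lambda>p. (dz x p)\<^sup>2) r"
    by (subst mean_combination) (use r L in \<open>auto intro!: continuous_intros c simp: mean_const\<close>)
  also have "\<dots> \<le> (L + 1) / 2" using small by simp
  finally have I: "integral {- (L / 2)..L / 2} h \<le> (L + 1) / 2" .
  have key: "\<bar>x (b, r) - x (a, r)\<bar> \<le> (L + 1) / 2" if ab: "a \<le> b" "- (L / 2) \<le> a" "b \<le> L / 2" for a b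
  proof -
    have f: "((\<lambda>z. dz x (z, r)) has_integral (x (b, r) - x (a, r))) {a..b}"
    proof (rule fundamental_theorem_of_calculus[OF ab(1)])
      fix s
      have "(s, r) \<in> half_plane" using r by simp
      from grad_at_slice_z[OF C2_grad(1)[OF C2_x(1) this]]
      show "((\<lambda>z. x (z, r)) has_vector_derivative dz x (s, r)) (at s within {a..b})"
        unfolding has_real_derivative_iff_has_vector_derivative[symmetric] by (rule has_field_derivative_at_within)
    qed
    have hi: "(h has_integral integral {a..b} h) {a..b}" using inth by (rule integrable_integral)
    have ineq: "t \<le> (1 + t\<^sup>2) / 2" "- t \<le> (1 + t\<^sup>2) / 2" for t :: real
      using zero_le_power2[of "t - 1"] zero_le_power2[of "t + 1"] by (simp_all add: power2_eq_square algebra_simps)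
    have "x (b, r) - x (a, r) \<le> integral {a..b} h"
      by (rule has_integral_le[OF f hi]) (simp only: h_def ineq)
    moreover have "- (x (b, r) - x (a, r)) \<le> integral {a..b} h"
      by (rule has_integral_le[OF has_integral_neg[OF f] hi]) (simp only: h_def ineq)
    moreover have "integral {a..b} h \<le> integral {- (L / 2)..L / 2} h"
      by (rule integral_subset_le) (use ab inth in \<open>auto simp: h_def\<close>)
    ultimately show ?thesis using I by linarith
  qed
  show ?thesis
  proof (cases "z \<le> w")
    case True
    have "\<bar>x (w, r) - x (z, r)\<bar> \<le> (L + 1) / 2" using z w True by (intro key) auto
    then show ?thesis by linarith
  next
    case False
    have "\<bar>x (z, r) - x (w, r)\<bar> \<le> (L + 1) / 2" using z w False by (intro key) auto
    then show ?thesis by linarith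
  qed
qed

lemma no_rotation:
  assumes L: "0 < m" "m < L / 2" "L < 4 * m"
    and per: "periodic L W" "periodic L E" "periodic L g"
    and bd: "eta_boundary L m (curry E)"
    and J: "angular_momentum L weyl_g \<noteq> 0"
    and complete: "q_complete_at_infinity L (curry g)"
  shows False
proof -
  have L0: "L > 0" using L by linarith
  note cx = C2_continuous[OF C2_x(1)] and cg = C2_continuous[OF C2g]
  have perx: "periodic L x" using per(2) by (simp add: periodic_def x_def)
  have pdz: "periodic L (dz F)" if "C2 F" "periodic L F" for F
    by (rule periodic_grad(1)[OF that(2)]) (rule C2_grad(1)[OF that(1)])
  have md: "(mean L F has_real_derivative mean L (dr F) r) (at r)"
    "(mean L (dr F) has_real_derivative mean L (dr (dr F)) r) (at r)"
    "mean L (dz (dz F)) r = 0" if F: "C2 F" "periodic L F" and r: "r > 0" for F r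
  proof -
    show "(mean L F has_real_derivative mean L (dr F) r) (at r)"
      using C2_grad(1)[OF F(1)] by (intro mean_derivative C2_continuous[OF F(1)] r exI)
    show "(mean L (dr F) has_real_derivative mean L (dr (dr F)) r) (at r)"
      using C2_grad(3)[OF F(1)] by (intro mean_derivative C2_continuous[OF F(1)] r exI)
    show "mean L (dz (dz F)) r = 0"
      using C2_grad(2)[OF F(1)] by (intro mean_z_derivative[where F = "dz F"] pdz F L0 r exI)
  qed
  have rd: "((\<lambda>r. r * mean L (dr F) r) has_real_derivative mean L (\<lambda>p. 1 * dr F p + r * dr (dr F) p) r) (at r)"
    if F: "C2 F" "periodic L F" and r: "r > 0" for F r
  proof -
    have "((\<lambda>r. r * mean L (dr F) r) has_real_derivative 1 * mean L (dr F) r + mean L (dr (dr F)) r * r) (at r)"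
      by (rule DERIV_mult[OF DERIV_ident md(2)[OF F r]])
    then show ?thesis
      by (subst mean_combination) (use C2_continuous[OF F(1)] r in \<open>auto simp: mult.commute\<close>)
  qed

  define X where "X = mean L x"
  define Y where "Y = (\<lambda>r. r * mean L (dr x) r)"
  have Y_anti: "Y b \<le> Y a" if ab: "0 < a" "a \<le> b" for a b
  proof (rule decreasing_le[OF ab(2)])
    fix r assume "a \<le> r"
    then have r: "r > 0" using ab by linarith
    show "(Y has_real_derivative mean L (\<lambda>p. 1 * dr x p + r * dr (dr x) p) r) (at r)"
      unfolding Y_def by (rule rd[OF C2_x(1) perx r])
    have "mean L (\<lambda>p. 1 * dr x p + r * dr (dr x) p) r \<le> mean L (\<lambda>p. - r * dz (dz x) p + 0 * dz (dz x) p) r"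
    proof (rule mean_mono)
      fix z
      have p: "(z, r) \<in> half_plane" using r by simp
      have "r * (dz (dz x) (z, r) + dr (dr x) (z, r) + dr x (z, r) / r) \<le> r * 0"
        using laplacian_x[OF p] r by (intro mult_left_mono) (auto intro!: divide_nonpos_nonneg)
      then show "1 * dr x (z, r) + r * dr (dr x) (z, r) \<le> - r * dz (dz x) (z, r) + 0 * dz (dz x) (z, r)"
        using r by (simp add: algebra_simps)
    qed (use r in \<open>auto intro!: continuous_intros cx\<close>)
    also have "\<dots> = 0"
      by (subst mean_combination) (use r md(3)[OF C2_x(1) perx r] in \<open>auto intro!: cx\<close>)
    finally show "mean L (\<lambda>p. 1 * dr x p + r * dr (dr x) p) r \<le> 0" .
  qed
  have X': "(X has_real_derivative Y r / r) (at r)" if "r > 0" for r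
    using md(1)[OF C2_x(1) perx that] that by (simp add: X_def Y_def)
  have e: "(\<lambda>p. ln (curry E (fst p) (snd p))) = x" by (rule ext) (simp add: x_def)
  obtain s C where s: "s < L" "\<And>r. 0 < r \<Longrightarrow> r \<le> 1 \<Longrightarrow> s * ln r - C \<le> X r"
  proof (rule eta_boundary_mean[OF bd L(3,1,2), unfolded e, OF cx(1)])
    fix s C assume "s < L" "\<And>r. 0 < r \<Longrightarrow> r \<le> 1 \<Longrightarrow> s * ln r - C \<le> mean L x r"
    then show ?thesis by (intro that[of s C]) (simp_all add: X_def)
  qed
  \<comment> \<open>If Y exceeded L at r1, it would do so on all of (0, r1], and X would fall
    towards \<rho> = 0 at least like \<open>c ln r\<close> with c > L > s, below the bound of
    \<open>eta_boundary_mean\<close>.\<close>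
  have YL: "Y r1 \<le> L" if r1: "r1 > 0" for r1
  proof (rule ccontr)
    define c where "c = Y r1"
    assume "\<not> Y r1 \<le> L"
    then have c: "c > s" using s(1) by (simp add: c_def)
    define K where "K = X r1 - c * ln r1"
    have up: "X r \<le> c * ln r + K" if r: "0 < r" "r \<le> r1" for r
    proof -
      have "- (X r1 - c * ln r1) \<le> - (X r - c * ln r)"
      proof (rule decreasing_le[OF r(2)])
        fix u assume u: "r \<le> u" "u \<le> r1"
        then have u0: "u > 0" using r by linarith
        show "((\<lambda>r. - (X r - c * ln r)) has_real_derivative - (Y u / u - c * (1 / u))) (at u)"
          using u0 by (intro DERIV_minus DERIV_diff X' DERIV_cmult DERIV_ln_divide)
        have "c / u \<le> Y u / u" using Y_anti[OF u0 u(2)] u0 by (intro divide_right_mono) (auto simp: c_def)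
        then show "- (Y u / u - c * (1 / u)) \<le> 0" by simp
      qed
      then show ?thesis by (simp add: K_def)
    qed
    \<comment> \<open>At \<open>r = exp (- T)\<close> the two bounds on X contradict each other once
      \<open>(c - s) * T\<close> exceeds \<open>|K + C|\<close>.\<close>
    define T where "T = max (max 0 (- ln r1)) ((\<bar>K + C\<bar> + 1) / (c - s))"
    have T: "0 \<le> T" "- ln r1 \<le> T" "(\<bar>K + C\<bar> + 1) / (c - s) \<le> T" by (auto simp: T_def)
    have "exp (- T) \<le> exp (ln r1)" using T by simp
    then have "X (exp (- T)) \<le> c * - T + K" using up[of "exp (- T)"] r1 by simp
    moreover have "s * - T - C \<le> X (exp (- T))" using s(2)[of "exp (- T)"] T by simp
    moreover have "\<bar>K + C\<bar> + 1 \<le> (c - s) * T" using T(3) c by (simp add: pos_divide_le_eq mult.commute)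
    ultimately show False by (simp add: algebra_simps)
  qed
  have XL: "X r \<le> X 1 + L * ln r" if r: "r \<ge> 1" for r
  proof -
    have "X r - L * ln r \<le> X 1 - L * ln 1"
    proof (rule decreasing_le[OF r])
      fix u :: real assume "1 \<le> u"
      then have u0: "u > 0" by linarith
      show "((\<lambda>r. X r - L * ln r) has_real_derivative (Y u / u - L * (1 / u))) (at u)"
        using u0 by (intro DERIV_diff X' DERIV_cmult DERIV_ln_divide)
      have "Y u / u \<le> L / u" using YL[OF u0] u0 by (intro divide_right_mono) auto
      then show "Y u / u - L * (1 / u) \<le> 0" by simp
    qed
    then show ?thesis by simp
  qed

  define J0 where "J0 = mean L Pr 1"
  have J0: "J0 \<noteq> 0" using angular_momentum_flux[OF J] by (simp add: J0_def mean_def)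
  have flux_const: "mean L Pr r = J0" if r: "r \<ge> 1" for r
  proof -
    have d: "(mean L Pr has_real_derivative mean L Prr u) (at u)" if "u > 0" for u
      by (rule mean_derivative[OF flux(2) continuous_flux(2) that])
    have perP: "periodic L Pz"
      using per(1,2) pdz[OF C2W per(1)] pdz[OF C2E per(2)] by (simp add: periodic_def Pz_def)
    have z: "mean L Prr u = 0" if "u > 0" for u
    proof -
      have "mean L Prr u = mean L (\<lambda>p. - Pzz p) u"
        unfolding mean_def
      proof (rule integral_cong)
        fix z
        have "(z, u) \<in> half_plane" using that by simp
        from flux(3)[OF this] show "Prr (z, u) = - Pzz (z, u)" by linarith
      qed
      also have "\<dots> = - mean L Pzz u" unfolding mean_def by simp
      also have "\<dots> = 0" using mean_z_derivative[OF flux(1) perP L0 that] by simp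
      finally show ?thesis .
    qed
    have "mean L Pr r \<le> mean L Pr 1"
      by (rule decreasing_le[OF r d]) (simp_all add: z)
    moreover have "- mean L Pr r \<le> - mean L Pr 1"
      by (rule decreasing_le[OF r DERIV_minus[OF d]]) (simp_all add: z)
    ultimately show ?thesis by (simp add: J0_def)
  qed

  define K where "K = exp (X 1 / L + (L + 1) / 2)"
  define Q where "Q = (\<lambda>p. (dz x p)\<^sup>2 + (Pr p)\<^sup>2 / (E p)\<^sup>2)"
  define \<epsilon> where "\<epsilon> = min 1 (J0\<^sup>2 / L / K\<^sup>2)"
  have K0: "K > 0" and \<epsilon>: "\<epsilon> > 0" using J0 L0 by (simp_all add: K_def \<epsilon>_def)
  have contQ: "continuous_on half_plane Q"
    unfolding Q_def
    by (intro continuous_intros cx continuous_flux(1) C2_continuous(1)[OF C2E]) (use pos in fastforce)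
  \<comment> \<open>Either the mean of \<open>x_z^2\<close> exceeds 1, or x oscillates so little
    that \<open>E \<le> K * r\<close> on the whole period. In the second case the constant flux
    keeps the mean of \<open>P_\<rho>^2\<close> above \<open>J0^2 / L\<close>.\<close>
  have Q_lower: "\<epsilon> \<le> r\<^sup>2 * mean L Q r" if r: "r \<ge> 1" for r
  proof -
    have r0: "r > 0" "r\<^sup>2 \<ge> 1" using r by (auto simp: one_le_power)
    show ?thesis
    proof (cases "mean L (\<lambda>p. (dz x p)\<^sup>2) r \<le> 1")
      case False
      have "mean L (\<lambda>p. (dz x p)\<^sup>2) r \<le> mean L Q r"
        by (rule mean_mono) (use r0 contQ in \<open>auto intro!: continuous_intros cx simp: Q_def\<close>)
      then have "1 * 1 \<le> r\<^sup>2 * mean L Q r" using False r0 by (intro mult_mono) auto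
      then show ?thesis by (simp add: \<epsilon>_def)
    next
      case True
      have E_le: "E (z, r) \<le> K * r" if z: "z \<in> {- (L / 2)..L / 2}" for z
      proof -
        have "mean L (\<lambda>p. x (z, r) - (L + 1) / 2) r \<le> X r"
          unfolding X_def
          by (rule mean_mono) (use r0 cx x_oscillation[OF L0 r0(1) True z] in \<open>auto simp: algebra_simps\<close>)
        then have "L * (x (z, r) - (L + 1) / 2) \<le> X 1 + L * ln r"
          unfolding mean_const[OF L0] using XL[OF r] by linarith
        then have "x (z, r) - (L + 1) / 2 \<le> (X 1 + L * ln r) / L" using L0 by (simp add: pos_le_divide_eq mult.commute)
        then have "x (z, r) \<le> X 1 / L + (L + 1) / 2 + ln r" using L0 by (simp add: add_divide_distrib)
        then have "exp (x (z, r)) \<le> exp (X 1 / L + (L + 1) / 2 + ln r)" by simp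
        then show ?thesis using r0 pos[of "(z, r)"] by (simp add: x_def K_def exp_add)
      qed
      \<comment> \<open>The average of \<open>Pr\<close> over a period; integrating
        \<open>(Pr - c)^2 \<ge> 0\<close> is Cauchy-Schwarz.\<close>
      define c where "c = J0 / L"
      have "mean L (\<lambda>p. (2 * c) * Pr p + (- c\<^sup>2) * 1) r \<le> mean L (\<lambda>p. (Pr p)\<^sup>2) r"
      proof (rule mean_mono)
        fix z
        have "0 \<le> (Pr (z, r) - c)\<^sup>2" by simp
        then show "(2 * c) * Pr (z, r) + (- c\<^sup>2) * 1 \<le> (Pr (z, r))\<^sup>2" by (simp add: power2_diff algebra_simps)
      qed (use r0 in \<open>auto intro!: continuous_intros continuous_flux\<close>)
      also have "mean L (\<lambda>p. (2 * c) * Pr p + (- c\<^sup>2) * 1) r = (2 * c) * J0 + (- c\<^sup>2) * (L * 1)"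
        by (subst mean_combination) (use r0 L0 flux_const[OF r] in \<open>auto intro!: continuous_flux simp: mean_const\<close>)
      also have "\<dots> = J0\<^sup>2 / L" using L0 by (simp add: c_def field_simps power2_eq_square)
      finally have PP: "J0\<^sup>2 / L \<le> mean L (\<lambda>p. (Pr p)\<^sup>2) r" .
      have 1: "mean L (\<lambda>p. (1 / (K * r)\<^sup>2) * (Pr p)\<^sup>2 + 0 * (Pr p)\<^sup>2) r \<le> mean L Q r"
      proof (rule mean_mono)
        fix z assume z: "z \<in> {- (L / 2)..L / 2}"
        have E: "0 < E (z, r)" using pos[of "(z, r)"] r0 by simp
        have "(E (z, r))\<^sup>2 \<le> (K * r)\<^sup>2" using E_le[OF z] E by (intro power_mono) auto
        then have "(Pr (z, r))\<^sup>2 / (K * r)\<^sup>2 \<le> (Pr (z, r))\<^sup>2 / (E (z, r))\<^sup>2"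
          using E by (intro divide_left_mono) (auto intro!: mult_pos_pos simp: K0 r0 zero_less_power2 less_imp_neq[OF K0, symmetric])
        then show "(1 / (K * r)\<^sup>2) * (Pr (z, r))\<^sup>2 + 0 * (Pr (z, r))\<^sup>2 \<le> Q (z, r)"
          unfolding Q_def by (simp add: add_increasing)
      qed (use r0 contQ K0 in \<open>auto intro!: continuous_intros continuous_flux\<close>)
      have 2: "mean L (\<lambda>p. (1 / (K * r)\<^sup>2) * (Pr p)\<^sup>2 + 0 * (Pr p)\<^sup>2) r
         = (1 / (K * r)\<^sup>2) * mean L (\<lambda>p. (Pr p)\<^sup>2) r + 0 * mean L (\<lambda>p. (Pr p)\<^sup>2) r"
        by (rule mean_combination) (use r0 in \<open>auto intro!: continuous_intros continuous_flux\<close>)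
      have "(1 / (K * r)\<^sup>2) * mean L (\<lambda>p. (Pr p)\<^sup>2) r \<le> mean L Q r"
        using 1 unfolding 2 by simp
      then have "r\<^sup>2 * ((1 / (K * r)\<^sup>2) * mean L (\<lambda>p. (Pr p)\<^sup>2) r) \<le> r\<^sup>2 * mean L Q r"
        using r0 by (intro mult_left_mono) auto
      moreover have "r\<^sup>2 * ((1 / (K * r)\<^sup>2) * mean L (\<lambda>p. (Pr p)\<^sup>2) r) = mean L (\<lambda>p. (Pr p)\<^sup>2) r / K\<^sup>2"
        using r0 K0 by (simp add: field_simps power2_eq_square)
      moreover have "J0\<^sup>2 / L / K\<^sup>2 \<le> mean L (\<lambda>p. (Pr p)\<^sup>2) r / K\<^sup>2"
        by (rule divide_right_mono[OF PP]) simp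
      ultimately show ?thesis unfolding \<epsilon>_def by linarith
    qed
  qed

  define \<Gamma> where "\<Gamma> = mean L g"
  define Z where "Z = (\<lambda>r. r * mean L (dr g) r)"
  have Z_le: "Z r \<le> Z 1 - \<epsilon> / 2 * ln r" if r: "r \<ge> 1" for r
  proof -
    have "Z r + \<epsilon> / 2 * ln r \<le> Z 1 + \<epsilon> / 2 * ln 1"
    proof (rule decreasing_le[OF r])
      fix u :: real assume u: "1 \<le> u"
      then have u0: "u > 0" by linarith
      show "((\<lambda>r. Z r + \<epsilon> / 2 * ln r) has_real_derivative
          (mean L (\<lambda>p. 1 * dr g p + u * dr (dr g) p) u + \<epsilon> / 2 * (1 / u))) (at u)"
        unfolding Z_def by (intro DERIV_add rd[OF C2g per(3) u0] DERIV_cmult DERIV_ln_divide u0)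
      have "mean L (\<lambda>p. 1 * dr g p + u * dr (dr g) p) u \<le> mean L (\<lambda>p. (- u) * dz (dz g) p + (- (u / 2)) * Q p) u"
      proof (rule mean_mono)
        fix z
        have "(z, u) \<in> half_plane" using u0 by simp
        from Q_identity[OF this]
        show "1 * dr g (z, u) + u * dr (dr g) (z, u) \<le> (- u) * dz (dz g) (z, u) + (- (u / 2)) * Q (z, u)"
          by (simp add: Q_def)
      qed (use u0 contQ in \<open>auto intro!: continuous_intros cg\<close>)
      also have "\<dots> = (- u) * mean L (dz (dz g)) u + (- (u / 2)) * mean L Q u"
        by (rule mean_combination[OF cg(4) contQ u0])
      also have "\<dots> = - (u / 2) * mean L Q u" using md(3)[OF C2g per(3) u0] by simp
      finally have "mean L (\<lambda>p. 1 * dr g p + u * dr (dr g) p) u \<le> - (u\<^sup>2 * mean L Q u) / (2 * u)"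
        using u0 by (simp add: power2_eq_square)
      also have "\<dots> \<le> - \<epsilon> / (2 * u)" using Q_lower[OF u] u0 by (intro divide_right_mono) auto
      finally show "mean L (\<lambda>p. 1 * dr g p + u * dr (dr g) p) u + \<epsilon> / 2 * (1 / u) \<le> 0" by simp
    qed
    then show ?thesis by simp
  qed
  \<comment> \<open>Beyond r2 the logarithmic decrease of Z has used up its value at 1 and another 2
    L. Also \<open>r2 \<ge> 2\<close>, from where \<open>schwarz_pick\<close> applies.\<close>
  define r2 where "r2 = exp (2 * (\<bar>Z 1\<bar> + 2 * L) / \<epsilon> + 1)"
  have r2: "1 \<le> r2" "2 \<le> r2" "\<bar>Z 1\<bar> + 2 * L \<le> \<epsilon> / 2 * ln r2"
  proof -
    have t: "0 \<le> 2 * (\<bar>Z 1\<bar> + 2 * L) / \<epsilon>" using \<epsilon> L0 by simp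
    have "1 + (2 * (\<bar>Z 1\<bar> + 2 * L) / \<epsilon> + 1) \<le> r2" unfolding r2_def by (rule exp_ge_add_one_self)
    then show "1 \<le> r2" "2 \<le> r2" using t by linarith+
    show "\<bar>Z 1\<bar> + 2 * L \<le> \<epsilon> / 2 * ln r2" unfolding r2_def using \<epsilon> by (simp add: field_simps)
  qed
  have Z2: "Z r \<le> - 2 * L" if r: "r2 \<le> r" for r
  proof -
    have "\<epsilon> / 2 * ln r2 \<le> \<epsilon> / 2 * ln r" using \<epsilon> r r2 by (intro mult_left_mono ln_mono) auto
    then show ?thesis using Z_le[of r] r r2 by linarith
  qed
  have upper: "\<Gamma> r \<le> \<Gamma> r2 + 2 * L * ln r2 - 2 * L * ln r" if r: "r2 \<le> r" for r
  proof -
    have "\<Gamma> r + 2 * L * ln r \<le> \<Gamma> r2 + 2 * L * ln r2"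
    proof (rule decreasing_le[OF r])
      fix u assume u: "r2 \<le> u"
      then have u0: "u > 0" using r2 by linarith
      show "((\<lambda>r. \<Gamma> r + 2 * L * ln r) has_real_derivative mean L (dr g) u + 2 * L * (1 / u)) (at u)"
        unfolding \<Gamma>_def by (intro DERIV_add md(1)[OF C2g per(3) u0] DERIV_cmult DERIV_ln_divide u0)
      have "mean L (dr g) u + 2 * L * (1 / u) = (Z u + 2 * L) / u" using u0 by (simp add: Z_def field_simps)
      also have "\<dots> \<le> 0" using Z2[OF u] u0 by (intro divide_nonpos_pos) auto
      finally show "mean L (dr g) u + 2 * L * (1 / u) \<le> 0" .
    qed
    then show ?thesis by simp
  qed

  have contg: "continuous_on half_plane (\<lambda>(z, \<rho>). curry g z \<rho>)" using cg(1) by simp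
  have perg: "curry g (z + L) \<rho> = curry g z \<rho>" if "\<rho> > 0" for z \<rho>
    using per(3) that by (simp add: periodic_def)
  have contg12: "continuous_on (UNIV \<times> {1..2}) (\<lambda>(z, \<rho>). curry g z \<rho>)"
    by (rule continuous_on_subset[OF contg]) auto
  obtain c where c: "\<And>z \<rho>. \<rho> \<in> {1..2} \<Longrightarrow> c \<le> curry g z \<rho>"
  proof -
    obtain c C where "\<And>z \<rho>. \<rho> \<in> {1..2} \<Longrightarrow> c \<le> curry g z \<rho> \<and> curry g z \<rho> \<le> C"
      by (rule periodic_strip_bounds[OF L0 _ contg12]) (use perg in auto)
    then show ?thesis using that by meson
  qed
  have lower: "c - ln 2 - ln r \<le> g (z, r)" if r: "r \<ge> 2" for z r
  proof -
    have "exp c \<le> exp (curry g (Re (Complex z (r - 1))) (Im (Complex z (r - 1)) + 1)) * (2 * Im (Complex z (r - 1)))"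
    proof (rule schwarz_pick[OF L0 complete perg contg cjet_half_plane[OF C2g]])
      fix w :: complex assume "0 < Im w"
      then have p: "(Re w, Im w + 1) \<in> half_plane" by simp
      have "0 \<le> (dz x p)\<^sup>2 + (dr x p)\<^sup>2 + ((Pz p)\<^sup>2 + (Pr p)\<^sup>2) / (E p)\<^sup>2" for p by simp
      then have "dz (dz g) (Re w, Im w + 1) + dr (dr g) (Re w, Im w + 1) \<le> 0"
        unfolding laplacian_gamma[OF p] by (metis divide_nonpos_pos neg_le_0_iff_le zero_less_numeral)
      then show "Re (of_real (Re 1 * dz (dz g) (Re w, Im w + 1) + Im 1 * dr (dz g) (Re w, Im w + 1))
          - \<i> * of_real (Re 1 * dz (dr g) (Re w, Im w + 1) + Im 1 * dr (dr g) (Re w, Im w + 1))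
          + \<i> * (of_real (Re \<i> * dz (dz g) (Re w, Im w + 1) + Im \<i> * dr (dz g) (Re w, Im w + 1))
          - \<i> * of_real (Re \<i> * dz (dr g) (Re w, Im w + 1) + Im \<i> * dr (dr g) (Re w, Im w + 1)))) \<le> 0"
        by simp
    qed (use c r in auto)
    then have "exp c \<le> exp (g (z, r)) * (2 * (r - 1))" by simp
    also have "\<dots> \<le> exp (g (z, r)) * (2 * r)" by (intro mult_left_mono) auto
    finally have "ln (exp c) \<le> ln (exp (g (z, r)) * (2 * r))" using r by (intro ln_mono) auto
    then show ?thesis using r by (simp add: ln_mult)
  qed
  have low: "L * (c - ln 2 - ln r) \<le> \<Gamma> r" if r: "r2 \<le> r" for r
  proof -
    have "mean L (\<lambda>p. c - ln 2 - ln r) r \<le> \<Gamma> r"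
      unfolding \<Gamma>_def by (rule mean_mono) (use r r2 cg lower[of r] in auto)
    then show ?thesis unfolding mean_const[OF L0] .
  qed
  \<comment> \<open>The mean of \<gamma> is bounded below with slope -L and above with slope -2 L in
    \<open>ln r\<close>; at \<open>r = exp T\<close> with \<open>L * T > B\<close> these are
    incompatible.\<close>
  define B where "B = \<Gamma> r2 + 2 * L * ln r2 - L * (c - ln 2)"
  define T where "T = max (ln r2) (\<bar>B\<bar> / L + 1)"
  have "exp (ln r2) \<le> exp T" by (simp add: T_def)
  then have "r2 \<le> exp T" using r2 by simp
  then have "L * (c - ln 2 - T) \<le> \<Gamma> r2 + 2 * L * ln r2 - 2 * L * T"
    using low[of "exp T"] upper[of "exp T"] by simp
  then have "L * T \<le> B" by (simp add: B_def algebra_simps)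
  moreover have "L * (\<bar>B\<bar> / L + 1) \<le> L * T" using L0 by (intro mult_left_mono) (auto simp: T_def)
  ultimately show False using L0 by (simp add: algebra_simps)
qed

end

theorem theorem2:
  fixes L\<^sub>0 m\<^sub>0 :: real
  assumes "0 < 2 * m\<^sub>0" and "2 * m\<^sub>0 < L\<^sub>0" and "L\<^sub>0 / m\<^sub>0 < 4"
  shows "\<not> (\<exists>(I :: real set) (L :: real \<Rightarrow> real) (m :: real \<Rightarrow> real)
             (V :: real \<Rightarrow> real \<Rightarrow> real \<Rightarrow> real) (W :: real \<Rightarrow> real \<Rightarrow> real \<Rightarrow> real)
             (\<eta> :: real \<Rightarrow> real \<Rightarrow> real \<Rightarrow> real) (\<gamma> :: real \<Rightarrow> real \<Rightarrow> real \<Rightarrow> real).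
           is_interval I \<and> 0 \<in> I \<and> I \<noteq> {0} \<and>
           (\<forall>l\<in>I. periodic_black_hole (L l) (m l) (V l) (W l) (\<eta> l) (\<gamma> l)) \<and>
           L 0 = L\<^sub>0 \<and> m 0 = m\<^sub>0 \<and> is_MKN L\<^sub>0 m\<^sub>0 (V 0) (W 0) (\<eta> 0) (\<gamma> 0) \<and>
           continuous_on I (\<lambda>l. L l / m l) \<and>
           (\<forall>l\<in>I. l \<noteq> 0 \<longrightarrow> angular_momentum (L l) (weyl_metric (V l) (W l) (\<eta> l) (\<gamma> l)) \<noteq> 0) \<and>
           (\<forall>l\<in>I. q_complete_at_infinity (L l) (\<gamma> l)))"
proof
  assume "\<exists>(I :: real set) L m V W \<eta> \<gamma>.
           is_interval I \<and> 0 \<in> I \<and> I \<noteq> {0} \<and>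
           (\<forall>l\<in>I. periodic_black_hole (L l) (m l) (V l) (W l) (\<eta> l) (\<gamma> l)) \<and>
           L 0 = L\<^sub>0 \<and> m 0 = m\<^sub>0 \<and> is_MKN L\<^sub>0 m\<^sub>0 (V 0) (W 0) (\<eta> 0) (\<gamma> 0) \<and>
           continuous_on I (\<lambda>l. L l / m l) \<and>
           (\<forall>l\<in>I. l \<noteq> 0 \<longrightarrow> angular_momentum (L l) (weyl_metric (V l) (W l) (\<eta> l) (\<gamma> l)) \<noteq> 0) \<and>
           (\<forall>l\<in>I. q_complete_at_infinity (L l) (\<gamma> l))"
  then obtain I :: "real set" and L m :: "real \<Rightarrow> real" and V W \<eta> \<gamma> :: "real \<Rightarrow> real \<Rightarrow> real \<Rightarrow> real" where
    I: "is_interval I" "0 \<in> I" "I \<noteq> {0}"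
    and bh: "\<forall>l\<in>I. periodic_black_hole (L l) (m l) (V l) (W l) (\<eta> l) (\<gamma> l)"
    and L0: "L 0 = L\<^sub>0" "m 0 = m\<^sub>0"
    and cont: "continuous_on I (\<lambda>l. L l / m l)"
    and J: "\<forall>l\<in>I. l \<noteq> 0 \<longrightarrow> angular_momentum (L l) (weyl_metric (V l) (W l) (\<eta> l) (\<gamma> l)) \<noteq> 0"
    and complete: "\<forall>l\<in>I. q_complete_at_infinity (L l) (\<gamma> l)"
    by (elim exE conjE) rule
  obtain l1 where l1: "l1 \<in> I" "l1 \<noteq> 0" using I by auto
  obtain \<delta> where \<delta>: "\<delta> > 0" "\<And>l. l \<in> I \<Longrightarrow> dist l 0 < \<delta> \<Longrightarrow> dist (L l / m l) (L 0 / m 0) < 4 - L 0 / m 0"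
    using cont[unfolded continuous_on_iff, rule_format, OF I(2), of "4 - L 0 / m 0"] assms(3) L0 by auto
  \<comment> \<open>I may lie on either side of 0; shrinking a nonzero member towards 0 stays in I
    by convexity and comes within \<delta> of 0 without reaching it.\<close>
  define t where "t = min 1 (\<delta> / (2 * \<bar>l1\<bar>))"
  have t: "0 < t" "t \<le> 1" "t * \<bar>l1\<bar> < \<delta>"
  proof -
    show "0 < t" "t \<le> 1" using \<delta>(1) l1 by (auto simp: t_def)
    have "t * \<bar>l1\<bar> \<le> \<delta> / (2 * \<bar>l1\<bar>) * \<bar>l1\<bar>" by (intro mult_right_mono) (auto simp: t_def)
    also have "\<dots> < \<delta>" using \<delta>(1) l1 by simp
    finally show "t * \<bar>l1\<bar> < \<delta>" .
  qed
  define l where "l = t * l1"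
  have "(1 - t) *\<^sub>R 0 + t *\<^sub>R l1 \<in> I"
    by (rule convexD) (use I l1 t is_interval_convex in auto)
  then have l: "l \<in> I" "l \<noteq> 0" using t l1 by (auto simp: l_def)
  have "dist l 0 < \<delta>" using t by (simp add: l_def abs_mult)
  from \<delta>(2)[OF l(1) this] have ratio: "L l / m l < 4" unfolding dist_real_def by linarith
  note B = bh[rule_format, OF l(1), unfolded periodic_black_hole_def]
  have m: "0 < m l" "m l < L l / 2" using B by blast+
  have sm: "smooth_on (\<lambda>(z, \<rho>). f z \<rho>) half_plane" "f (z + L l) \<rho> = f z \<rho>"
    if "f \<in> {V l, W l, \<eta> l, \<gamma> l}" "\<rho> > 0" for f z \<rho>
    using B that by blast+
  interpret weyl_vacuum "case_prod (V l)" "case_prod (W l)" "case_prod (\<eta> l)" "case_prod (\<gamma> l)"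
  proof
    show "C2 (case_prod (V l))" "C2 (case_prod (W l))" "C2 (case_prod (\<eta> l))" "C2 (case_prod (\<gamma> l))"
      by (intro smooth_on_C2 sm(1)[OF _ zero_less_one]; simp)+
    have pw: "\<forall>z. \<forall>\<rho>>0. \<eta> l z \<rho> > 0 \<and> V l z \<rho> * \<eta> l z \<rho> + (W l z \<rho>)\<^sup>2 = \<rho>\<^sup>2" using B by blast
    show "0 < case_prod (\<eta> l) p"
      "case_prod (V l) p * case_prod (\<eta> l) p + (case_prod (W l) p)\<^sup>2 = (snd p)\<^sup>2" if "p \<in> half_plane" for p
      using pw that by (auto simp: case_prod_unfold)
    have "\<forall>y\<in>weyl_domain. \<forall>b c. ricci (weyl_metric (V l) (W l) (\<eta> l) (\<gamma> l)) b c y = 0" using B by blast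
    then show "ricci (weyl_metric (curry (case_prod (V l))) (curry (case_prod (W l)))
        (curry (case_prod (\<eta> l))) (curry (case_prod (\<gamma> l)))) b c y = 0" if "y \<in> weyl_domain" for y b c
      using that by simp
  qed
  show False
  proof (rule no_rotation[of "m l" "L l"])
    show "L l < 4 * m l" using ratio m by (simp add: pos_divide_less_eq)
    show "periodic (L l) (case_prod (W l))" "periodic (L l) (case_prod (\<eta> l))" "periodic (L l) (case_prod (\<gamma> l))"
      using sm(2) by (simp_all add: periodic_def)
    show "eta_boundary (L l) (m l) (curry (case_prod (\<eta> l)))" using B by simp
    show "angular_momentum (L l) weyl_g \<noteq> 0" using J l by simp
    show "q_complete_at_infinity (L l) (curry (case_prod (\<gamma> l)))" using complete l by simp
  qed (use m in simp_all)
qed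

end
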